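(* Fix a dimension $d\ge 1$. For the Uniform Stochastic Online Euclidean TSP with $n$ points, the block-based phased algorithm described in the context is $O(\log^{2} n)$-competitive with probability at least $1-1/n$: there is a constant $D$ (depending only on $d$) such that for all sufficiently large $n$, with probability at least $1-1/n$ over the input, the cost of the algorithm is at most $D\log^{2} n\cdot \mathrm{OPT}$, where $\mathrm{OPT}$ is the length of an optimal (offline) travelling salesperson tour of the realized points.
   Context: Uniform Stochastic Online Euclidean TSP: an array $A[1..n]$ of initially empty cells is given; points $x_1,\dots,x_n\in[0,1]^d$ drawn i.i.d. uniformly from $[0,1]^d$ arrive online one by one, and each must be placed immediately and irrevocably into an empty cell; the cost is $\sum_{i=1}^{n-1}\|A[i+1]-A[i]\|$ (Euclidean norm). Logarithms are base 2. Let $\mathcal{B}$ denote Bertram's adversarial online Euclidean TSP algorithm, which is $O(\sqrt{m})$-competitive on $m$ points; "placing into a bucket using $\mathcal{B}$" means running it on the cells of that bucket. Preprocessing: let $\ell$ be the unique positive integer with $\frac{n}{4\log^2 n} < 2^\ell \le \frac{n}{2\log^2 n}$ (for large $n$, $d\le\ell$). Starting from the single block $[0,1]^d$, perform $\ell$ splits; split $t$ ($t=1,\dots,\ell$) halves every current block by a hyperplane perpendicular to coordinate $((t-1)\bmod d)+1$. This yields a grid of $K_1 = 2^\ell$ blocks, with $n_r\ge 2$ (a power of 2) blocks along coordinate $r$; index a block by $(v_1,\dots,v_d)\in\prod_r[n_r]$. Order the blocks $c_1,\dots,c_{K_1}$ by the following procedure: start with $v=(1,\dots,1)$ and direction vector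 $m=(1,\dots,1)$; while not ($v_r=1$ for all $r<d$ and $v_d=n_d$): set $j=1$; while $v_j+m_j>n_j$ or $v_j+m_j<1$, set $m_j\leftarrow -m_j$ and $j\leftarrow j+1$; then set $v_j\leftarrow v_j+m_j$; the successive values of $v$ give the order. Phases: as in the one-dimensional algorithm, the array is divided into consecutive subarrays $A_1,A_2,\dots$ with $|A_i|=\lfloor n/2^i\rfloor$, allocated while at least $100\log^2 n$ cells remain unallocated (last one $A_k$), followed by a final subarray $B$ of fewer than $100\log^2 n$ cells. Put $K_i = 2^{\ell-i+1}$; bucket $j\in[K_i]$ of $A_i$ receives the points lying in the region $c_{(j-1)2^{i-1}+1}\cup\dots\cup c_{j2^{i-1}}$ (points on shared boundaries assigned to one block by a fixed rule); inside each bucket points are placed with $\mathcal{B}$. Phase 1: $A_1$ is split into $K_1$ buckets of sizes $\lfloor C_1\rfloor$ or $\lfloor C_1\rfloor+1$ summing to $A_1$, $C_1=A_1/K_1$; each point goes to its bucket; when a point's bucket is full (overflow), Phase 2 begins. Phase $i\ge2$: with $N_{i-1}$ the number of points placed in $A_{i-1}$ up to its first overflow and $C_i=(A_{i-1}+A_i-N_{i-1})/K_i$, bin $j$ consists of the empty cells of buckets $2j-1,2j$ of $A_{i-1}$ and bucket $j$ of $A_i$; bin capacities are in $\{\lfloor C_i\rfloor,\lfloor C_i\rfloor+1\}$ summing to $A_{i-1}+A_i-N_{i-1}$, and bucket $j$ of $A_i$ has size equal to bin $j$'s capacity minus the empty cells of buckets $2j-1,2j$ of $A_{i-1}$. A point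 goes to its designated bucket in $A_{i-1}$ if it has room, else to its designated bucket in $A_i$; if that is full, Phase $i+1$ begins. Final phase: after $A_k$ overflows, the remaining points are placed in $B$ using $\mathcal{B}$. *)

theory Defs
  imports "HOL-Probability.Probability" "HOL-Library.While_Combinator"
begin

text \<open>Array cells and arriving points are numbered from 0; coordinates, blocks, subarrays, phases
  and buckets are numbered from 1.\<close>

definition unit_cube :: "(real ^ 'd) set" where
  "unit_cube = {x. \<forall>i. 0 \<le> x $ i \<and> x $ i \<le> 1}"

definition array_cost :: "nat \<Rightarrow> (nat \<Rightarrow> real ^ 'd) \<Rightarrow> real" where
  "array_cost n A = (\<Sum>i<n - 1. norm (A (Suc i) - A i))"

definition tour_length :: "(real ^ 'd) list \<Rightarrow> real" where
  "tour_length ys = (\<Sum>i<length ys. norm (ys ! (Suc i mod length ys) - ys ! i))"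

definition opt_tour :: "(real ^ 'd) list \<Rightarrow> real" where
  "opt_tour xs = Min (tour_length ` {ys. mset ys = mset xs})"

definition uniform_input :: "nat \<Rightarrow> (nat \<Rightarrow> real ^ 'd) measure" where
  "uniform_input n = Pi\<^sub>M {..<n} (\<lambda>_. uniform_measure lborel unit_cube)"

text \<open>A deterministic online algorithm \<open>\<B>\<close> is encoded by its decisions: \<open>\<B> m ps\<close> is the cell
  (in an array of \<open>m\<close> cells) given to the last point of \<open>ps\<close> when \<open>ps\<close> is the sequence of all
  points that have arrived so far.\<close>

type_synonym 'd online_alg = "nat \<Rightarrow> (real ^ 'd) list \<Rightarrow> nat"

definition online_placement :: "'d::finite online_alg \<Rightarrow> bool" where
  "online_placement \<B> \<longleftrightarrow>
    (\<forall>m ps. length ps \<le> m \<and> set ps \<subseteq> unit_cube \<longrightarrow>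
      (\<forall>t<length ps. \<B> m (take (Suc t) ps) < m) \<and>
      inj_on (\<lambda>t. \<B> m (take (Suc t) ps)) {..<length ps})"

definition final_array :: "'d online_alg \<Rightarrow> nat \<Rightarrow> (real ^ 'd) list \<Rightarrow> nat \<Rightarrow> real ^ 'd" where
  "final_array \<B> m ps c = ps ! inv_into {..<m} (\<lambda>t. \<B> m (take (Suc t) ps)) c"

definition sqrt_competitive :: "'d::finite online_alg \<Rightarrow> bool" where
  "sqrt_competitive \<B> \<longleftrightarrow> online_placement \<B> \<and>
    (\<exists>c. \<forall>m ps. length ps = m \<and> set ps \<subseteq> unit_cube \<longrightarrow>
      array_cost m (final_array \<B> m ps) \<le> c * sqrt (real m) * opt_tour ps)"

definition split_count :: "nat \<Rightarrow> nat" where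
  "split_count n = (THE l. 0 < l \<and> real n / (4 * (log 2 (real n))\<^sup>2) < 2 ^ l \<and>
                           2 ^ l \<le> real n / (2 * (log 2 (real n))\<^sup>2))"

text \<open>Each split perpendicular to coordinate \<open>r\<close> halves all blocks, hence doubles the number of
  (equally wide) blocks along \<open>r\<close>.\<close>

definition grid_size :: "nat \<Rightarrow> nat \<Rightarrow> nat \<Rightarrow> nat" where
  "grid_size d l r = 2 ^ card {t \<in> {1..l}. (t - 1) mod d + 1 = r}"

text \<open>The bijection \<open>e\<close> from \<open>{1..CARD('d)}\<close> numbers the coordinates.\<close>

definition block :: "(nat \<Rightarrow> 'd::finite) \<Rightarrow> nat \<Rightarrow> (nat \<Rightarrow> int) \<Rightarrow> (real ^ 'd) set" where
  "block e l v = {x. \<forall>r\<in>{1..CARD('d)}.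
      (of_int (v r) - 1) / real (grid_size CARD('d) l r) \<le> x $ e r \<and>
      x $ e r \<le> of_int (v r) / real (grid_size CARD('d) l r)}"

definition snake_step ::
  "nat \<Rightarrow> (nat \<Rightarrow> nat) \<Rightarrow> (nat \<Rightarrow> int) \<times> (nat \<Rightarrow> int) \<Rightarrow> (nat \<Rightarrow> int) \<times> (nat \<Rightarrow> int)" where
  "snake_step d N = (\<lambda>(v, m).
     if (\<forall>r\<in>{1..<d}. v r = 1) \<and> v d = int (N d) then (v, m)
     else
       let (m', j) = while (\<lambda>(m, j). v j + m j > int (N j) \<or> v j + m j < 1)
                           (\<lambda>(m, j). (m(j := - m j), j + 1)) (m, 1)
       in (v(j := v j + m' j), m'))"

definition snake :: "nat \<Rightarrow> (nat \<Rightarrow> nat) \<Rightarrow> nat \<Rightarrow> nat \<Rightarrow> int" where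
  "snake d N q = fst ((snake_step d N ^^ (q - 1)) (\<lambda>_. 1, \<lambda>_. 1))"

definition ordered_block :: "(nat \<Rightarrow> 'd::finite) \<Rightarrow> nat \<Rightarrow> nat \<Rightarrow> (real ^ 'd) set" where
  "ordered_block e l q = block e l (snake CARD('d) (grid_size CARD('d) l) q)"

definition sub_len :: "nat \<Rightarrow> nat \<Rightarrow> nat" where
  "sub_len n i = n div 2 ^ i"

definition unallocated :: "nat \<Rightarrow> nat \<Rightarrow> nat" where
  "unallocated n i = n - (\<Sum>i'=1..i. sub_len n i')"

definition last_sub :: "nat \<Rightarrow> nat" where
  "last_sub n = (LEAST i. real (unallocated n i) < 100 * (log 2 (real n))\<^sup>2)"

definition bucket_count :: "nat \<Rightarrow> nat \<Rightarrow> nat" where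
  "bucket_count n i = 2 ^ (split_count n + 1 - i)"

text \<open>What the description of the algorithm leaves open:
  \<^item> \<open>assign x\<close> is the index \<open>q\<close> of the block \<open>c\<^sub>q\<close> to which \<open>x\<close> is assigned (a real choice only on
    shared boundaries);
  \<^item> \<open>cap h T K j\<close> is the capacity of bin \<open>j\<close> when \<open>T\<close> cells are distributed over \<open>K\<close> bins, \<open>h\<close> being
    the points that have arrived so far;
  \<^item> \<open>spare h S\<close> is the cell used when the description prescribes no cell, \<open>S\<close> being the set of
    occupied cells. This concerns the points that are left when \<open>B\<close> is full, and all points after
    some bin got a capacity smaller than the number of empty cells it already contains.\<close>

record ('d::finite) choices =
  assign :: "real ^ 'd \<Rightarrow> nat"
  cap :: "(real ^ 'd) list \<Rightarrow> nat \<Rightarrow> nat \<Rightarrow> nat \<Rightarrow> nat"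
  spare :: "(real ^ 'd) list \<Rightarrow> nat set \<Rightarrow> nat"

definition valid_choices :: "nat \<Rightarrow> (nat \<Rightarrow> 'd::finite) \<Rightarrow> 'd choices \<Rightarrow> bool" where
  "valid_choices n e ch \<longleftrightarrow>
    (\<forall>x\<in>unit_cube. assign ch x \<in> {1..2 ^ split_count n} \<and>
       x \<in> ordered_block e (split_count n) (assign ch x)) \<and>
    (\<forall>h T K. K > 0 \<longrightarrow>
       (\<forall>j\<in>{1..K}. cap ch h T K j \<in> {T div K, T div K + 1}) \<and>
       (\<Sum>j=1..K. cap ch h T K j) = T) \<and>
    (\<forall>h S. S \<subset> {..<n} \<longrightarrow> spare ch h S \<in> {..<n} - S)"

text \<open>\<open>bsize s i j\<close> and \<open>bpts s i j\<close> are the size of bucket \<open>j\<close> of \<open>A\<^sub>i\<close> and the points placed there,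
  in order of arrival. With \<open>k = last_sub n\<close>, the final subarray \<open>B\<close> is treated as subarray \<open>k + 1\<close>
  with the single bucket 1, and the final phase is phase \<open>k + 1\<close>.\<close>

record ('d::finite) alg_state =
  phase :: nat
  stuck :: bool
  bsize :: "nat \<Rightarrow> nat \<Rightarrow> nat"
  bpts :: "nat \<Rightarrow> nat \<Rightarrow> (real ^ 'd) list"
  cells :: "nat \<Rightarrow> (real ^ 'd) option"

definition init_state :: "nat \<Rightarrow> 'd::finite choices \<Rightarrow> 'd alg_state" where
  "init_state n ch = \<lparr> phase = 1, stuck = False,
     bsize = (\<lambda>_ _. 0)(1 := cap ch [] (sub_len n 1) (bucket_count n 1)),
     bpts = (\<lambda>_ _. []), cells = (\<lambda>_. None) \<rparr>"

definition vacant :: "'d::finite alg_state \<Rightarrow> nat \<Rightarrow> nat \<Rightarrow> nat" where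
  "vacant s i j = bsize s i j - length (bpts s i j)"

text \<open>The unique \<open>j\<close> with \<open>(j - 1) * 2 ^ (i - 1) + 1 \<le> assign ch x \<le> j * 2 ^ (i - 1)\<close>.\<close>

definition bucket_of :: "'d::finite choices \<Rightarrow> nat \<Rightarrow> real ^ 'd \<Rightarrow> nat" where
  "bucket_of ch i x = (assign ch x - 1) div 2 ^ (i - 1) + 1"

definition bucket_start :: "nat \<Rightarrow> 'd::finite alg_state \<Rightarrow> nat \<Rightarrow> nat \<Rightarrow> nat" where
  "bucket_start n s i j = (\<Sum>i'=1..<i. sub_len n i') + (\<Sum>j'=1..<j. bsize s i j')"

definition put_bucket ::
  "nat \<Rightarrow> 'd::finite online_alg \<Rightarrow> nat \<Rightarrow> nat \<Rightarrow> real ^ 'd \<Rightarrow> 'd alg_state \<Rightarrow> 'd alg_state" where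
  "put_bucket n \<B> i j x s =
    (let ps = bpts s i j @ [x];
         c = bucket_start n s i j + \<B> (bsize s i j) ps
     in s\<lparr> bpts := (bpts s)(i := (bpts s i)(j := ps)), cells := (cells s)(c \<mapsto> x) \<rparr>)"

definition put_spare ::
  "'d::finite choices \<Rightarrow> (real ^ 'd) list \<Rightarrow> real ^ 'd \<Rightarrow> 'd alg_state \<Rightarrow> 'd alg_state" where
  "put_spare ch h x s = s\<lparr> cells := (cells s)(spare ch h (dom (cells s)) \<mapsto> x) \<rparr>"

definition overflows :: "nat \<Rightarrow> 'd::finite choices \<Rightarrow> real ^ 'd \<Rightarrow> 'd alg_state \<Rightarrow> bool" where
  "overflows n ch x s \<longleftrightarrow> \<not> stuck s \<and> phase s \<le> last_sub n \<and>
     (phase s \<ge> 2 \<longrightarrow> vacant s (phase s - 1) (bucket_of ch (phase s - 1) x) = 0) \<and>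
     vacant s (phase s) (bucket_of ch (phase s) x) = 0"

definition next_phase ::
  "nat \<Rightarrow> 'd::finite choices \<Rightarrow> (real ^ 'd) list \<Rightarrow> 'd alg_state \<Rightarrow> 'd alg_state" where
  "next_phase n ch h s =
    (let i = phase s + 1 in
     if i = last_sub n + 1
     then s\<lparr> phase := i, bsize := (bsize s)(i := (\<lambda>_. 0)(1 := unallocated n (last_sub n))) \<rparr>
     else
       let N = (\<Sum>j=1..bucket_count n (i - 1). length (bpts s (i - 1) j));
           T = sub_len n (i - 1) + sub_len n i - N;
           C = cap ch h T (bucket_count n i);
           old = (\<lambda>j. vacant s (i - 1) (2 * j - 1) + vacant s (i - 1) (2 * j))
       in if \<forall>j\<in>{1..bucket_count n i}. old j \<le> C j
          then s\<lparr> phase := i, bsize := (bsize s)(i := (\<lambda>j. C j - old j)) \<rparr>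
          else s\<lparr> stuck := True \<rparr>)"

definition alg_step ::
  "nat \<Rightarrow> 'd::finite online_alg \<Rightarrow> 'd choices \<Rightarrow> (real ^ 'd) list \<Rightarrow> real ^ 'd \<Rightarrow> 'd alg_state \<Rightarrow> 'd alg_state"
where
  "alg_step n \<B> ch h x s0 =
    (let s = while (overflows n ch x) (next_phase n ch h) s0; i = phase s in
     if stuck s then put_spare ch h x s
     else if i = last_sub n + 1 then
       (if vacant s i 1 > 0 then put_bucket n \<B> i 1 x s else put_spare ch h x s)
     else if i \<ge> 2 \<and> vacant s (i - 1) (bucket_of ch (i - 1) x) > 0
       then put_bucket n \<B> (i - 1) (bucket_of ch (i - 1) x) x s
     else put_bucket n \<B> i (bucket_of ch i x) x s)"

primrec alg_run ::
  "nat \<Rightarrow> 'd::finite online_alg \<Rightarrow> 'd choices \<Rightarrow> (nat \<Rightarrow> real ^ 'd) \<Rightarrow> nat \<Rightarrow> 'd alg_state" where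
  "alg_run n \<B> ch X 0 = init_state n ch"
| "alg_run n \<B> ch X (Suc t) = alg_step n \<B> ch (map X [0..<Suc t]) (X t) (alg_run n \<B> ch X t)"

definition alg_cost ::
  "nat \<Rightarrow> 'd::finite online_alg \<Rightarrow> 'd choices \<Rightarrow> (nat \<Rightarrow> real ^ 'd) \<Rightarrow> real" where
  "alg_cost n \<B> ch X = array_cost n (\<lambda>c. the (cells (alg_run n \<B> ch X n) c))"

end

theory Submission
  imports Defs "HOL-Real_Asymp.Real_Asymp"
begin

text \<open>Chernoff bounds show that, with high probability, in every window of arrivals and for every bucket
  region the number of points in the region deviates from its mean \<open>\<mu>\<close> by at most
  \<open>(\<mu> + log\<^sup>2 n) / 200\<close>. Each bin of a phase has capacity \<open>\<Theta>(log\<^sup>2 n)\<close>, equal up to one for all bins,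
  so when one bin overflows all bins are nearly full; the deviations do not accumulate because the
  next phase equalises the capacities again. Hence the algorithm never gets stuck, every subarray
  \<open>A\<^sub>i\<close> with \<open>i < k\<close> is filled bucket by bucket, and only the \<open>O(log\<^sup>2 n)\<close> cells of \<open>A\<^sub>k\<close> and
  \<open>B\<close> can receive points in an uncontrolled way.

  Consecutive blocks are adjacent, so the points of a bucket of \<open>A\<^sub>i\<close> have a tour of length
  \<open>O(2\<^sup>i + log\<^sup>2 n)\<close> block widths (without the second term if \<open>d = 1\<close>). Multiplying by the competitive
  ratio \<open>O(log n)\<close> inside buckets and summing over buckets and phases bounds the cost. For
  the matching lower bound on the optimum, split the cube into about \<open>n\<close> cells: a union bound over
  sets of cells shows that a constant fraction of them is occupied, and points in distinct
  cells of equal coordinate parities are at distance at least one cell width.\<close>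

section \<open>Tours\<close>

text \<open>Phases begin at random times that depend on the past. Concentration is therefore
  demanded for all windows of arrivals at once: there are only polynomially many pairs of a window
  and a bucket, against a failure probability exp (- c log^2 n) for each. On the resulting event the
  analysis is deterministic.

  The exponent 2 is a balance. With K blocks the cost is, up to constants, log n * (log n + f *
  log^2 n) * K^(1 - 1/d): the outer log n is the competitive ratio inside a bucket, the inner one
  counts phases, and f * log^2 n is the price of points sharing a block. The last summand is too
  large by a factor log n. For d \<ge> 2 the factor is recovered from K \<le> M / log^2 n, where M
  is of order n and the optimum of order M^(1 - 1/d), since then K^(1 - 1/d) * log n \<le> M^(1 -
  1/d). For d = 1 the exponent is 0 and nothing is recovered; there a bucket is toured in the order
  of the coordinate itself, so that f = 0.

  The blocks of the algorithm are closed, those of the analysis open: shared boundaries are null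
  sets, so almost surely the boundary rule is never consulted.\<close>

fun path_len :: "'a::real_normed_vector list \<Rightarrow> real" where
  "path_len (x # y # ys) = norm (y - x) + path_len (y # ys)"
| "path_len _ = 0"

lemma path_len_conv_sum: "path_len ys = (\<Sum>i<length ys - 1. norm (ys ! Suc i - ys ! i))"
proof (induction ys rule: path_len.induct)
  case (1 x y ys)
  then show ?case by (simp add: sum.lessThan_Suc_shift del: sum.lessThan_Suc)
qed auto

lemma tour_length_conv_path_len:
  assumes "ys \<noteq> []"
  shows "tour_length ys = path_len ys + norm (hd ys - last ys)"
proof -
  obtain m where m: "length ys = Suc m" using assms by (cases ys) auto
  have "tour_length ys = (\<Sum>i<m. norm (ys ! (Suc i mod Suc m) - ys ! i)) + norm (ys ! 0 - ys ! m)"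
    by (simp add: tour_length_def m)
  also have "(\<Sum>i<m. norm (ys ! (Suc i mod Suc m) - ys ! i)) = (\<Sum>i<m. norm (ys ! Suc i - ys ! i))"
    by (intro sum.cong) auto
  finally show ?thesis
    using assms m by (simp add: path_len_conv_sum hd_conv_nth last_conv_nth)
qed

lemma path_len_Cons_remove: "path_len (x # ys) \<le> path_len (x # y # ys)"
proof (cases ys)
  case (Cons z zs)
  have "norm (z - x) \<le> norm (y - x) + norm (z - y)"
    using norm_triangle_ineq[of "y - x" "z - y"] by simp
  then show ?thesis using Cons by simp
qed simp

lemma path_len_filter_Cons: "path_len (x # filter P ys) \<le> path_len (x # ys)"
proof (induction ys arbitrary: x)
  case (Cons y ys)
  show ?case
    using path_len_Cons_remove[of x ys y] Cons[of x] Cons[of y] by (cases "P y") auto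
qed simp

lemma path_len_filter: "path_len (filter P ys) \<le> path_len ys"
proof (induction ys)
  case (Cons y ys)
  have "path_len ys \<le> path_len (y # ys)" by (cases ys) auto
  then show ?case using Cons path_len_filter_Cons[of y P ys] by auto
qed simp

text \<open>If the head occurs again later, dropping it does not change the set of points; otherwise
  the first step leads to a different point and has length at least \<open>h\<close>.\<close>

lemma path_len_separated:
  assumes "\<And>x y. x \<in> set ys \<Longrightarrow> y \<in> set ys \<Longrightarrow> x \<noteq> y \<Longrightarrow> h \<le> norm (x - y)" "h \<ge> 0"
  shows "real (card (set ys) - 1) * h \<le> path_len ys"
  using assms
proof (induction ys rule: path_len.induct)
  case (1 x y ys)
  have IH: "real (card (set (y # ys)) - 1) * h \<le> path_len (y # ys)"
    using 1 by auto
  show ?case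
  proof (cases "x \<in> set (y # ys)")
    case True
    then have "set (x # y # ys) = set (y # ys)" by auto
    then show ?thesis using IH by (metis add_increasing norm_ge_zero path_len.simps(1))
  next
    case False
    then have "h \<le> norm (y - x)" using 1(2)[of y x] by auto
    moreover have "real (card (set (x # y # ys)) - 1) = real (card (set (y # ys)) - 1) + 1"
      using False by (simp add: card_gt_0_iff of_nat_diff Suc_le_eq)
    ultimately show ?thesis using IH by (simp add: algebra_simps)
  qed
qed (auto)

lemma finite_mset_eq: "finite {ys. mset ys = mset xs}"
proof (rule finite_subset)
  show "{ys. mset ys = mset xs} \<subseteq> {ys. set ys \<subseteq> set xs \<and> length ys = length xs}"
    by (auto dest: mset_eq_setD mset_eq_length)
qed (simp add: finite_lists_length_eq)

lemma opt_tour_le: "mset ys = mset xs \<Longrightarrow> opt_tour xs \<le> tour_length ys"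
  unfolding opt_tour_def by (intro Min_le) (auto simp: finite_mset_eq)

lemma opt_tour_attained: obtains ys where "mset ys = mset xs" "opt_tour xs = tour_length ys"
proof -
  have "opt_tour xs \<in> tour_length ` {ys. mset ys = mset xs}"
    unfolding opt_tour_def by (intro Min_in) (auto simp: finite_mset_eq)
  then show ?thesis using that by auto
qed

text \<open>Shortcutting an optimal tour to the points of \<open>Q\<close> cannot lengthen it, by
  the triangle inequality; the closing edge is simply dropped.\<close>

lemma opt_tour_ge_separated:
  assumes "Q \<subseteq> set xs" "h \<ge> 0"
    and "\<And>x y. x \<in> Q \<Longrightarrow> y \<in> Q \<Longrightarrow> x \<noteq> y \<Longrightarrow> h \<le> norm (x - y)"
  shows "real (card Q - 1) * h \<le> opt_tour xs"
proof -
  obtain ys where ys: "mset ys = mset xs" "opt_tour xs = tour_length ys"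
    by (rule opt_tour_attained)
  have s: "set (filter (\<lambda>x. x \<in> Q) ys) = Q"
    using assms(1) mset_eq_setD[OF ys(1)] by auto
  have "real (card Q - 1) * h \<le> path_len (filter (\<lambda>x. x \<in> Q) ys)"
    using path_len_separated[of "filter (\<lambda>x. x \<in> Q) ys" h] assms(2,3) unfolding s by blast
  also have "\<dots> \<le> path_len ys" by (rule path_len_filter)
  also have "\<dots> \<le> tour_length ys"
    by (cases "ys = []") (auto simp: tour_length_conv_path_len, simp add: tour_length_def)
  finally show ?thesis using ys by simp
qed

lemma opt_tour_nonneg: "0 \<le> opt_tour xs"
  using opt_tour_ge_separated[of "{}" xs 0] by simp

text \<open>The slack \<open>\<beta>\<close> pays for steps between points with equal keys. It will
  be of the order of a block width when the key is a block index, and 0 when the key is the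
  coordinate in dimension one.\<close>

lemma path_len_sorted_key:
  fixes f :: "'a::real_normed_vector \<Rightarrow> real"
  assumes "sorted (map f ys)" "ys \<noteq> []"
    and "\<And>x y. x \<in> set ys \<Longrightarrow> y \<in> set ys \<Longrightarrow> norm (x - y) \<le> \<alpha> * \<bar>f x - f y\<bar> + \<beta>"
  shows "path_len ys \<le> \<alpha> * (f (last ys) - f (hd ys)) + real (length ys - 1) * \<beta>"
  using assms
proof (induction ys rule: path_len.induct)
  case (1 x y ys)
  have IH: "path_len (y # ys) \<le> \<alpha> * (f (last (y # ys)) - f y) + real (length (y # ys) - 1) * \<beta>"
    using 1 by auto
  have "norm (y - x) \<le> \<alpha> * (f y - f x) + \<beta>"
    using 1(4)[of y x] 1(2) by auto
  then show ?case using IH by (simp add: algebra_simps)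
qed auto

text \<open>Visit the points in the order of \<open>f\<close>; the jumps of \<open>f\<close> telescope.\<close>

lemma opt_tour_le_key:
  fixes ps :: "(real ^ 'd) list" and f :: "real ^ 'd \<Rightarrow> real"
  assumes "\<And>x y. x \<in> set ps \<Longrightarrow> y \<in> set ps \<Longrightarrow> norm (x - y) \<le> \<alpha> * \<bar>f x - f y\<bar> + \<beta>"
    and "\<And>x. x \<in> set ps \<Longrightarrow> lo \<le> f x \<and> f x \<le> hi" and "lo \<le> hi" "\<alpha> \<ge> 0" "\<beta> \<ge> 0"
  shows "opt_tour ps \<le> 2 * \<alpha> * (hi - lo) + real (length ps) * \<beta>"
proof (cases "ps = []")
  case True
  then have "opt_tour ps \<le> 0" using opt_tour_le[of "[]" ps] by (simp add: tour_length_def)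
  moreover have "0 \<le> 2 * \<alpha> * (hi - lo) + real (length ps) * \<beta>" using assms by simp
  ultimately show ?thesis by linarith
next
  case False
  define ys where "ys = sort_key f ps"
  have ys: "mset ys = mset ps" "sorted (map f ys)" "set ys = set ps" "ys \<noteq> []" "length ys = length ps"
    using False by (auto simp: ys_def simp flip: set_empty)
  have hl: "hd ys \<in> set ps" "last ys \<in> set ps" using ys by (metis hd_in_set last_in_set)+
  have "path_len ys \<le> \<alpha> * (f (last ys) - f (hd ys)) + real (length ys - 1) * \<beta>"
    by (rule path_len_sorted_key) (use ys assms in auto)
  also have "\<dots> \<le> \<alpha> * (hi - lo) + real (length ys - 1) * \<beta>"
    using assms(2)[OF hl(1)] assms(2)[OF hl(2)] assms(4) by (intro add_mono mult_left_mono) auto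
  finally have 1: "path_len ys \<le> \<alpha> * (hi - lo) + real (length ys - 1) * \<beta>" .
  have "norm (hd ys - last ys) \<le> \<alpha> * \<bar>f (hd ys) - f (last ys)\<bar> + \<beta>"
    using assms(1) hl by auto
  also have "\<dots> \<le> \<alpha> * (hi - lo) + \<beta>"
    using assms(2)[OF hl(1)] assms(2)[OF hl(2)] assms(4) by (intro add_mono mult_left_mono) auto
  finally have "tour_length ys \<le> 2 * \<alpha> * (hi - lo) + (real (length ys - 1) * \<beta> + \<beta>)"
    using 1 ys(4) by (simp add: tour_length_conv_path_len)
  also have "real (length ys - 1) * \<beta> + \<beta> = real (length ps) * \<beta>"
    using ys by (cases ys) (auto simp: algebra_simps)
  finally show ?thesis using opt_tour_le[OF ys(1)] by simp
qed

section \<open>The order of the blocks\<close>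

text \<open>The splits along coordinate r happen at times r, r + d, r + 2d, ..., and the quotient
  grows exactly then: \<open>d\<close> divides \<open>Suc l + d - r\<close> precisely if
  \<open>l mod d + 1 = r\<close>.\<close>

lemma card_splits:
  assumes "1 \<le> r" "r \<le> d"
  shows "card {t \<in> {1..l}. (t - 1) mod d + 1 = r} = (l + d - r) div d"
proof (induction l)
  case 0
  then show ?case using assms by simp
next
  case (Suc l)
  have eq: "{t \<in> {1..Suc l}. (t - 1) mod d + 1 = r} =
      (if l mod d + 1 = r then insert (Suc l) else id) {t \<in> {1..l}. (t - 1) mod d + 1 = r}"
    using assms by (auto simp: le_Suc_eq)
  have "(Suc l + d - r) div d = (l + d - r) div d + (if l mod d + 1 = r then 1 else 0)"
  proof -
    define y where "y = l + d - r"
    have 1: "Suc l + d - r = Suc y" using assms by (simp add: y_def)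
    have "Suc y mod d = 0 \<longleftrightarrow> l mod d + 1 = r"
    proof -
      define a where "a = l div d"
      define c where "c = l mod d"
      have l: "l = d * a + c" "c < d" unfolding a_def c_def using assms by auto
      have "int (Suc y) = int d * (int a + 1) + (int c + 1 - int r)"
        using l(1) assms by (simp add: y_def algebra_simps of_nat_diff)
      then have "int d dvd int (Suc y) \<longleftrightarrow> int d dvd (int c + 1 - int r)"
        by (metis dvd_add_right_iff dvd_triv_left)
      also have "\<dots> \<longleftrightarrow> int c + 1 - int r = 0"
      proof
        assume "int d dvd int c + 1 - int r"
        then show "int c + 1 - int r = 0"
          using l(2) assms dvd_imp_le_int[of "int c + 1 - int r" "int d"] by (rule_tac ccontr) auto
      qed simp
      also have "\<dots> \<longleftrightarrow> c + 1 = r" by linarith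
      finally have "d dvd Suc y \<longleftrightarrow> c + 1 = r" by (simp only: int_dvd_int_iff)
      then show ?thesis by (simp only: dvd_eq_mod_eq_0 c_def)
    qed
    then show ?thesis unfolding 1 y_def[symmetric] div_Suc by simp
  qed
  then show ?case unfolding eq using Suc by (auto simp: card_insert_if)
qed

text \<open>Round robin gives every coordinate l/d splits up to one, so up to a factor 2 in each
  direction the blocks are cubes of side 2^(-l/d).\<close>

lemma grid_size_bounds:
  assumes "1 \<le> r" "r \<le> d"
  shows "(2 ^ l) powr (1 / real d) / 2 \<le> real (grid_size d l r)"
    and "real (grid_size d l r) \<le> 2 * (2 ^ l) powr (1 / real d)"
proof -
  define c where "c = (l + d - r) div d"
  have g: "real (grid_size d l r) = 2 powr real c"
    unfolding grid_size_def card_splits[OF assms] c_def by (simp add: powr_realpow)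
  have p: "(2 ^ l :: real) powr (1 / real d) = 2 powr (real l / real d)"
    by (simp add: powr_powr flip: powr_realpow)
  have d: "d > 0" using assms by simp
  have "d * c \<le> l + d - r" unfolding c_def by simp
  then have "d * c \<le> l + d" by simp
  then have "real (d * c) \<le> real (l + d)" by (simp only: of_nat_le_iff)
  then have c1: "real c \<le> real l / real d + 1" using d by (simp add: field_simps)
  have "l + d - r < d * c + d" unfolding c_def using d
    by (metis add.commute dividend_less_times_div)
  then have "l < d * c + d" using assms by simp
  then have "real l < real (d * c + d)" by (simp only: of_nat_less_iff)
  then have c2: "real l / real d - 1 \<le> real c" using d by (simp add: field_simps)
  have "(2::real) powr (real l / real d - 1) \<le> 2 powr real c" using c2 by simp
  then show "(2 ^ l) powr (1 / real d) / 2 \<le> real (grid_size d l r)"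
    unfolding g p by (simp add: powr_diff)
  have "(2::real) powr real c \<le> 2 powr (real l / real d + 1)" using c1 by simp
  then show "real (grid_size d l r) \<le> 2 * (2 ^ l) powr (1 / real d)"
    unfolding g p by (simp add: powr_add mult.commute)
qed

lemma grid_size_pos: "0 < grid_size d l r"
  by (simp add: grid_size_def)

lemma prod_grid_size:
  assumes "d > 0"
  shows "(\<Prod>r=1..d. grid_size d l r) = 2 ^ l"
proof -
  have "(\<Sum>r=1..d. card {t \<in> {1..l}. (t - 1) mod d + 1 = r}) =
      (\<Sum>r=1..d. \<Sum>t | t \<in> {1..l} \<and> (t - 1) mod d + 1 = r. 1)" by simp
  also have "\<dots> = (\<Sum>t\<in>{1..l}. 1)"
    by (rule sum.group) (use assms in \<open>auto simp: Suc_le_eq\<close>)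
  finally show ?thesis by (simp add: grid_size_def flip: power_sum)
qed

lemma even_grid_size:
  assumes "1 \<le> r" "r \<le> d" "d \<le> l"
  shows "even (grid_size d l r)"
proof -
  have "(l + d - r) div d \<ge> 1" using assms by (simp add: Suc_le_eq div_greater_zero_iff)
  then show ?thesis using assms unfolding grid_size_def card_splits[OF assms(1,2)] by simp
qed

section \<open>The boustrophedon walk\<close>

text \<open>The test at a coordinate reads only the direction of that coordinate, which is flipped
  after the test; so the flips already made do not affect where the loop stops.\<close>

lemma while_flip:
  fixes m :: "nat \<Rightarrow> int"
  assumes "\<not> P m j\<^sub>0" "\<And>j. 1 \<le> j \<Longrightarrow> j < j\<^sub>0 \<Longrightarrow> P m j" "1 \<le> j\<^sub>0"
    and "\<And>m m' j. m j = m' j \<Longrightarrow> P m j = P m' j"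
  shows "while (\<lambda>(m, j). P m j) (\<lambda>(m, j). (m(j := - m j), j + 1)) (m, 1) =
    ((\<lambda>r. if 1 \<le> r \<and> r < j\<^sub>0 then - m r else m r), j\<^sub>0)" (is "while ?b ?c _ = (?m j\<^sub>0, _)")
proof -
  have *: "while ?b ?c (?m j, j) = (?m j\<^sub>0, j\<^sub>0)" if "1 \<le> j" "j \<le> j\<^sub>0" for j
    using that
  proof (induction "j\<^sub>0 - j" arbitrary: j)
    case 0
    then show ?case using assms(1) assms(4)[of "?m j\<^sub>0" j\<^sub>0 m] by (subst while_unfold) auto
  next
    case (Suc x)
    have b: "?b (?m j, j)" using assms(2)[of j] Suc assms(4)[of "?m j" j m] by auto
    have c: "?c (?m j, j) = (?m (Suc j), Suc j)" using Suc by (auto simp: fun_eq_iff)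
    show ?case using Suc(1)[of "Suc j"] Suc(2-) b c by (subst while_unfold) auto
  qed
  have m1: "?m 1 = m" by auto
  show ?thesis using *[of 1] assms(3) unfolding m1 by blast
qed

text \<open>In boustrophedon order the direction of travel along coordinate \<open>r\<close> is reversed by each
  step along a later coordinate, so it is determined by a parity.\<close>

definition snake_inv :: "nat \<Rightarrow> (nat \<Rightarrow> nat) \<Rightarrow> (nat \<Rightarrow> int) \<times> (nat \<Rightarrow> int) \<Rightarrow> bool" where
  "snake_inv d N = (\<lambda>(v, m). \<forall>r\<in>{1..d}. 1 \<le> v r \<and> v r \<le> int (N r) \<and>
      m r = (if even (\<Sum>r'\<in>{r<..d}. v r' - 1) then 1 else - 1))"

text \<open>Evenness enters here. At the last layer the offset \<open>v d - 1\<close> is odd. Going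
  down from coordinate d - 1, if all coordinates between \<open>r\<close> and \<open>d\<close> are
  at 1, the parity rule makes \<open>r\<close> travel downwards, and being blocked it sits at
  1.\<close>

lemma snake_blocked_imp_end:
  assumes inv: "snake_inv d N (v, m)" and d: "d \<ge> 1" and ev: "even (N d)"
    and bl: "\<And>j. j \<in> {1..d} \<Longrightarrow> v j + m j > int (N j) \<or> v j + m j < 1"
  shows "(\<forall>r\<in>{1..<d}. v r = 1) \<and> v d = int (N d)"
proof -
  have inv': "1 \<le> v r" "v r \<le> int (N r)" "m r = (if even (\<Sum>r'\<in>{r<..d}. v r' - 1) then 1 else - 1)"
    if "r \<in> {1..d}" for r using inv that by (auto simp: snake_inv_def)
  have vd: "v d = int (N d)" using inv'[of d] bl[of d] d by auto
  have "v r = 1" if "r \<in> {1..<d}" for r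
    using that
  proof (induction "d - r" arbitrary: r rule: less_induct)
    case less
    have "(\<Sum>r'\<in>{r<..d}. v r' - 1) = (\<Sum>r'\<in>insert d {r<..<d}. v r' - 1)"
      by (rule sum.cong) (use less.prems in auto)
    also have "\<dots> = v d - 1 + (\<Sum>r'\<in>{r<..<d}. v r' - 1)" by simp
    also have "(\<Sum>r'\<in>{r<..<d}. v r' - 1) = 0"
      by (rule sum.neutral) (use less in auto)
    finally have "odd (\<Sum>r'\<in>{r<..d}. v r' - 1)" using ev vd by simp
    then have "m r = -1" using inv'(3)[of r] less.prems by auto
    then show ?case using bl[of r] inv'[of r] less.prems by auto
  qed
  then show ?thesis using vd by auto
qed

text \<open>The move along \<open>j0\<close> changes one summand by one, hence the parity for
  exactly the coordinates before \<open>j0\<close>, and these are the ones whose direction the carry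
  loop has reversed.\<close>

lemma snake_step_inv:
  assumes inv: "snake_inv d N (v, m)" and d: "d \<ge> 1" and ev: "even (N d)"
  obtains v' m' where "snake_step d N (v, m) = (v', m')" "snake_inv d N (v', m')"
    "\<And>r. \<bar>v' r - v r\<bar> \<le> 1"
proof (cases "(\<forall>r\<in>{1..<d}. v r = 1) \<and> v d = int (N d)")
  case True
  then show ?thesis using that[of v m] inv by (auto simp: snake_step_def)
next
  case False
  have inv': "1 \<le> v r" "v r \<le> int (N r)" "m r = (if even (\<Sum>r'\<in>{r<..d}. v r' - 1) then 1 else - 1)"
    if "r \<in> {1..d}" for r using inv that by (auto simp: snake_inv_def)
  define P where "P = (\<lambda>m j. v j + m j > int (N j) \<or> v j + m j < 1)"
  \<comment> \<open>A walk blocked in all coordinates would be at its end, so the carry loop finds a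
    free one.\<close>
  have "\<exists>j. j \<in> {1..d} \<and> \<not> P m j"
    using snake_blocked_imp_end[OF inv d ev] False unfolding P_def by blast
  define j0 where "j0 = (LEAST j. j \<in> {1..d} \<and> \<not> P m j)"
  have j0: "j0 \<in> {1..d}" "\<not> P m j0"
    using LeastI_ex[OF \<open>\<exists>j. j \<in> {1..d} \<and> \<not> P m j\<close>] unfolding j0_def by auto
  have j0l: "P m j" if "1 \<le> j" "j < j0" for j
    using not_less_Least[of j "\<lambda>j. j \<in> {1..d} \<and> \<not> P m j"] that j0(1) unfolding j0_def[symmetric]
    by auto
  define m' where "m' = (\<lambda>r. if 1 \<le> r \<and> r < j0 then - m r else m r)"
  have w: "while (\<lambda>(m, j). P m j) (\<lambda>(m, j). (m(j := - m j), j + 1)) (m, 1) = (m', j0)"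
    unfolding m'_def by (rule while_flip) (use j0 j0l in \<open>auto simp: P_def\<close>)
  have mj: "m' j0 = m j0" by (simp add: m'_def)
  have mpm: "m j0 = 1 \<or> m j0 = -1" using inv'(3)[OF j0(1)] by (auto split: if_splits)
  define v' where "v' = v(j0 := v j0 + m j0)"
  have step: "snake_step d N (v, m) = (v', m')"
    using w False mj unfolding snake_step_def P_def v'_def by auto
  have "snake_inv d N (v', m')"
    unfolding snake_inv_def
  proof (clarify)
    fix r assume r: "r \<in> {1..d}"
    have rng: "1 \<le> v' r \<and> v' r \<le> int (N r)"
      using inv'[OF r] j0(2) by (auto simp: v'_def P_def)
    have "m' r = (if even (\<Sum>r'\<in>{r<..d}. v' r' - 1) then 1 else - 1)"
    proof (cases "r < j0")
      case True
      have "(\<Sum>r'\<in>{r<..d}. v' r' - 1) = (v' j0 - 1) + (\<Sum>r'\<in>{r<..d} - {j0}. v' r' - 1)"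
        by (rule sum.remove) (use True j0 in auto)
      also have "(\<Sum>r'\<in>{r<..d} - {j0}. v' r' - 1) = (\<Sum>r'\<in>{r<..d} - {j0}. v r' - 1)"
        by (rule sum.cong) (auto simp: v'_def)
      also have "(v' j0 - 1) + \<dots> = m j0 + (\<Sum>r'\<in>{r<..d}. v r' - 1)"
        using sum.remove[of "{r<..d}" j0 "\<lambda>r'. v r' - 1"] True j0 by (simp add: v'_def)
      finally have "even (\<Sum>r'\<in>{r<..d}. v' r' - 1) \<longleftrightarrow> odd (\<Sum>r'\<in>{r<..d}. v r' - 1)"
        using mpm by auto
      then show ?thesis using inv'(3)[OF r] True r by (auto simp: m'_def)
    next
      case False
      have "(\<Sum>r'\<in>{r<..d}. v' r' - 1) = (\<Sum>r'\<in>{r<..d}. v r' - 1)"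
        by (rule sum.cong) (use False in \<open>auto simp: v'_def\<close>)
      then show ?thesis using inv'(3)[OF r] False by (simp add: m'_def)
    qed
    then show "1 \<le> v' r \<and> v' r \<le> int (N r) \<and> m' r = (if even (\<Sum>r'\<in>{r<..d}. v' r' - 1) then 1 else - 1)"
      using rng by blast
  qed
  moreover have "\<bar>v' r - v r\<bar> \<le> 1" for r using mpm by (auto simp: v'_def)
  ultimately show ?thesis using that step by blast
qed

lemma snake_state_inv:
  assumes d: "d \<ge> 1" and ev: "even (N d)" and N: "\<And>r. N r > 0"
  shows "snake_inv d N ((snake_step d N ^^ q) (\<lambda>_. 1, \<lambda>_. 1))"
proof (induction q)
  case 0
  then show ?case using N by (simp add: snake_inv_def Suc_le_eq)
next
  case (Suc q)
  obtain v m where vm: "(snake_step d N ^^ q) (\<lambda>_. 1, \<lambda>_. 1) = (v, m)" by fastforce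
  show ?case using snake_step_inv[OF Suc[unfolded vm] d ev] vm by (metis comp_apply funpow.simps(2))
qed

lemma snake_in_grid:
  assumes "d \<ge> 1" "even (N d)" "\<And>r. N r > 0" "r \<in> {1..d}"
  shows "1 \<le> snake d N q r \<and> snake d N q r \<le> int (N r)"
  using snake_state_inv[of d N "q - 1"] assms
  by (auto simp: snake_def snake_inv_def case_prod_beta)

lemma snake_Suc_dist:
  assumes "d \<ge> 1" "even (N d)" "\<And>r. N r > 0" "q \<ge> 1"
  shows "\<bar>snake d N (Suc q) r - snake d N q r\<bar> \<le> 1"
proof -
  obtain v m where vm: "(snake_step d N ^^ (q - 1)) (\<lambda>_. 1, \<lambda>_. 1) = (v, m)" by fastforce
  have "snake_inv d N (v, m)" using snake_state_inv[of d N "q - 1"] assms vm by simp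
  from snake_step_inv[OF this assms(1,2)]
  obtain v' m' where 1: "snake_step d N (v, m) = (v', m')" "\<bar>v' r - v r\<bar> \<le> 1" by metis
  obtain p where p: "q = Suc p" using assms(4) by (cases q) auto
  have "(snake_step d N ^^ q) (\<lambda>_. 1, \<lambda>_. 1) = snake_step d N (v, m)"
    using vm by (simp add: p)
  with 1 show ?thesis using vm by (simp add: snake_def)
qed

lemma snake_dist:
  assumes "d \<ge> 1" "even (N d)" "\<And>r. N r > 0" "1 \<le> q" "1 \<le> q'"
  shows "\<bar>snake d N q r - snake d N q' r\<bar> \<le> \<bar>int q - int q'\<bar>"
proof -
  have "\<bar>snake d N (q + p) r - snake d N q r\<bar> \<le> int p" if "q \<ge> 1" for p q
  proof (induction p)
    case (Suc p)
    then show ?case using snake_Suc_dist[of d N "q + p" r] assms(1-3) that by auto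
  qed simp
  from this[of q "q' - q"] this[of q' "q - q'"] assms(4,5) show ?thesis
    by (cases "q \<le> q'") (auto simp: abs_minus_commute of_nat_diff)
qed

section \<open>Blocks as subsets of the cube\<close>

text \<open>Interiors are disjoint and miss only a null set of the cube, and on them the block
  assignment has no freedom.\<close>

definition open_block :: "(nat \<Rightarrow> 'd::finite) \<Rightarrow> nat \<Rightarrow> (nat \<Rightarrow> int) \<Rightarrow> (real ^ 'd) set" where
  "open_block e l v = {x. \<forall>r\<in>{1..CARD('d)}.
      (of_int (v r) - 1) / real (grid_size CARD('d) l r) < x $ e r \<and>
      x $ e r < of_int (v r) / real (grid_size CARD('d) l r)}"

definition grid :: "nat \<Rightarrow> nat \<Rightarrow> (nat \<Rightarrow> int) set" where
  "grid d l = (\<Pi>\<^sub>E r\<in>{1..d}. {1..int (grid_size d l r)})"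

lemma finite_grid: "finite (grid d l)"
  unfolding grid_def by (intro finite_PiE) auto

lemma card_grid: "d > 0 \<Longrightarrow> card (grid d l) = 2 ^ l"
  using prod_grid_size[of d l] by (simp add: grid_def card_PiE)

lemma open_block_eq_box:
  fixes e :: "nat \<Rightarrow> 'd::finite" and l :: nat
  assumes e: "bij_betw e {1..CARD('d)} UNIV"
  defines "f \<equiv> inv_into {1..CARD('d)} e"
  defines "N \<equiv> grid_size CARD('d) l"
  shows "open_block e l v = box (\<chi> i. (of_int (v (f i)) - 1) / N (f i)) (\<chi> i. of_int (v (f i)) / N (f i))"
proof -
  have fe: "f (e r) = r" if "r \<in> {1..CARD('d)}" for r
    using e that unfolding f_def by (simp add: bij_betw_def inv_into_f_f)
  have "(\<forall>r\<in>{1..CARD('d)}. P r (x $ e r)) \<longleftrightarrow> (\<forall>i. P (f i) (x $ i))" for P and x :: "real ^ 'd"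
    using e fe by (metis (no_types, lifting) UNIV_I bij_betw_def f_def f_inv_into_f inv_into_into)
  from this[of "\<lambda>r y. (of_int (v r) - 1) / N r < y \<and> y < of_int (v r) / N r"]
  show ?thesis unfolding open_block_def N_def
    by (auto simp: mem_box_cart set_eq_iff)
qed

lemma measure_open_block:
  fixes e :: "nat \<Rightarrow> 'd::finite"
  assumes e: "bij_betw e {1..CARD('d)} UNIV"
  shows "measure lborel (open_block e l v) = 1 / 2 ^ l"
proof -
  define f where "f = inv_into {1..CARD('d)} e"
  define N where "N r = real (grid_size CARD('d) l r)" for r
  have N: "N r > 0" for r by (simp add: N_def grid_size_pos)
  have bf: "bij_betw f UNIV {1..CARD('d)}" unfolding f_def by (rule bij_betw_inv_into[OF e])
  let ?a = "\<chi> i. (of_int (v (f i)) - 1) / N (f i)" and ?b = "\<chi> i. of_int (v (f i)) / N (f i)"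
  have le: "\<forall>b\<in>Basis. ?a \<bullet> b \<le> ?b \<bullet> b"
    using N by (auto simp: Basis_vec_def inner_axis divide_right_mono[OF _ less_imp_le[OF N]])
  have "measure lborel (open_block e l v) = measure lborel (box ?a ?b)"
    unfolding open_block_eq_box[OF e] f_def N_def ..
  also have "\<dots> = (\<Prod>b\<in>Basis. (?b - ?a) \<bullet> b)"
    using le by (simp add: measure_lborel_box_eq)
  also have "\<dots> = (\<Prod>i\<in>UNIV. (?b - ?a) $ i)"
  proof -
    have B: "(Basis :: (real ^ 'd) set) = (\<lambda>i. axis i 1) ` UNIV" by (auto simp: Basis_vec_def)
    have "inj (\<lambda>i::'d. axis i (1::real))" by (simp add: inj_on_def axis_eq_axis)
    then show ?thesis unfolding B by (subst prod.reindex) (auto simp: inner_axis)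
  qed
  also have "\<dots> = (\<Prod>i\<in>UNIV. 1 / N (f i))" by (simp add: diff_divide_distrib[symmetric])
  also have "\<dots> = (\<Prod>r\<in>{1..CARD('d)}. 1 / N r)" by (rule prod.reindex_bij_betw[OF bf])
  also have "\<dots> = 1 / real (\<Prod>r\<in>{1..CARD('d)}. grid_size CARD('d) l r)"
    by (simp add: prod_dividef N_def)
  also have "\<dots> = 1 / 2 ^ l" by (subst prod_grid_size) auto
  finally show ?thesis .
qed

lemma open_block_sets: "bij_betw e {1..CARD('d)} UNIV \<Longrightarrow> open_block (e :: nat \<Rightarrow> 'd::finite) l v \<in> sets borel"
  by (simp add: open_block_eq_box)

lemma unit_cube_eq_cbox: "unit_cube = cbox 0 (1 :: real ^ 'd)"
  by (auto simp: unit_cube_def mem_box_cart)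

lemma emeasure_unit_cube: "emeasure lborel (unit_cube :: (real ^ 'd) set) = 1"
proof -
  have "(1 :: real ^ 'd) \<bullet> b = 1" if "b \<in> Basis" for b
    using that by (auto simp: Basis_vec_def inner_axis)
  then show ?thesis by (simp add: unit_cube_eq_cbox emeasure_lborel_cbox_eq)
qed

section \<open>The uniform distribution on the cube\<close>

definition cube_measure :: "(real ^ 'd) measure" where
  "cube_measure = uniform_measure lborel unit_cube"

lemma prob_space_cube: "prob_space (cube_measure :: (real ^ 'd::finite) measure)"
  unfolding cube_measure_def by (rule prob_space_uniform_measure) (auto simp: emeasure_unit_cube)

lemma sets_cube [simp]: "sets (cube_measure :: (real ^ 'd::finite) measure) = sets borel"
  and space_cube [simp]: "space (cube_measure :: (real ^ 'd::finite) measure) = UNIV"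
  by (simp_all add: cube_measure_def)

text \<open>Only one of the two blocks has to be open. Hence an interior point determines its block,
  whatever the rule on shared boundaries is.\<close>

lemma open_block_eqI:
  assumes "x \<in> open_block (e :: nat \<Rightarrow> 'd::finite) l v" "x \<in> block e l w" "r \<in> {1..CARD('d)}"
  shows "v r = w r"
proof -
  define N where "N = real (grid_size CARD('d) l r)"
  have N: "N > 0" by (simp add: N_def grid_size_pos)
  have "(of_int (v r) - 1) / N < of_int (w r) / N" "(of_int (w r) - 1) / N < of_int (v r) / N"
    using assms unfolding open_block_def block_def N_def by fastforce+
  then have "real_of_int (v r) - 1 < w r" "real_of_int (w r) - 1 < v r"
    using N by (simp_all add: divide_less_cancel)
  then show ?thesis by linarith
qed

lemma open_block_subset_block: "open_block e l v \<subseteq> block e l v"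
  by (auto simp: open_block_def block_def less_imp_le)

lemma open_block_subset_cube:
  fixes e :: "nat \<Rightarrow> 'd::finite"
  assumes e: "bij_betw e {1..CARD('d)} UNIV"
    and v: "\<And>r. r \<in> {1..CARD('d)} \<Longrightarrow> 1 \<le> v r \<and> v r \<le> int (grid_size CARD('d) l r)"
  shows "open_block e l v \<subseteq> unit_cube"
proof
  fix x assume x: "x \<in> open_block e l v"
  have "0 \<le> x $ i \<and> x $ i \<le> 1" for i
  proof -
    obtain r where r: "r \<in> {1..CARD('d)}" "i = e r"
      using e by (metis UNIV_I bij_betw_def imageE)
    define N where "N = real (grid_size CARD('d) l r)"
    have N: "N > 0" by (simp add: N_def grid_size_pos)
    have "(of_int (v r) - 1) / N < x $ i" "x $ i < of_int (v r) / N"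
      using x r unfolding open_block_def N_def by auto
    moreover have "0 \<le> (of_int (v r) - 1) / N" using v[OF r(1)] N by simp
    moreover have "of_int (v r) / N \<le> 1" using v[OF r(1)] N by (simp add: N_def)
    ultimately show ?thesis by linarith
  qed
  then show "x \<in> unit_cube" by (simp add: unit_cube_def)
qed

lemma measure_cube_open_block:
  fixes e :: "nat \<Rightarrow> 'd::finite"
  assumes e: "bij_betw e {1..CARD('d)} UNIV"
    and v: "\<And>r. r \<in> {1..CARD('d)} \<Longrightarrow> 1 \<le> v r \<and> v r \<le> int (grid_size CARD('d) l r)"
  shows "measure cube_measure (open_block e l v) = 1 / 2 ^ l"
proof -
  have "unit_cube \<inter> open_block e l v = open_block e l v"
    using open_block_subset_cube[OF assms] by auto
  then show ?thesis
    unfolding cube_measure_def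
    using measure_open_block[OF e, of l v] open_block_sets[OF e, of l v]
    by (subst measure_uniform_measure) (auto simp: emeasure_unit_cube measure_def)
qed

text \<open>Index functions are arbitrary outside \<open>{1..CARD('d)}\<close>; it is injectivity of
  their restrictions that makes the blocks disjoint.\<close>

lemma measure_cube_UN_open_block:
  fixes e :: "nat \<Rightarrow> 'd::finite"
  assumes e: "bij_betw e {1..CARD('d)} UNIV" and fin: "finite I"
    and v: "\<And>q r. q \<in> I \<Longrightarrow> r \<in> {1..CARD('d)} \<Longrightarrow> 1 \<le> v q r \<and> v q r \<le> int (grid_size CARD('d) l r)"
    and inj: "inj_on (\<lambda>q. restrict (v q) {1..CARD('d)}) I"
  shows "measure cube_measure (\<Union>q\<in>I. open_block e l (v q)) = real (card I) / 2 ^ l"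
proof -
  interpret prob_space "cube_measure :: (real ^ 'd) measure" by (rule prob_space_cube)
  have "disjoint_family_on (\<lambda>q. open_block e l (v q)) I"
    unfolding disjoint_family_on_def
  proof (intro ballI impI, rule ccontr)
    fix q q' assume q: "q \<in> I" "q' \<in> I" "q \<noteq> q'" "open_block e l (v q) \<inter> open_block e l (v q') \<noteq> {}"
    then obtain x where x: "x \<in> open_block e l (v q)" "x \<in> block e l (v q')"
      using open_block_subset_block by blast
    have "v q r = v q' r" if "r \<in> {1..CARD('d)}" for r
      by (rule open_block_eqI[OF x that])
    then have "restrict (v q) {1..CARD('d)} = restrict (v q') {1..CARD('d)}"
      by (auto simp: restrict_def)
    then show False using inj q by (auto dest: inj_onD)
  qed
  then have "measure cube_measure (\<Union>q\<in>I. open_block e l (v q)) =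
      (\<Sum>q\<in>I. measure cube_measure (open_block e l (v q)))"
    by (intro finite_measure_finite_Union) (auto simp: fin open_block_sets[OF e])
  also have "\<dots> = (\<Sum>q\<in>I. 1 / 2 ^ l)"
    using measure_cube_open_block[OF e v] by (intro sum.cong) auto
  finally show ?thesis by simp
qed

section \<open>Distances between points of blocks\<close>

text \<open>In each coordinate the points are at most D + 1 block widths apart; the norm is then
  bounded by the sum over the coordinates.\<close>

lemma block_dist:
  fixes e :: "nat \<Rightarrow> 'd::finite"
  assumes e: "bij_betw e {1..CARD('d)} UNIV" and x: "x \<in> block e l v" and y: "y \<in> block e l w"
    and D: "\<And>r. r \<in> {1..CARD('d)} \<Longrightarrow> of_int \<bar>v r - w r\<bar> \<le> (D :: real)"
  shows "\<bar>x $ i - y $ i\<bar> \<le> (D + 1) * (2 * (2 ^ l) powr (- 1 / real CARD('d)))"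
    and "norm (x - y) \<le> (D + 1) * (real CARD('d) * (2 * (2 ^ l) powr (- 1 / real CARD('d))))"
proof -
  define s where "s = 2 * (2 ^ l :: real) powr (- 1 / real CARD('d))"
  have s: "\<bar>x $ i - y $ i\<bar> \<le> (D + 1) * s" for i
  proof -
    obtain r where r: "r \<in> {1..CARD('d)}" "i = e r"
      using e by (metis UNIV_I bij_betw_def imageE)
    define N where "N = real (grid_size CARD('d) l r)"
    have N: "N > 0" by (simp add: N_def grid_size_pos)
    have "(2 ^ l :: real) powr (1 / real CARD('d)) / 2 \<le> N"
      unfolding N_def by (rule grid_size_bounds) (use r in auto)
    then have "1 / N \<le> 1 / ((2 ^ l :: real) powr (1 / real CARD('d)) / 2)"
      using N by (intro divide_left_mono) auto
    then have sN: "1 / N \<le> s" by (simp add: s_def powr_minus_divide)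
    have 1: "(of_int (v r) - 1) / N \<le> x $ i" "x $ i \<le> of_int (v r) / N"
      "(of_int (w r) - 1) / N \<le> y $ i" "y $ i \<le> of_int (w r) / N"
      using x y r unfolding block_def N_def by auto
    have "x $ i - y $ i \<le> (of_int (v r - w r) + 1) / N" "y $ i - x $ i \<le> (of_int (w r - v r) + 1) / N"
      using 1 by (simp_all add: diff_divide_distrib add_divide_distrib)
    moreover have "(of_int (v r - w r) + 1) / N \<le> (D + 1) / N" "(of_int (w r - v r) + 1) / N \<le> (D + 1) / N"
      using D[OF r(1)] N by (auto intro!: divide_right_mono)
    ultimately have "\<bar>x $ i - y $ i\<bar> \<le> (D + 1) * (1 / N)" by simp
    also have "\<dots> \<le> (D + 1) * s"
      using D[OF r(1)] sN by (intro mult_left_mono) auto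
    finally show ?thesis .
  qed
  from s[of i] show "\<bar>x $ i - y $ i\<bar> \<le> (D + 1) * (2 * (2 ^ l) powr (- 1 / real CARD('d)))"
    unfolding s_def .
  have "norm (x - y) \<le> (\<Sum>i\<in>UNIV. \<bar>(x - y) $ i\<bar>)" by (rule norm_le_l1_cart)
  also have "\<dots> \<le> (\<Sum>i\<in>(UNIV::'d set). (D + 1) * s)" using s by (intro sum_mono) auto
  finally show "norm (x - y) \<le> (D + 1) * (real CARD('d) * (2 * (2 ^ l) powr (- 1 / real CARD('d))))"
    by (simp add: s_def mult_ac)
qed

lemma unit_cube_dist: "x \<in> unit_cube \<Longrightarrow> y \<in> unit_cube \<Longrightarrow> norm (x - y) \<le> real CARD('d)"
  for x y :: "real ^ 'd::finite"
proof -
  assume "x \<in> unit_cube" "y \<in> unit_cube"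
  then have "\<bar>(x - y) $ i\<bar> \<le> 1" for i
    by (auto simp: unit_cube_def abs_le_iff intro: diff_mono[where d = 0, simplified])
  then have "(\<Sum>i\<in>UNIV. \<bar>(x - y) $ i\<bar>) \<le> (\<Sum>i\<in>(UNIV::'d set). 1)" by (intro sum_mono)
  then show ?thesis using norm_le_l1_cart[of "x - y"] by simp
qed

text \<open>Distinct indices of equal parity differ by at least 2, so a whole cell separates the two
  points in that coordinate.\<close>

lemma same_parity_blocks_dist:
  fixes e :: "nat \<Rightarrow> 'd::finite"
  assumes x: "x \<in> open_block e l v" and y: "y \<in> open_block e l w"
    and r: "r \<in> {1..CARD('d)}" "v r \<noteq> w r" "even (v r) = even (w r)"
  shows "(2 ^ l) powr (- 1 / real CARD('d)) / 2 \<le> norm (x - y)"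
proof -
  define N where "N = real (grid_size CARD('d) l r)"
  have N: "N > 0" by (simp add: N_def grid_size_pos)
  have "N \<le> 2 * (2 ^ l) powr (1 / real CARD('d))"
    unfolding N_def by (rule grid_size_bounds) (use r in auto)
  then have "1 / (2 * (2 ^ l) powr (1 / real CARD('d))) \<le> 1 / N"
    using N by (intro divide_left_mono) auto
  then have sN: "(2 ^ l) powr (- 1 / real CARD('d)) / 2 \<le> 1 / N" by (simp add: powr_minus_divide)
  have 1: "(of_int (v r) - 1) / N \<le> x $ e r" "x $ e r \<le> of_int (v r) / N"
    "(of_int (w r) - 1) / N \<le> y $ e r" "y $ e r \<le> of_int (w r) / N"
    using x y r unfolding open_block_def N_def by (auto simp: less_imp_le)
  have "v r \<noteq> w r + 1" "w r \<noteq> v r + 1" using r by auto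
  then consider "v r \<ge> w r + 2" | "w r \<ge> v r + 2" using r(2) by linarith
  then have "1 / N \<le> \<bar>x $ e r - y $ e r\<bar>"
  proof cases
    case 1
    have "1 / N + of_int (w r) / N \<le> (of_int (v r) - 1) / N"
      unfolding add_divide_distrib[symmetric] using 1 N by (intro divide_right_mono) auto
    then show ?thesis using \<open>(of_int (v r) - 1) / N \<le> x $ e r\<close> \<open>y $ e r \<le> of_int (w r) / N\<close> by linarith
  next
    case 2
    have "1 / N + of_int (v r) / N \<le> (of_int (w r) - 1) / N"
      unfolding add_divide_distrib[symmetric] using 2 N by (intro divide_right_mono) auto
    then show ?thesis using \<open>(of_int (w r) - 1) / N \<le> y $ e r\<close> \<open>x $ e r \<le> of_int (v r) / N\<close> by linarith
  qed
  also have "\<dots> \<le> norm (x - y)" using component_le_norm_cart[of "x - y" "e r"] by simp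
  finally show ?thesis using sN by linarith
qed

section \<open>Concentration and the optimal tour\<close>

lemma exp_le_quadratic:
  fixes x :: real
  assumes "\<bar>x\<bar> \<le> 1"
  shows "exp x \<le> 1 + x + x\<^sup>2"
proof (cases "x \<ge> 0")
  case True
  then show ?thesis using exp_bound[of x] assms by simp
next
  case False
  define y where "y = - x"
  have y: "0 < y" "y \<le> 1" using False assms by (auto simp: y_def)
  have "exp (-y) = 1 / exp y" by (simp add: exp_minus divide_inverse)
  also have "\<dots> \<le> 1 / (1 + y)" using exp_ge_add_one_self[of y] y by (intro divide_left_mono) auto
  also have "\<dots> \<le> 1 - y + y\<^sup>2"
  proof -
    have "(1 + y) * (1 - y + y\<^sup>2) = 1 + y ^ 3" by (simp add: power2_eq_square power3_eq_cube algebra_simps)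
    also have "\<dots> \<ge> 1" using y by simp
    finally show ?thesis using y by (simp add: field_simps)
  qed
  finally show ?thesis by (simp add: y_def)
qed

lemma (in prob_space) measurable_count:
  assumes R: "R \<in> events" and I: "I \<subseteq> {..<n::nat}"
  shows "(\<lambda>X. (\<Sum>t\<in>I. indicator R (X t)) :: real) \<in> borel_measurable (Pi\<^sub>M {..<n} (\<lambda>_. M))"
proof (rule borel_measurable_sum)
  fix t assume "t \<in> I"
  then have "(\<lambda>X. X t) \<in> measurable (Pi\<^sub>M {..<n} (\<lambda>_. M)) M"
    using I by (intro measurable_component_singleton) auto
  then show "(\<lambda>X. indicator R (X t) :: real) \<in> borel_measurable (Pi\<^sub>M {..<n} (\<lambda>_. M))"
    using borel_measurable_indicator[OF R] by (rule measurable_compose)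
qed

text \<open>Markov's inequality for the exponential moment, which factors over the independent
  coordinates. Each factor is 1 + p (exp \<theta> - 1) with p = \<open>prob R\<close>. Since
  \<open>\<theta>\<close> may have either sign, both tails are covered.\<close>

lemma (in prob_space) count_exp_tail:
  assumes R: "R \<in> events" and I: "I \<subseteq> {..<n::nat}"
  defines "P \<equiv> Pi\<^sub>M {..<n} (\<lambda>_. M)"
  shows "measure P {X \<in> space P. a \<le> \<theta> * (\<Sum>t\<in>I. indicator R (X t))}
    \<le> exp (real (card I) * prob R * (exp \<theta> - 1) - a)"
proof -
  interpret PP: product_sigma_finite "\<lambda>_. M" ..
  interpret P: prob_space P unfolding P_def by (rule prob_space_PiM) (rule prob_space_axioms)
  have finI: "finite I" using I finite_subset by blast
  define h where "h = (\<lambda>X. (\<Sum>t\<in>I. indicator R (X t)) :: real)"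
  have hm[measurable]: "h \<in> borel_measurable P"
    unfolding h_def P_def by (rule measurable_count[OF R I])
  \<comment> \<open>The factor 1 outside \<open>I\<close> turns the product over the window into one
    over all coordinates, as the product measure requires.\<close>
  define f where "f = (\<lambda>t y. if t \<in> I then ennreal (exp (\<theta> * indicator R y)) else 1)"
  have fm: "f t \<in> borel_measurable M" for t
    unfolding f_def using R by (cases "t \<in> I") auto
  have prod: "ennreal (exp (\<theta> * h X)) = (\<Prod>t<n. f t (X t))" for X
  proof -
    have "exp (\<theta> * h X) = (\<Prod>t\<in>I. exp (\<theta> * indicator R (X t)))"
      unfolding h_def sum_distrib_left by (rule exp_sum[OF finI])
    then have "ennreal (exp (\<theta> * h X)) = (\<Prod>t\<in>I. ennreal (exp (\<theta> * indicator R (X t))))"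
      by (simp add: prod_ennreal)
    also have "\<dots> = (\<Prod>t\<in>I. f t (X t))" by (intro prod.cong) (auto simp: f_def)
    also have "\<dots> = (\<Prod>t<n. f t (X t))"
      by (rule prod.mono_neutral_left) (use I in \<open>auto simp: f_def\<close>)
    finally show ?thesis .
  qed
  define q where "q = exp \<theta> * prob R + (1 - prob R)"
  have q: "0 \<le> q" "q \<le> exp (prob R * (exp \<theta> - 1))"
    using exp_ge_add_one_self[of "prob R * (exp \<theta> - 1)"] prob_le_1[of R]
    by (auto simp: q_def algebra_simps intro: add_increasing2)
  have int: "(\<integral>\<^sup>+ y. ennreal (exp (\<theta> * indicator R y)) \<partial>M) = ennreal q"
  proof -
    have "(\<integral>\<^sup>+ y. ennreal (exp (\<theta> * indicator R y)) \<partial>M) =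
        (\<integral>\<^sup>+ y. ennreal (exp \<theta>) * indicator R y + indicator (space M - R) y \<partial>M)"
      by (rule nn_integral_cong) (auto simp: indicator_def)
    also have "\<dots> = ennreal (exp \<theta>) * emeasure M R + emeasure M (space M - R)"
      using R by (subst nn_integral_add) (auto simp: nn_integral_cmult)
    also have "\<dots> = ennreal q"
      using R by (simp add: q_def emeasure_eq_measure prob_compl ennreal_mult[symmetric] flip: ennreal_plus)
    finally show ?thesis .
  qed
  have "(\<integral>\<^sup>+ X. ennreal (exp (\<theta> * h X)) \<partial>P) = (\<Prod>t<n. \<integral>\<^sup>+ y. f t y \<partial>M)"
    unfolding prod P_def by (rule PP.product_nn_integral_prod) (use fm in auto)
  also have "\<dots> = (\<Prod>t\<in>I. \<integral>\<^sup>+ y. f t y \<partial>M)"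
    by (rule prod.mono_neutral_right) (use I in \<open>auto simp: f_def emeasure_space_1\<close>)
  also have "\<dots> = (\<Prod>t\<in>I. \<integral>\<^sup>+ y. ennreal (exp (\<theta> * indicator R y)) \<partial>M)"
    by (intro prod.cong) (auto simp: f_def)
  also have "\<dots> = ennreal (q ^ card I)" using q by (simp add: int ennreal_power)
  also have "\<dots> \<le> ennreal (exp (prob R * (exp \<theta> - 1)) ^ card I)"
    using q by (intro ennreal_leI power_mono) auto
  also have "exp (prob R * (exp \<theta> - 1)) ^ card I = exp (real (card I) * prob R * (exp \<theta> - 1))"
    by (simp only: exp_of_nat_mult[symmetric] mult.assoc)
  finally have mgf: "(\<integral>\<^sup>+ X. ennreal (exp (\<theta> * h X)) \<partial>P) \<le> ennreal (exp (real (card I) * prob R * (exp \<theta> - 1)))" .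
  have "emeasure P {X \<in> space P. a \<le> \<theta> * h X} =
      emeasure P ({X \<in> space P. 1 \<le> ennreal (exp (- a)) * ennreal (exp (\<theta> * h X))} \<inter> space P)"
    by (rule arg_cong[where f = "emeasure P"])
      (auto simp flip: ennreal_mult exp_add ennreal_1 simp: ennreal_le_iff)
  also have "\<dots> \<le> ennreal (exp (- a)) * (\<integral>\<^sup>+ X. ennreal (exp (\<theta> * h X)) * indicator (space P) X \<partial>P)"
    by (rule order_trans[OF _ nn_integral_Markov_inequality]) (auto intro!: eq_refl arg_cong[where f = "emeasure P"])
  also have "(\<integral>\<^sup>+ X. ennreal (exp (\<theta> * h X)) * indicator (space P) X \<partial>P) = (\<integral>\<^sup>+ X. ennreal (exp (\<theta> * h X)) \<partial>P)"
    by (rule nn_integral_cong) auto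
  also have "ennreal (exp (- a)) * \<dots> \<le> ennreal (exp (- a)) * ennreal (exp (real (card I) * prob R * (exp \<theta> - 1)))"
    using mgf by (intro mult_left_mono) auto
  also have "\<dots> = ennreal (exp (real (card I) * prob R * (exp \<theta> - 1) - a))"
    by (simp flip: ennreal_mult exp_add)
  finally show ?thesis
    by (simp add: P.emeasure_eq_measure h_def)
qed

text \<open>The additive \<open>\<Lambda>\<close> makes the failure probability independent of the
  mean, so short windows are covered by the same bound as long ones.\<close>

lemma (in prob_space) count_deviation:
  assumes R: "R \<in> events" and I: "I \<subseteq> {..<n::nat}" and \<epsilon>: "0 < \<epsilon>" "\<epsilon> \<le> 1" and \<Lambda>: "0 \<le> \<Lambda>"
  defines "P \<equiv> Pi\<^sub>M {..<n} (\<lambda>_. M)" and "\<mu> \<equiv> real (card I) * prob R"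
  defines "B \<equiv> {X \<in> space P. \<epsilon> * (\<mu> + \<Lambda>) < \<bar>(\<Sum>t\<in>I. indicator R (X t)) - \<mu>\<bar>}"
  shows "B \<in> sets P" and "measure P B \<le> 2 * exp (- \<epsilon>\<^sup>2 * \<Lambda> / 2)"
proof -
  interpret P: prob_space P unfolding P_def by (rule prob_space_PiM) (rule prob_space_axioms)
  define h where "h = (\<lambda>X. (\<Sum>t\<in>I. indicator R (X t)) :: real)"
  have hm[measurable]: "h \<in> borel_measurable P"
    unfolding h_def P_def by (rule measurable_count[OF R I])
  have B: "B = {X \<in> space P. \<epsilon> * (\<mu> + \<Lambda>) < \<bar>h X - \<mu>\<bar>}" unfolding B_def h_def ..
  show "B \<in> sets P" unfolding B by measurable
  have \<mu>: "\<mu> \<ge> 0" by (simp add: \<mu>_def)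
  \<comment> \<open>With this choice the exponent becomes \<epsilon>^2 \<mu> / 4 - \<epsilon>^2
    (\<mu> + \<Lambda>) / 2, at most - \<epsilon>^2 \<Lambda> / 2 for every \<mu> \<ge> 0.\<close>
  define \<theta> where "\<theta> = \<epsilon> / 2"
  define a where "a = \<theta> * (\<mu> + \<epsilon> * (\<mu> + \<Lambda>))"
  define b where "b = - \<theta> * (\<mu> - \<epsilon> * (\<mu> + \<Lambda>))"
  let ?U = "{X \<in> space P. a \<le> \<theta> * h X}" and ?L = "{X \<in> space P. b \<le> - \<theta> * h X}"
  have "B \<subseteq> ?U \<union> ?L"
  proof
    fix X assume X: "X \<in> B"
    then consider "\<mu> + \<epsilon> * (\<mu> + \<Lambda>) \<le> h X" | "h X \<le> \<mu> - \<epsilon> * (\<mu> + \<Lambda>)" unfolding B by fastforce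
    then show "X \<in> ?U \<union> ?L"
    proof cases
      case 1
      then have "a \<le> \<theta> * h X" unfolding a_def using \<epsilon> by (intro mult_left_mono) (auto simp: \<theta>_def)
      then show ?thesis using X by (simp add: B)
    next
      case 2
      then have "\<theta> * h X \<le> \<theta> * (\<mu> - \<epsilon> * (\<mu> + \<Lambda>))" using \<epsilon> by (intro mult_left_mono) (auto simp: \<theta>_def)
      then have "b \<le> - \<theta> * h X" by (simp add: b_def)
      then show ?thesis using X by (simp add: B)
    qed
  qed
  then have "measure P B \<le> measure P (?U \<union> ?L)" by (intro P.finite_measure_mono) measurable
  also have "\<dots> \<le> measure P ?U + measure P ?L" by (rule measure_Un_le) measurable
  also have "\<dots> \<le> exp (\<mu> * (exp \<theta> - 1) - a) + exp (\<mu> * (exp (- \<theta>) - 1) - b)"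
    using count_exp_tail[OF R I, of a \<theta>] count_exp_tail[OF R I, of b "- \<theta>"]
    unfolding h_def P_def \<mu>_def by (intro add_mono) auto
  also have "\<dots> \<le> exp (- \<epsilon>\<^sup>2 * \<Lambda> / 2) + exp (- \<epsilon>\<^sup>2 * \<Lambda> / 2)"
  proof (intro add_mono)
    have *: "\<mu> * \<theta>\<^sup>2 - \<theta> * (\<epsilon> * (\<mu> + \<Lambda>)) \<le> - \<epsilon>\<^sup>2 * \<Lambda> / 2"
      using \<mu> \<epsilon> by (simp add: \<theta>_def power2_eq_square field_simps)
    have "\<mu> * (exp \<theta> - 1) \<le> \<mu> * (\<theta> + \<theta>\<^sup>2)"
      using exp_le_quadratic[of \<theta>] \<epsilon> \<mu> by (intro mult_left_mono) (auto simp: \<theta>_def)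
    then have "\<mu> * (exp \<theta> - 1) - a \<le> \<mu> * \<theta>\<^sup>2 - \<theta> * (\<epsilon> * (\<mu> + \<Lambda>))"
      by (simp add: a_def algebra_simps)
    then show "exp (\<mu> * (exp \<theta> - 1) - a) \<le> exp (- \<epsilon>\<^sup>2 * \<Lambda> / 2)" using * by simp
    have "\<mu> * (exp (-\<theta>) - 1) \<le> \<mu> * (- \<theta> + \<theta>\<^sup>2)"
      using exp_le_quadratic[of "-\<theta>"] \<epsilon> \<mu> by (intro mult_left_mono) (auto simp: \<theta>_def)
    then have "\<mu> * (exp (-\<theta>) - 1) - b \<le> \<mu> * \<theta>\<^sup>2 - \<theta> * (\<epsilon> * (\<mu> + \<Lambda>))"
      by (simp add: b_def algebra_simps)
    then show "exp (\<mu> * (exp (-\<theta>) - 1) - b) \<le> exp (- \<epsilon>\<^sup>2 * \<Lambda> / 2)" using * by simp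
  qed
  finally show "measure P B \<le> 2 * exp (- \<epsilon>\<^sup>2 * \<Lambda> / 2)" by simp
qed

lemma (in prob_space) all_in_measure:
  assumes "W \<in> events"
  shows "Pi\<^sub>E {..<n::nat} (\<lambda>_. W) \<in> sets (Pi\<^sub>M {..<n} (\<lambda>_. M))"
    and "measure (Pi\<^sub>M {..<n} (\<lambda>_. M)) (Pi\<^sub>E {..<n} (\<lambda>_. W)) = prob W ^ n"
proof -
  interpret PP: product_sigma_finite "\<lambda>_. M" ..
  show "Pi\<^sub>E {..<n::nat} (\<lambda>_. W) \<in> sets (Pi\<^sub>M {..<n} (\<lambda>_. M))"
    using assms by (intro sets_PiM_I_finite) auto
  show "measure (Pi\<^sub>M {..<n} (\<lambda>_. M)) (Pi\<^sub>E {..<n} (\<lambda>_. W)) = prob W ^ n"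
    unfolding measure_def using assms
    by (subst PP.emeasure_PiM) (auto simp: emeasure_eq_measure ennreal_power)
qed

text \<open>One union bound over all windows and all \<open>R j\<close>, another over the sets
  \<open>W s\<close>. Having every window available is what later allows windows that start at a
  phase change.\<close>

lemma (in prob_space) concentration_event:
  fixes R :: "'j \<Rightarrow> 'a set" and W :: "'s \<Rightarrow> 'a set" and n :: nat and w :: real
  assumes J: "finite J" "\<And>j. j \<in> J \<Longrightarrow> R j \<in> events"
    and S: "finite S" "\<And>s. s \<in> S \<Longrightarrow> W s \<in> events" "\<And>s. s \<in> S \<Longrightarrow> prob (W s) \<le> w"
    and U: "U \<in> events" "prob U = 1"
    and \<epsilon>: "0 < \<epsilon>" "\<epsilon> \<le> 1" and \<Lambda>: "0 \<le> \<Lambda>"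
  defines "P \<equiv> Pi\<^sub>M {..<n} (\<lambda>_. M)"
  shows "\<exists>E\<in>sets P. 1 - ((real (n + 1))\<^sup>2 * card J * (2 * exp (- \<epsilon>\<^sup>2 * \<Lambda> / 2)) + card S * w ^ n) \<le> measure P E \<and>
    (\<forall>X\<in>E. (\<forall>t<n. X t \<in> U) \<and> (\<forall>s\<in>S. \<exists>t<n. X t \<notin> W s) \<and>
      (\<forall>j\<in>J. \<forall>a b. a \<le> b \<and> b \<le> n \<longrightarrow>
        \<bar>real (card {t \<in> {a..<b}. X t \<in> R j}) - real (b - a) * prob (R j)\<bar>
          \<le> \<epsilon> * (real (b - a) * prob (R j) + \<Lambda>)))"
proof -
  interpret P: prob_space P unfolding P_def by (rule prob_space_PiM) (rule prob_space_axioms)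
  define B where "B = (\<lambda>(a, b, j). {X \<in> space P. \<epsilon> * (real (card ({a..<b} \<inter> {..<n})) * prob (R j) + \<Lambda>) <
      \<bar>(\<Sum>t\<in>{a..<b} \<inter> {..<n}. indicator (R j) (X t)) - real (card ({a..<b} \<inter> {..<n})) * prob (R j)\<bar>})"
  define I where "I = {..n} \<times> {..n} \<times> J"
  define V where "V = (\<lambda>s. Pi\<^sub>E {..<n} (\<lambda>_. W s))"
  define G where "G = Pi\<^sub>E {..<n} (\<lambda>_. U)"
  define E where "E = G - ((\<Union>i\<in>I. B i) \<union> (\<Union>s\<in>S. V s))"
  have finI: "finite I" using J by (simp add: I_def)
  have cardI: "real (card I) = (real (n + 1))\<^sup>2 * card J" by (simp add: I_def card_cartesian_product power2_eq_square algebra_simps)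
  have Bs: "B i \<in> sets P" "measure P (B i) \<le> 2 * exp (- \<epsilon>\<^sup>2 * \<Lambda> / 2)" if "i \<in> I" for i
  proof -
    obtain a b j where i: "i = (a, b, j)" by (cases i)
    have j: "j \<in> J" using that i by (simp add: I_def)
    show "B i \<in> sets P" "measure P (B i) \<le> 2 * exp (- \<epsilon>\<^sup>2 * \<Lambda> / 2)"
      using count_deviation[OF J(2)[OF j] Int_lower2 \<epsilon> \<Lambda>, of n "{a..<b}"]
      unfolding B_def P_def i prod.case .
  qed
  have Vs: "V s \<in> sets P" "measure P (V s) \<le> w ^ n" if "s \<in> S" for s
    using all_in_measure[OF S(2)[OF that], of n] S(3)[OF that]
    unfolding V_def P_def by (auto intro: power_mono)
  have Gs: "G \<in> sets P" "measure P G = 1"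
    using all_in_measure[OF U(1), of n] U(2) unfolding G_def P_def by auto
  have US: "(\<Union>i\<in>I. B i) \<in> sets P" "(\<Union>s\<in>S. V s) \<in> sets P"
    using Bs Vs finI S(1) by (auto intro!: sets.finite_UN)
  have Es: "E \<in> sets P" unfolding E_def using US Gs by auto
  have "measure P (\<Union>i\<in>I. B i) \<le> (\<Sum>i\<in>I. measure P (B i))"
    using Bs finI by (intro P.finite_measure_subadditive_finite) auto
  also have "\<dots> \<le> (\<Sum>i\<in>I. 2 * exp (- \<epsilon>\<^sup>2 * \<Lambda> / 2))" using Bs by (intro sum_mono) auto
  finally have 1: "measure P (\<Union>i\<in>I. B i) \<le> (real (n + 1))\<^sup>2 * card J * (2 * exp (- \<epsilon>\<^sup>2 * \<Lambda> / 2))"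
    by (simp only: sum_constant cardI)
  have "measure P (\<Union>s\<in>S. V s) \<le> (\<Sum>s\<in>S. measure P (V s))"
    using Vs S(1) by (intro P.finite_measure_subadditive_finite) auto
  also have "\<dots> \<le> (\<Sum>s\<in>S. w ^ n)" using Vs by (intro sum_mono) auto
  finally have 2: "measure P (\<Union>s\<in>S. V s) \<le> card S * w ^ n" by simp
  have "measure P G \<le> measure P (E \<union> ((\<Union>i\<in>I. B i) \<union> (\<Union>s\<in>S. V s)))"
    using Gs US Es by (intro P.finite_measure_mono) (auto simp: E_def)
  also have "\<dots> \<le> measure P E + measure P ((\<Union>i\<in>I. B i) \<union> (\<Union>s\<in>S. V s))"
    using US Es by (intro measure_Un_le) auto
  also have "\<dots> \<le> measure P E + (measure P (\<Union>i\<in>I. B i) + measure P (\<Union>s\<in>S. V s))"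
    using US by (intro add_left_mono measure_Un_le) auto
  finally have m: "1 - ((real (n + 1))\<^sup>2 * card J * (2 * exp (- \<epsilon>\<^sup>2 * \<Lambda> / 2)) + card S * w ^ n) \<le> measure P E"
    using 1 2 Gs by linarith
  show ?thesis
  proof (intro bexI[OF _ Es] conjI m ballI allI impI)
    fix X t assume X: "X \<in> E" and t: "t < n"
    then show "X t \<in> U" unfolding E_def G_def by auto
  next
    fix X s assume X: "X \<in> E" and s: "s \<in> S"
    show "\<exists>t<n. X t \<notin> W s"
    proof (rule ccontr)
      assume "\<not> (\<exists>t<n. X t \<notin> W s)"
      moreover have "X \<in> extensional {..<n}" using X by (auto simp: E_def G_def PiE_def)
      ultimately have "X \<in> V s" unfolding V_def by (auto simp: PiE_def)
      then show False using X s by (auto simp: E_def)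
    qed
  next
    fix X j a b assume X: "X \<in> E" and j: "j \<in> J" and ab: "a \<le> b \<and> b \<le> n"
    have i: "(a, b, j) \<in> I" using ab j by (auto simp: I_def)
    have Xs: "X \<in> space P" using X sets.sets_into_space[OF Es] by auto
    have nB: "X \<notin> B (a, b, j)" using X i by (auto simp: E_def)
    have w: "{a..<b} \<inter> {..<n} = {a..<b}" using ab by auto
    have c: "(\<Sum>t\<in>{a..<b}. indicator (R j) (X t)) = real (card {t \<in> {a..<b}. X t \<in> R j})"
      by (simp add: indicator_def sum.If_cases Int_def)
    show "\<bar>real (card {t \<in> {a..<b}. X t \<in> R j}) - real (b - a) * prob (R j)\<bar>
          \<le> \<epsilon> * (real (b - a) * prob (R j) + \<Lambda>)"
      using nB Xs unfolding B_def by (simp add: w c not_less)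
  qed
qed

section \<open>Lower bound for the optimal tour\<close>

text \<open>Were at most a quarter of the cells occupied, \<open>Occ\<close> itself would contradict
  the assumption on \<open>S\<close>. One of the 2^d parity classes contains at least a fraction
  2^(-d) of \<open>Occ\<close>, and one point from each of its cells gives a separated set.\<close>

lemma opt_tour_ge_occupied:
  fixes e :: "nat \<Rightarrow> 'd::finite" and X :: "nat \<Rightarrow> real ^ 'd"
  assumes U: "\<And>t. t < n \<Longrightarrow> X t \<in> (\<Union>v\<in>grid CARD('d) l. open_block e l v)"
    and S: "\<And>S. S \<subseteq> grid CARD('d) l \<Longrightarrow> 4 * card S \<le> 2 ^ l \<Longrightarrow> \<exists>t<n. X t \<notin> (\<Union>v\<in>S. open_block e l v)"
  shows "(2 ^ l / (4 * 2 ^ CARD('d)) - 1) * ((2 ^ l) powr (- 1 / real CARD('d)) / 2) \<le> opt_tour (map X [0..<n])"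
proof -
  define h where "h = (2 ^ l :: real) powr (- 1 / real CARD('d)) / 2"
  have h: "h > 0" by (simp add: h_def)
  define Occ where "Occ = {v \<in> grid CARD('d) l. \<exists>t<n. X t \<in> open_block e l v}"
  have finO: "finite Occ" using finite_grid by (simp add: Occ_def)
  have "\<not> 4 * card Occ \<le> 2 ^ l"
  proof
    assume "4 * card Occ \<le> 2 ^ l"
    then obtain t where t: "t < n" "X t \<notin> (\<Union>v\<in>Occ. open_block e l v)"
      using S[of Occ] by (auto simp: Occ_def)
    then show False using U[OF t(1)] by (auto simp: Occ_def)
  qed
  then have cO: "2 ^ l / 4 < real (card Occ)"
  proof -
    assume "\<not> 4 * card Occ \<le> 2 ^ l"
    then have "2 ^ l < 4 * card Occ" by simp
    then have "real (2 ^ l) < real (4 * card Occ)" by (simp only: of_nat_less_iff)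
    then show ?thesis by simp
  qed
  define par where "par = (\<lambda>v::nat \<Rightarrow> int. \<lambda>r\<in>{1..CARD('d)}. even (v r))"
  define C where "C = (\<Pi>\<^sub>E r\<in>{1..CARD('d)}. (UNIV :: bool set))"
  have finC: "finite C" unfolding C_def by (intro finite_PiE) auto
  have cardC: "card C = 2 ^ CARD('d)" unfolding C_def by (simp add: card_PiE)
  have parC: "par ` Occ \<subseteq> C" by (auto simp: par_def C_def)
  have "(\<Sum>c\<in>C. card {v \<in> Occ. par v = c}) = card Occ"
    using sum.group[OF finO finC parC, of "\<lambda>_. 1::nat"] by simp
  then have sumC: "(\<Sum>c\<in>C. real (card {v \<in> Occ. par v = c})) = real (card Occ)"
    by (simp flip: of_nat_sum)
  have "\<exists>c\<in>C. real (card Occ) / 2 ^ CARD('d) \<le> real (card {v \<in> Occ. par v = c})"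
  proof (rule ccontr)
    assume "\<not> ?thesis"
    then have "(\<Sum>c\<in>C. real (card {v \<in> Occ. par v = c})) < of_nat (card C) * (real (card Occ) / 2 ^ CARD('d))"
      by (intro sum_bounded_above_strict) (auto simp: cardC not_le)
    then show False by (simp add: sumC cardC)
  qed
  then obtain c where c: "real (card Occ) / 2 ^ CARD('d) \<le> real (card {v \<in> Occ. par v = c})" by blast
  define D where "D = {v \<in> Occ. par v = c}"
  have "\<forall>v\<in>D. \<exists>t<n. X t \<in> open_block e l v" by (auto simp: D_def Occ_def)
  then obtain f where f: "\<And>v. v \<in> D \<Longrightarrow> f v < n \<and> X (f v) \<in> open_block e l v" by metis
  have sep: "h \<le> norm (X (f v) - X (f w))" if vw: "v \<in> D" "w \<in> D" "v \<noteq> w" for v w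
  proof -
    have "v \<in> grid CARD('d) l" "w \<in> grid CARD('d) l" using vw by (auto simp: D_def Occ_def)
    then obtain r where r: "r \<in> {1..CARD('d)}" "v r \<noteq> w r"
      using vw(3) unfolding grid_def by (metis PiE_ext)
    have "par v r = par w r" using vw by (simp add: D_def)
    then have "even (v r) = even (w r)" using r by (simp add: par_def)
    then show ?thesis
      unfolding h_def using same_parity_blocks_dist[of "X (f v)" e l v "X (f w)" w r] f vw r by auto
  qed
  define Q where "Q = (\<lambda>v. X (f v)) ` D"
  have "inj_on (\<lambda>v. X (f v)) D"
  proof (rule inj_onI, rule ccontr)
    fix v w assume "v \<in> D" "w \<in> D" "X (f v) = X (f w)" "v \<noteq> w"
    then show False using sep[of v w] h by simp
  qed
  then have cQ: "card Q = card D" unfolding Q_def by (rule card_image)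
  have "real (card Q - 1) * h \<le> opt_tour (map X [0..<n])"
  proof (rule opt_tour_ge_separated)
    show "Q \<subseteq> set (map X [0..<n])" using f by (auto simp: Q_def)
    show "0 \<le> h" using h by simp
    fix x y assume "x \<in> Q" "y \<in> Q" "x \<noteq> y"
    then show "h \<le> norm (x - y)" unfolding Q_def using sep by auto
  qed
  moreover have "(2 ^ l / (4 * 2 ^ CARD('d)) - 1) * h \<le> real (card Q - 1) * h"
  proof (rule mult_right_mono)
    have "2 ^ l / (4 * 2 ^ CARD('d)) = 2 ^ l / 4 / (2::real) ^ CARD('d)" by simp
    also have "\<dots> \<le> real (card Occ) / 2 ^ CARD('d)" using cO by (intro divide_right_mono) auto
    also have "\<dots> \<le> real (card Q)" using c by (simp add: cQ D_def)
    finally show "2 ^ l / (4 * 2 ^ CARD('d)) - 1 \<le> real (card Q - 1)" by linarith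
  qed (use h in auto)
  ultimately show ?thesis unfolding h_def by linarith
qed

section \<open>The run of the algorithm on a concentrated input\<close>

lemma sum_consecutive_blocks:
  fixes g :: "nat \<Rightarrow> 'a::comm_monoid_add" and p m :: nat
  shows "(\<Sum>c\<in>{p..<p + (\<Sum>j=1..m. b j)}. g c) =
    (\<Sum>j=1..m. \<Sum>c\<in>{p + (\<Sum>j'=1..<j. b j')..<p + (\<Sum>j'=1..<j. b j') + b j}. g c)"
proof (induction m)
  case (Suc m)
  have "(\<Sum>c\<in>{p..<p + (\<Sum>j=1..Suc m. b j)}. g c) =
      (\<Sum>c\<in>{p..<p + (\<Sum>j=1..m. b j)}. g c) +
      (\<Sum>c\<in>{p + (\<Sum>j=1..m. b j)..<p + (\<Sum>j=1..m. b j) + b (Suc m)}. g c)"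
    by (simp add: sum.atLeastLessThan_concat add.assoc)
  then show ?case using Suc by (simp add: atLeastLessThanSuc_atLeastAtMost)
qed simp

definition count_in :: "'d::finite choices \<Rightarrow> (nat \<Rightarrow> real ^ 'd) \<Rightarrow> nat \<Rightarrow> nat \<Rightarrow> nat \<Rightarrow> nat \<Rightarrow> nat" where
  "count_in ch X i j a b = card {t \<in> {a..<b}. bucket_of ch i (X t) = j}"

lemma count_in_refl [simp]: "count_in ch X i j a a = 0"
  by (simp add: count_in_def)

lemma count_in_Suc:
  assumes "a \<le> b"
  shows "count_in ch X i j a (Suc b) = count_in ch X i j a b + (if bucket_of ch i (X b) = j then 1 else 0)"
proof -
  have "{t \<in> {a..<Suc b}. bucket_of ch i (X t) = j} =
      (if bucket_of ch i (X b) = j then insert b else id) {t \<in> {a..<b}. bucket_of ch i (X t) = j}"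
    using assms by (auto simp: less_Suc_eq)
  then show ?thesis by (auto simp: count_in_def card_insert_if)
qed

lemma vacant_put_bucket:
  "vacant (put_bucket n \<B> i j x s) i' j' = (if i' = i \<and> j' = j then vacant s i j - 1 else vacant s i' j')"
  by (auto simp: vacant_def put_bucket_def Let_def)

lemma put_bucket_simps [simp]:
  "phase (put_bucket n \<B> i j x s) = phase s"
  "stuck (put_bucket n \<B> i j x s) = stuck s"
  "bsize (put_bucket n \<B> i j x s) = bsize s"
  "bpts (put_bucket n \<B> i j x s) = (bpts s)(i := (bpts s i)(j := bpts s i j @ [x]))"
  by (auto simp: put_bucket_def Let_def)

text \<open>Division by 2^(i - 1) is division by 2^(i - 2) followed by halving, so each bucket
  region is the union of two regions of the previous subarray.\<close>

lemma bucket_of_pred: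
  assumes "2 \<le> i"
  shows "bucket_of ch (i - 1) x = 2 * bucket_of ch i x - 1 \<or> bucket_of ch (i - 1) x = 2 * bucket_of ch i x"
proof -
  obtain i' where i: "i = Suc (Suc i')" using assms by (metis add_2_eq_Suc le_Suc_ex)
  define b where "b = (assign ch x - 1) div 2 ^ i'"
  have "(assign ch x - 1) div 2 ^ Suc i' = b div 2"
    by (simp add: b_def div_mult2_eq[symmetric] mult.commute)
  then have "bucket_of ch i x = b div 2 + 1" "bucket_of ch (i - 1) x = b + 1"
    by (simp_all add: bucket_of_def i b_def)
  moreover have "b = 2 * (b div 2) \<or> b = 2 * (b div 2) + 1" by presburger
  ultimately show ?thesis by auto
qed

lemma sum_pairs:
  fixes f :: "nat \<Rightarrow> nat"
  shows "(\<Sum>j=1..m. f (2 * j - 1) + f (2 * j)) = (\<Sum>j=1..2 * m. f j)"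
  by (induction m) auto

section \<open>Cells and buckets during a run\<close>

text \<open>Inside the locale the random input is known only through \<open>in_cube\<close> and
  \<open>concentrated\<close>. With \<Lambda> = log^2 n the average bucket size lies between
  \<Lambda> and 2 \<Lambda> in every subarray, because lengths and bucket counts are halved
  together; the - 1 covers rounding.\<close>

locale good_run =
  fixes n :: nat and \<B> :: "'d::finite online_alg" and ch :: "'d choices" and X :: "nat \<Rightarrow> real ^ 'd"
    and \<Lambda> :: real
  assumes placement: "online_placement \<B>"
    and assign_range: "\<And>x. x \<in> unit_cube \<Longrightarrow> assign ch x \<in> {1..2 ^ split_count n}"
    and cap_range: "\<And>h T K j. K > 0 \<Longrightarrow> j \<in> {1..K} \<Longrightarrow> cap ch h T K j \<in> {T div K, T div K + 1}"
    and cap_sum: "\<And>h T K. K > 0 \<Longrightarrow> (\<Sum>j=1..K. cap ch h T K j) = T"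
    and spare_range: "\<And>h S. S \<subset> {..<n} \<Longrightarrow> spare ch h S \<in> {..<n} - S"
    and in_cube: "\<And>t. t < n \<Longrightarrow> X t \<in> unit_cube"
    and last_sub_bounds: "1 \<le> last_sub n" "last_sub n \<le> split_count n"
    and concentrated: "\<And>i j a b. 1 \<le> i \<Longrightarrow> i \<le> last_sub n \<Longrightarrow> j \<in> {1..bucket_count n i} \<Longrightarrow> a \<le> b \<Longrightarrow> b \<le> n \<Longrightarrow>
      \<bar>real (count_in ch X i j a b) - real (b - a) / real (bucket_count n i)\<bar>
        \<le> (real (b - a) / real (bucket_count n i) + \<Lambda>) / 200"
    and Lambda_large: "1000 \<le> \<Lambda>"
    and sub_len_lower: "\<And>i. 1 \<le> i \<Longrightarrow> i \<le> last_sub n \<Longrightarrow> real (bucket_count n i) * (\<Lambda> - 1) \<le> real (sub_len n i)"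
    and sub_len_upper: "\<And>i. 1 \<le> i \<Longrightarrow> i \<le> last_sub n \<Longrightarrow> real (sub_len n i) \<le> 2 * \<Lambda> * real (bucket_count n i)"
    and sub_len_sum: "(\<Sum>i=1..last_sub n. sub_len n i) < n"
begin

abbreviation "k \<equiv> last_sub n"
abbreviation "K \<equiv> bucket_count n"

definition slen :: "nat \<Rightarrow> nat" where
  "slen i = (if i = k + 1 then unallocated n k else sub_len n i)"

definition nb :: "nat \<Rightarrow> nat" where
  "nb i = (if i = k + 1 then 1 else K i)"

text \<open>An online decision depends only on a prefix, so this cell remains the right one when the
  bucket receives more points.\<close>

definition pos :: "'d alg_state \<Rightarrow> nat \<Rightarrow> nat \<Rightarrow> nat \<Rightarrow> nat" where
  "pos s i j r = bucket_start n s i j + \<B> (bsize s i j) (take (Suc r) (bpts s i j))"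

definition placed :: "'d alg_state \<Rightarrow> bool" where
  "placed s \<longleftrightarrow> (\<forall>i\<in>{1..k+1}. (\<Sum>j=1..nb i. bsize s i j) \<le> slen i) \<and>
    (\<forall>i\<in>{1..k+1}. \<forall>j\<in>{1..nb i}. length (bpts s i j) \<le> bsize s i j \<and> set (bpts s i j) \<subseteq> unit_cube \<and>
      (\<forall>r<length (bpts s i j). cells s (pos s i j r) = Some (bpts s i j ! r))) \<and>
    ran (cells s) \<subseteq> unit_cube \<and> dom (cells s) \<subseteq> {..<n}"

text \<open>The converse of the cell condition in \<open>placed\<close>. It guarantees that the next
  cell chosen in a bucket is free, and it fails once spare cells are used.\<close>

definition exact :: "'d alg_state \<Rightarrow> bool" where
  "exact s \<longleftrightarrow> (\<forall>c\<in>dom (cells s). \<exists>i\<in>{1..k+1}. \<exists>j\<in>{1..nb i}. \<exists>r<length (bpts s i j). c = pos s i j r)"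

lemma K_pos: "0 < K i"
  by (simp add: bucket_count_def)

lemma K_pred: "1 \<le> i \<Longrightarrow> i \<le> k \<Longrightarrow> K (i - 1) = 2 * K i"
proof -
  assume i: "1 \<le> i" "i \<le> k"
  then have "split_count n + 1 - (i - 1) = Suc (split_count n + 1 - i)" using last_sub_bounds by linarith
  then show ?thesis unfolding bucket_count_def by simp
qed

lemma nb_eq [simp]: "i \<le> k \<Longrightarrow> nb i = K i"
  by (simp add: nb_def)

lemma bucket_of_range:
  assumes "x \<in> unit_cube" "1 \<le> i" "i \<le> k"
  shows "bucket_of ch i x \<in> {1..K i}"
proof -
  have "assign ch x - 1 < 2 ^ split_count n" using assign_range[OF assms(1)] by auto
  also have "(2::nat) ^ split_count n = 2 ^ (i - 1) * 2 ^ (split_count n + 1 - i)"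
    using assms last_sub_bounds by (simp flip: power_add)
  finally have "(assign ch x - 1) div 2 ^ (i - 1) < 2 ^ (split_count n + 1 - i)"
    by (simp add: less_mult_imp_div_less mult.commute)
  then show ?thesis by (auto simp: bucket_of_def bucket_count_def)
qed

lemma bucket_start_mono:
  assumes "1 \<le> j" "j < j'"
  shows "bucket_start n s i j + bsize s i j \<le> bucket_start n s i j'"
proof -
  have "(\<Sum>j'=1..<j. bsize s i j') + bsize s i j = (\<Sum>j'=1..<Suc j. bsize s i j')"
    using assms by simp
  also have "\<dots> \<le> (\<Sum>j'=1..<j'. bsize s i j')" using assms by (intro sum_mono2) auto
  finally show ?thesis by (simp add: bucket_start_def)
qed

lemma bucket_end_le:
  assumes "(\<Sum>j=1..nb i. bsize s i j) \<le> slen i" "j \<in> {1..nb i}"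
  shows "bucket_start n s i j + bsize s i j \<le> (\<Sum>i'=1..<i. sub_len n i') + slen i"
proof -
  have "(\<Sum>j'=1..<j. bsize s i j') + bsize s i j = (\<Sum>j'=1..<Suc j. bsize s i j')"
    using assms by simp
  also have "\<dots> \<le> (\<Sum>j=1..nb i. bsize s i j)" using assms by (intro sum_mono2) auto
  finally show ?thesis using assms(1) by (simp add: bucket_start_def)
qed

lemma sub_start_mono:
  assumes "1 \<le> i" "i < i'" "i' \<le> k + 1"
  shows "(\<Sum>i'=1..<i. sub_len n i') + slen i \<le> (\<Sum>i'=1..<i'. sub_len n i')"
proof -
  have "(\<Sum>i'=1..<i. sub_len n i') + slen i = (\<Sum>i'=1..<Suc i. sub_len n i')"
    using assms by (simp add: slen_def)
  also have "\<dots> \<le> (\<Sum>i'=1..<i'. sub_len n i')" using assms by (intro sum_mono2) auto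
  finally show ?thesis .
qed

lemma sub_end_le:
  assumes "i \<in> {1..k+1}"
  shows "(\<Sum>i'=1..<i. sub_len n i') + slen i \<le> n"
proof -
  have *: "(\<Sum>i'=1..<k+1. sub_len n i') + slen (k + 1) = n"
    using sub_len_sum by (simp add: slen_def unallocated_def atLeastLessThanSuc_atLeastAtMost)
  show ?thesis
  proof (cases "i = k + 1")
    case False
    then show ?thesis using sub_start_mono[of i "k + 1"] assms * by auto
  qed (use * in simp)
qed

lemma bucket_disjoint:
  assumes sz: "\<And>i. i \<in> {1..k+1} \<Longrightarrow> (\<Sum>j=1..nb i. bsize s i j) \<le> slen i"
    and ij: "i \<in> {1..k+1}" "j \<in> {1..nb i}" "i' \<in> {1..k+1}" "j' \<in> {1..nb i'}"
    and c: "bucket_start n s i j \<le> c" "c < bucket_start n s i j + bsize s i j"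
      "bucket_start n s i' j' \<le> c" "c < bucket_start n s i' j' + bsize s i' j'"
  shows "i = i' \<and> j = j'"
proof -
  have no: False if "i\<^sub>1 < i\<^sub>2" "i\<^sub>1 \<in> {1..k+1}" "i\<^sub>2 \<in> {1..k+1}" "j\<^sub>1 \<in> {1..nb i\<^sub>1}"
    "c < bucket_start n s i\<^sub>1 j\<^sub>1 + bsize s i\<^sub>1 j\<^sub>1" "bucket_start n s i\<^sub>2 j\<^sub>2 \<le> c" for i\<^sub>1 i\<^sub>2 j\<^sub>1 j\<^sub>2
  proof -
    have "c < (\<Sum>i'=1..<i\<^sub>1. sub_len n i') + slen i\<^sub>1"
      using bucket_end_le[OF sz[OF that(2)] that(4)] that by linarith
    also have "\<dots> \<le> (\<Sum>i'=1..<i\<^sub>2. sub_len n i')" using sub_start_mono that by auto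
    also have "\<dots> \<le> bucket_start n s i\<^sub>2 j\<^sub>2" by (simp add: bucket_start_def)
    finally show False using that by simp
  qed
  have "i = i'" using no[of i i' j j'] no[of i' i j' j] ij c by (metis linorder_less_linear)
  moreover have "j = j'"
    using bucket_start_mono[of j j' s i] bucket_start_mono[of j' j s i] ij c \<open>i = i'\<close>
    by (cases j j' rule: linorder_cases) auto
  ultimately show ?thesis by simp
qed

lemma placement_range:
  assumes "length ps \<le> m" "set ps \<subseteq> unit_cube" "r < length ps"
  shows "\<B> m (take (Suc r) ps) < m"
  using placement assms unfolding online_placement_def by blast

lemma placement_inj:
  assumes "length ps \<le> m" "set ps \<subseteq> unit_cube"
  shows "inj_on (\<lambda>r. \<B> m (take (Suc r) ps)) {..<length ps}"
  using placement assms unfolding online_placement_def by blast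

text \<open>The cell chosen by \<open>\<B>\<close> is free: other buckets occupy disjoint intervals,
  within the bucket \<open>\<B>\<close> is injective on the extended sequence, and by
  \<open>exact\<close> no further cell is occupied.\<close>

lemma put_bucket_placed:
  assumes pl: "placed s" and ex: "exact s" and ij: "i \<in> {1..k+1}" "j \<in> {1..nb i}"
    and v: "0 < vacant s i j" and x: "x \<in> unit_cube"
  defines "s' \<equiv> put_bucket n \<B> i j x s"
  shows "placed s'" "exact s'" "card (dom (cells s')) = Suc (card (dom (cells s)))"
proof -
  define ps where "ps = bpts s i j"
  define m where "m = bsize s i j"
  define c where "c = bucket_start n s i j + \<B> m (ps @ [x])"
  have sz: "\<And>i. i \<in> {1..k+1} \<Longrightarrow> (\<Sum>j=1..nb i. bsize s i j) \<le> slen i"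
    and pb: "\<And>i j. i \<in> {1..k+1} \<Longrightarrow> j \<in> {1..nb i} \<Longrightarrow> length (bpts s i j) \<le> bsize s i j \<and> set (bpts s i j) \<subseteq> unit_cube \<and>
      (\<forall>r<length (bpts s i j). cells s (pos s i j r) = Some (bpts s i j ! r))"
    and rd: "ran (cells s) \<subseteq> unit_cube" "dom (cells s) \<subseteq> {..<n}"
    using pl unfolding placed_def by blast+
  have len: "length (ps @ [x]) \<le> m" using v by (simp add: vacant_def ps_def m_def)
  have sub: "set (ps @ [x]) \<subseteq> unit_cube" using pb[OF ij] x by (simp add: ps_def)
  have cB: "\<B> m (ps @ [x]) < m" using placement_range[OF len sub, of "length ps"] by simp
  have cells': "cells s' = (cells s)(c \<mapsto> x)"
    by (simp add: s'_def put_bucket_def Let_def c_def ps_def m_def)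
  have bs': "bsize s' = bsize s" by (simp add: s'_def)
  have bp': "bpts s' = (bpts s)(i := (bpts s i)(j := ps @ [x]))" by (simp add: s'_def ps_def)
  have st': "bucket_start n s' = bucket_start n s" by (simp add: bucket_start_def bs' fun_eq_iff)
  have pos_old: "pos s' i' j' r = pos s i' j' r" if "r < length (bpts s i' j')" for i' j' r
    using that by (auto simp: pos_def st' bs' bp' ps_def)
  have pos_new: "pos s' i j (length ps) = c" by (simp add: pos_def st' bs' bp' c_def m_def)
  have fresh: "pos s i' j' r \<noteq> c" if *: "i' \<in> {1..k+1}" "j' \<in> {1..nb i'}" "r < length (bpts s i' j')" for i' j' r
  proof
    assume eq: "pos s i' j' r = c"
    have "\<B> (bsize s i' j') (take (Suc r) (bpts s i' j')) < bsize s i' j'"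
      using placement_range pb[OF *(1,2)] *(3) by blast
    then have "i = i' \<and> j = j'"
      using bucket_disjoint[OF sz ij *(1,2), of c] cB eq by (auto simp: c_def m_def pos_def)
    then have r: "r < length ps" and "\<B> m (take (Suc r) ps) = \<B> m (ps @ [x])"
      using eq * by (auto simp: pos_def c_def m_def ps_def)
    then have "\<B> m (take (Suc r) (ps @ [x])) = \<B> m (take (Suc (length ps)) (ps @ [x]))" by simp
    then have "r = length ps" using inj_onD[OF placement_inj[OF len sub], of r "length ps"] r by auto
    then show False using r by simp
  qed
  have c_notin: "c \<notin> dom (cells s)" using ex fresh unfolding exact_def by metis
  have "finite (dom (cells s))" using rd finite_subset by blast
  then show "card (dom (cells s')) = Suc (card (dom (cells s)))" using c_notin by (simp add: cells')
  have cn: "c < n"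
    using bucket_end_le[OF sz[OF ij(1)] ij(2)] sub_end_le[OF ij(1)] cB by (simp add: c_def m_def)
  have cell: "cells s' (pos s' i' j' r) = Some (bpts s' i' j' ! r)"
    if *: "i' \<in> {1..k+1}" "j' \<in> {1..nb i'}" "r < length (bpts s' i' j')" for i' j' r
  proof (cases "r < length (bpts s i' j')")
    case True
    then have "cells s' (pos s' i' j' r) = Some (bpts s i' j' ! r)"
      using pb[OF *(1,2)] fresh[OF *(1,2) True] pos_old[OF True] by (simp add: cells')
    then show ?thesis using True by (auto simp: bp' ps_def nth_append)
  next
    case False
    then have "i' = i" "j' = j" "r = length ps" using *(3) by (auto simp: bp' ps_def split: if_splits)
    then show ?thesis using pos_new by (simp add: cells' bp')
  qed
  have "length (bpts s' i' j') \<le> bsize s' i' j' \<and> set (bpts s' i' j') \<subseteq> unit_cube"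
    if *: "i' \<in> {1..k+1}" "j' \<in> {1..nb i'}" for i' j'
    using pb[OF *] len sub by (auto simp: bp' bs' m_def)
  then show "placed s'"
    unfolding placed_def using cell sz rd cn x
    by (auto simp: bs' cells' ran_map_upd ran_def split: if_splits)
  show "exact s'"
    unfolding exact_def
  proof
    fix c' assume "c' \<in> dom (cells s')"
    then consider "c' = c" | "c' \<in> dom (cells s)" by (auto simp: cells')
    then show "\<exists>i\<in>{1..k+1}. \<exists>j\<in>{1..nb i}. \<exists>r<length (bpts s' i j). c' = pos s' i j r"
    proof cases
      case 1
      have "length ps < length (bpts s' i j)" by (simp add: bp')
      then show ?thesis using pos_new ij 1 by blast
    next
      case 2
      then obtain i' j' r where *: "i' \<in> {1..k+1}" "j' \<in> {1..nb i'}" "r < length (bpts s i' j')" "c' = pos s i' j' r"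
        using ex unfolding exact_def by blast
      have "r < length (bpts s' i' j')" using *(3) by (auto simp: bp' ps_def)
      then show ?thesis using * pos_old[OF *(3)] by metis
    qed
  qed
qed

text \<open>Positions in a subarray depend only on its own bucket sizes and on the fixed lengths of
  earlier subarrays, so sizing a still empty subarray moves nothing.\<close>

lemma set_sizes_placed:
  fixes p :: nat and g :: "nat \<Rightarrow> nat"
  assumes pl: "placed s" and ex: "exact s" and i: "i \<in> {1..k+1}" and e: "\<And>j. bpts s i j = []"
    and g: "(\<Sum>j=1..nb i. g j) \<le> slen i"
  defines "s' \<equiv> s\<lparr>phase := p, bsize := (bsize s)(i := g)\<rparr>"
  shows "placed s'" "exact s'"
proof -
  have p: "pos s' i' j r = pos s i' j r" if "i' \<noteq> i" for i' j r
    using that by (simp add: s'_def pos_def bucket_start_def)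
  have sz: "(\<Sum>j=1..nb i'. bsize s' i' j) \<le> slen i'" if "i' \<in> {1..k+1}" for i'
    using that pl g by (auto simp: placed_def s'_def)
  have "length (bpts s' i' j) \<le> bsize s' i' j \<and> set (bpts s' i' j) \<subseteq> unit_cube \<and>
      (\<forall>r<length (bpts s' i' j). cells s' (pos s' i' j r) = Some (bpts s' i' j ! r))"
    if "i' \<in> {1..k+1}" "j \<in> {1..nb i'}" for i' j
  proof (cases "i' = i")
    case True
    then show ?thesis using e by (simp add: s'_def)
  next
    case False
    then show ?thesis using pl that unfolding placed_def by (simp add: p) (simp add: s'_def)
  qed
  then show "placed s'" using sz pl unfolding placed_def by (auto simp: s'_def)
  show "exact s'" unfolding exact_def
  proof
    fix c assume "c \<in> dom (cells s')"
    then have "c \<in> dom (cells s)" by (simp add: s'_def)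
    then obtain i' j r where *: "i' \<in> {1..k+1}" "j \<in> {1..nb i'}" "r < length (bpts s i' j)" "c = pos s i' j r"
      using ex unfolding exact_def by blast
    have "i' \<noteq> i" using * e by auto
    then have "c = pos s' i' j r" "r < length (bpts s' i' j)" using * p by (auto simp: s'_def)
    then show "\<exists>i\<in>{1..k+1}. \<exists>j\<in>{1..nb i}. \<exists>r<length (bpts s' i j). c = pos s' i j r"
      using *(1,2) by blast
  qed
qed

section \<open>Invariants of the phases\<close>

abbreviation "cnt \<equiv> count_in ch X"

text \<open>Nonempty buckets ensure that the two cells at a bucket border hold points of consecutive
  regions; the bound 4 \<Lambda> limits the competitive ratio inside a bucket.\<close>

definition buckets_ok :: "nat \<Rightarrow> 'd alg_state \<Rightarrow> bool" where
  "buckets_ok i s \<longleftrightarrow> (\<Sum>j=1..K i. bsize s i j) = sub_len n i \<and>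
    (\<forall>j\<in>{1..K i}. 1 \<le> bsize s i j \<and> real (bsize s i j) \<le> 4 * \<Lambda> \<and>
      (\<forall>x\<in>set (bpts s i j). bucket_of ch i x = j))"

text \<open>Phase \<open>i\<close> began after \<open>\<tau>\<close> arrivals, when bucket \<open>j\<close> of \<open>A\<^sub>i\<^sub>-\<^sub>1\<close> had \<open>u j\<close> empty cells; every bin
  then had capacity \<open>Q\<close> or \<open>Q + 1\<close>.\<close>

definition bins :: "nat \<Rightarrow> nat \<Rightarrow> (nat \<Rightarrow> nat) \<Rightarrow> nat \<Rightarrow> nat \<Rightarrow> 'd alg_state \<Rightarrow> bool" where
  "bins i \<tau> u Q t s \<longleftrightarrow> \<tau> \<le> t \<and>
    (\<forall>j\<in>{1..K (i - 1)}. (0 < u j \<longrightarrow> 2 \<le> i) \<and> real (u j) \<le> \<Lambda> / 10 \<and>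
      vacant s (i - 1) j = u j - cnt (i - 1) j \<tau> t) \<and>
    \<Lambda> - 2 \<le> real Q \<and> real Q \<le> 3 * \<Lambda> \<and>
    (\<forall>j\<in>{1..K i}. u (2 * j - 1) + u (2 * j) + bsize s i j \<in> {Q, Q + 1} \<and>
      vacant s (i - 1) (2 * j - 1) + vacant s (i - 1) (2 * j) + vacant s i j + cnt i j \<tau> t =
        u (2 * j - 1) + u (2 * j) + bsize s i j)"

definition good :: "nat \<Rightarrow> nat \<Rightarrow> (nat \<Rightarrow> nat) \<Rightarrow> nat \<Rightarrow> nat \<Rightarrow> 'd alg_state \<Rightarrow> bool" where
  "good i \<tau> u Q t s \<longleftrightarrow> phase s = i \<and> \<not> stuck s \<and> 1 \<le> i \<and> i \<le> k \<and> placed s \<and> exact s \<and>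
    card (dom (cells s)) = t \<and> (\<forall>i'\<in>{1..i}. buckets_ok i' s) \<and> (\<forall>i'>i. \<forall>j. bpts s i' j = []) \<and>
    (\<forall>i'\<in>{1..<i - 1}. \<forall>j\<in>{1..K i'}. vacant s i' j = 0) \<and> bins i \<tau> u Q t s"

text \<open>Spare cells destroy \<open>exact\<close>, but they are used only once \<open>B\<close>
  is full, and from then on no bucket receives a point. Fullness is recorded below \<open>k\<close>
  only: \<open>A\<^sub>k\<close> may still have free cells when it overflows.\<close>

definition final :: "nat \<Rightarrow> 'd alg_state \<Rightarrow> bool" where
  "final t s \<longleftrightarrow> phase s = k + 1 \<and> \<not> stuck s \<and> placed s \<and> (exact s \<or> vacant s (k + 1) 1 = 0) \<and>
    card (dom (cells s)) = t \<and> (\<forall>i\<in>{1..<k}. buckets_ok i s \<and> (\<forall>j\<in>{1..K i}. vacant s i j = 0))"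

definition settle :: "nat \<Rightarrow> real ^ 'd \<Rightarrow> 'd alg_state \<Rightarrow> 'd alg_state" where
  "settle i x s = (if i \<ge> 2 \<and> vacant s (i - 1) (bucket_of ch (i - 1) x) > 0
    then put_bucket n \<B> (i - 1) (bucket_of ch (i - 1) x) x s
    else put_bucket n \<B> i (bucket_of ch i x) x s)"

lemma buckets_ok_put_bucket:
  assumes "buckets_ok i' s" "bucket_of ch i x = j"
  shows "buckets_ok i' (put_bucket n \<B> i j x s)"
  using assms by (auto simp: buckets_ok_def)

text \<open>Reduces preservation of \<open>good\<close> to the accounting in
  \<open>bins\<close>.\<close>

lemma good_put:
  assumes g: "good i \<tau> u Q t s" and x: "x \<in> unit_cube"
    and i': "i' = i \<or> i' = i - 1" "1 \<le> i'" and j: "j = bucket_of ch i' x"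
    and v: "0 < vacant s i' j" and b: "bins i \<tau> u Q (Suc t) (put_bucket n \<B> i' j x s)"
  shows "good i \<tau> u Q (Suc t) (put_bucket n \<B> i' j x s)"
proof -
  have i: "1 \<le> i" "i \<le> k" "placed s" "exact s" and ph: "phase s = i" "\<not> stuck s" "card (dom (cells s)) = t"
    using g unfolding good_def by blast+
  have ij: "i' \<in> {1..k+1}" "j \<in> {1..nb i'}"
    using i i' bucket_of_range[OF x, of i'] j by auto
  note pp = put_bucket_placed[OF i(3,4) ij v x]
  have ok: "\<forall>i''\<in>{1..i}. buckets_ok i'' (put_bucket n \<B> i' j x s)"
    using g buckets_ok_put_bucket j unfolding good_def by blast
  have em: "\<forall>i''>i. \<forall>j'. bpts (put_bucket n \<B> i' j x s) i'' j' = []"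
    using g i' unfolding good_def by auto
  have va: "\<forall>i''\<in>{1..<i - 1}. \<forall>j'\<in>{1..K i''}. vacant (put_bucket n \<B> i' j x s) i'' j' = 0"
    using g unfolding good_def vacant_put_bucket by auto
  show ?thesis
    unfolding good_def using pp ok em va b i ph by auto
qed

text \<open>Each arrival in the region of a bin uses up one free cell of that bin, so free cells
  plus arrivals since \<open>\<tau>\<close> stay constant. A bucket of the previous subarray takes
  every point of its region while it has room, hence the truncated difference for its free
  cells.\<close>

lemma good_settle:
  assumes g: "good i \<tau> u Q t s" and t: "t < n" and no: "\<not> overflows n ch (X t) s"
  shows "good i \<tau> u Q (Suc t) (settle i (X t) s)"
proof -
  define x where "x = X t"
  have x: "x \<in> unit_cube" using in_cube[OF t] by (simp add: x_def)
  have i: "1 \<le> i" "i \<le> k" and ph: "phase s = i" "\<not> stuck s" and bn: "bins i \<tau> u Q t s"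
    using g unfolding good_def by blast+
  define b where "b = bucket_of ch (i - 1) x"
  define j where "j = bucket_of ch i x"
  have \<tau>: "\<tau> \<le> t"
    and b1: "\<And>j. j \<in> {1..K (i - 1)} \<Longrightarrow> (0 < u j \<longrightarrow> 2 \<le> i) \<and> real (u j) \<le> \<Lambda> / 10 \<and> vacant s (i - 1) j = u j - cnt (i - 1) j \<tau> t"
    and Q: "\<Lambda> - 2 \<le> real Q" "real Q \<le> 3 * \<Lambda>"
    and b2: "\<And>j. j \<in> {1..K i} \<Longrightarrow> u (2 * j - 1) + u (2 * j) + bsize s i j \<in> {Q, Q + 1} \<and>
      vacant s (i - 1) (2 * j - 1) + vacant s (i - 1) (2 * j) + vacant s i j + cnt i j \<tau> t =
        u (2 * j - 1) + u (2 * j) + bsize s i j"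
    using bn unfolding bins_def by blast+
  have cS: "cnt i' j' \<tau> (Suc t) = cnt i' j' \<tau> t + (if bucket_of ch i' x = j' then 1 else 0)" for i' j'
    unfolding x_def by (rule count_in_Suc[OF \<tau>])
  have jr: "j \<in> {1..K i}" unfolding j_def by (rule bucket_of_range[OF x i])
  show ?thesis
  proof (cases "i \<ge> 2 \<and> vacant s (i - 1) b > 0")
    case True
    have bj: "b = 2 * j - 1 \<or> b = 2 * j" unfolding b_def j_def using True by (intro bucket_of_pred) auto
    define s' where "s' = put_bucket n \<B> (i - 1) b x s"
    have v': "vacant s' i' j' = (if i' = i - 1 \<and> j' = b then vacant s (i - 1) b - 1 else vacant s i' j')" for i' j'
      unfolding s'_def vacant_put_bucket ..
    have bs': "bsize s' = bsize s" by (simp add: s'_def)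
    have "bins i \<tau> u Q (Suc t) s'"
      unfolding bins_def
    proof (intro conjI ballI)
      show "\<tau> \<le> Suc t" using \<tau> by simp
      show "\<Lambda> - 2 \<le> real Q" "real Q \<le> 3 * \<Lambda>" using Q by auto
      fix j' assume "j' \<in> {1..K (i - 1)}"
      note bb = b1[OF this]
      then show "0 < u j' \<longrightarrow> 2 \<le> i" "real (u j') \<le> \<Lambda> / 10" by auto
      show "vacant s' (i - 1) j' = u j' - cnt (i - 1) j' \<tau> (Suc t)"
        using bb by (auto simp: v' cS b_def)
    next
      fix j' assume j': "j' \<in> {1..K i}"
      show "u (2 * j' - 1) + u (2 * j') + bsize s' i j' \<in> {Q, Q + 1}"
        using b2[OF j'] by (simp add: bs')
      have ii: "i - 1 \<noteq> i" "i \<noteq> i - 1" using i by auto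
      show "vacant s' (i - 1) (2 * j' - 1) + vacant s' (i - 1) (2 * j') + vacant s' i j' + cnt i j' \<tau> (Suc t) =
        u (2 * j' - 1) + u (2 * j') + bsize s' i j'"
      proof (cases "j' = j")
        case jj: True
        have "2 * j - 1 \<noteq> 2 * j" using jr by auto
        then show ?thesis using b2[OF jr] bj True ii unfolding jj
          by (auto simp: v' cS bs' simp flip: j_def)
      next
        case False
        have "b \<noteq> 2 * j' - 1" "b \<noteq> 2 * j'" using bj False jr j' by auto
        then show ?thesis using b2[OF j'] ii False by (auto simp: v' cS bs' simp flip: j_def)
      qed
    qed
    then have "good i \<tau> u Q (Suc t) s'"
      unfolding s'_def using good_put[OF g x, of "i - 1" b] True i b_def by auto
    then show ?thesis using True by (simp add: settle_def s'_def b_def x_def)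
  next
    case False
    have vj: "0 < vacant s i j"
      using no False ph i unfolding overflows_def by (auto simp: b_def j_def x_def)
    define s' where "s' = put_bucket n \<B> i j x s"
    have v': "vacant s' i' j' = (if i' = i \<and> j' = j then vacant s i j - 1 else vacant s i' j')" for i' j'
      unfolding s'_def vacant_put_bucket ..
    have bs': "bsize s' = bsize s" by (simp add: s'_def)
    have ii: "i - 1 \<noteq> i" "i \<noteq> i - 1" using i by auto
    have "bins i \<tau> u Q (Suc t) s'"
      unfolding bins_def
    proof (intro conjI ballI)
      show "\<tau> \<le> Suc t" using \<tau> by simp
      show "\<Lambda> - 2 \<le> real Q" "real Q \<le> 3 * \<Lambda>" using Q by auto
      fix j' assume "j' \<in> {1..K (i - 1)}"
      note bb = b1[OF this]
      then show "0 < u j' \<longrightarrow> 2 \<le> i" "real (u j') \<le> \<Lambda> / 10" by auto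
      \<comment> \<open>By truncated subtraction, an arrival in the region of a full bucket leaves
        its vacancy at 0; in phase 1 all \<open>u j'\<close> are 0.\<close>
      have "vacant s (i - 1) b = 0 \<or> u j' = 0" using False bb by auto
      then show "vacant s' (i - 1) j' = u j' - cnt (i - 1) j' \<tau> (Suc t)"
        using bb ii by (auto simp: v' cS b_def)
    next
      fix j' assume j': "j' \<in> {1..K i}"
      show "u (2 * j' - 1) + u (2 * j') + bsize s' i j' \<in> {Q, Q + 1}"
        using b2[OF j'] by (simp add: s'_def)
      show "vacant s' (i - 1) (2 * j' - 1) + vacant s' (i - 1) (2 * j') + vacant s' i j' + cnt i j' \<tau> (Suc t) =
        u (2 * j' - 1) + u (2 * j') + bsize s' i j'"
        using b2[OF j'] vj ii by (auto simp: v' cS bs' simp flip: j_def)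
    qed
    then have "good i \<tau> u Q (Suc t) s'"
      unfolding s'_def using good_put[OF g x, of i j] vj i j_def by auto
    then show ?thesis using False by (auto simp: settle_def s'_def b_def j_def x_def)
  qed
qed

text \<open>Concentration at the moment of overflow: the overflowing bin is full, so every bin is nearly
  full, and each bucket of the previous subarray, having had few empty cells, is full.\<close>

lemma overflow_full:
  assumes g: "good i \<tau> u Q t s" and t: "t < n" and ov: "overflows n ch (X t) s"
  shows "\<And>j. j \<in> {1..K (i - 1)} \<Longrightarrow> vacant s (i - 1) j = 0"
    and "\<And>j. j \<in> {1..K i} \<Longrightarrow> real (vacant s i j) \<le> \<Lambda> / 10"
proof -
  define x where "x = X t"
  have x: "x \<in> unit_cube" using in_cube[OF t] by (simp add: x_def)
  have i: "1 \<le> i" "i \<le> k" and ph: "phase s = i" "\<not> stuck s" and bn: "bins i \<tau> u Q t s"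
    using g unfolding good_def by blast+
  define b where "b = bucket_of ch (i - 1) x"
  define j where "j = bucket_of ch i x"
  have \<tau>: "\<tau> \<le> t"
    and b1: "\<And>j. j \<in> {1..K (i - 1)} \<Longrightarrow> (0 < u j \<longrightarrow> 2 \<le> i) \<and> real (u j) \<le> \<Lambda> / 10 \<and> vacant s (i - 1) j = u j - cnt (i - 1) j \<tau> t"
    and Q: "\<Lambda> - 2 \<le> real Q" "real Q \<le> 3 * \<Lambda>"
    and b2: "\<And>j. j \<in> {1..K i} \<Longrightarrow> u (2 * j - 1) + u (2 * j) + bsize s i j \<in> {Q, Q + 1} \<and>
      vacant s (i - 1) (2 * j - 1) + vacant s (i - 1) (2 * j) + vacant s i j + cnt i j \<tau> t =
        u (2 * j - 1) + u (2 * j) + bsize s i j"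
    using bn unfolding bins_def by blast+
  have jr: "j \<in> {1..K i}" unfolding j_def by (rule bucket_of_range[OF x i])
  have Kp: "K (i - 1) = 2 * K i" by (rule K_pred[OF i])
  define \<mu> where "\<mu> = real (t - \<tau>) / real (K i)"
  have c: "\<bar>real (cnt i j' \<tau> t) - \<mu>\<bar> \<le> (\<mu> + \<Lambda>) / 200" if "j' \<in> {1..K i}" for j'
    using concentrated[OF i that \<tau>] t by (simp add: \<mu>_def)
  have c': "\<bar>real (cnt (i - 1) j' \<tau> t) - \<mu> / 2\<bar> \<le> (\<mu> / 2 + \<Lambda>) / 200" if "j' \<in> {1..K (i - 1)}" "2 \<le> i" for j'
  proof -
    have eq: "real (t - \<tau>) / real (K (i - 1)) = \<mu> / 2" unfolding Kp \<mu>_def by simp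
    have "1 \<le> i - 1" "i - 1 \<le> k" using that i by auto
    from concentrated[OF this that(1) \<tau> less_imp_le[OF t]] show ?thesis unfolding eq .
  qed
  \<comment> \<open>At most \<Lambda> / 10 points have reached this bucket, whose mean is \<mu> / 2.
    Solving \<mu> / 2 - (\<mu> / 2 + \<Lambda>) / 200 \<le> \<Lambda> / 10 gives the constants: such
    a phase is too short to fill a bin.\<close>
  have small: "199 * \<mu> \<le> 42 * \<Lambda>" if j': "j' \<in> {1..K (i - 1)}" "0 < vacant s (i - 1) j'" for j'
  proof -
    have "0 < u j'" "cnt (i - 1) j' \<tau> t < u j'" using b1[OF j'(1)] j'(2) by auto
    then have i2: "2 \<le> i" and "real (cnt (i - 1) j' \<tau> t) \<le> \<Lambda> / 10" using b1[OF j'(1)] by auto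
    moreover have "\<mu> / 2 - real (cnt (i - 1) j' \<tau> t) \<le> (\<mu> / 2 + \<Lambda>) / 200"
      using c'[OF j'(1) i2] unfolding abs_le_iff by simp
    ultimately show ?thesis by (simp add: field_simps)
  qed
  have vj: "vacant s i j = 0" and vb: "2 \<le> i \<Longrightarrow> vacant s (i - 1) b = 0"
    using ov ph unfolding overflows_def j_def b_def x_def by auto
  have in2: "2 * j - 1 \<in> {1..K (i - 1)}" "2 * j \<in> {1..K (i - 1)}" using jr unfolding Kp by auto
  \<comment> \<open>The arriving point belongs to bucket \<open>b\<close> of the pair, which has no
    room; only the sibling can have free cells.\<close>
  have one: "real (vacant s (i - 1) (2 * j - 1) + vacant s (i - 1) (2 * j)) \<le> \<Lambda> / 10 \<and>
      (0 < vacant s (i - 1) (2 * j - 1) + vacant s (i - 1) (2 * j) \<longrightarrow> 199 * \<mu> \<le> 42 * \<Lambda>)"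
  proof (cases "2 \<le> i")
    case True
    have le: "real (vacant s (i - 1) j') \<le> \<Lambda> / 10" if "j' \<in> {1..K (i - 1)}" for j'
      using b1[OF that] by auto
    have bj: "b = 2 * j - 1 \<or> b = 2 * j" unfolding b_def j_def using True by (intro bucket_of_pred) auto
    then show ?thesis using vb[OF True] le[OF in2(1)] le[OF in2(2)] small[OF in2(1)] small[OF in2(2)] by auto
  next
    case False
    then show ?thesis using b1[OF in2(1)] b1[OF in2(2)] Lambda_large by auto
  qed
  \<comment> \<open>Otherwise at least \<Lambda> - 2 - \<Lambda> / 10 points would have arrived in
    this region although \<mu> is below \<Lambda> / 4, against concentration.\<close>
  have z: "vacant s (i - 1) (2 * j - 1) + vacant s (i - 1) (2 * j) = 0"
  proof (rule ccontr)
    assume nz: "vacant s (i - 1) (2 * j - 1) + vacant s (i - 1) (2 * j) \<noteq> 0"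
    then have m: "199 * \<mu> \<le> 42 * \<Lambda>" using one by auto
    have "Q \<le> vacant s (i - 1) (2 * j - 1) + vacant s (i - 1) (2 * j) + cnt i j \<tau> t"
      using b2[OF jr] vj by auto
    then have "real Q \<le> real (vacant s (i - 1) (2 * j - 1) + vacant s (i - 1) (2 * j)) + real (cnt i j \<tau> t)"
      by (simp only: of_nat_le_iff flip: of_nat_add)
    then have "\<Lambda> - 2 \<le> \<Lambda> / 10 + real (cnt i j \<tau> t)" using one Q by linarith
    then show False using conjunct1[OF c[OF jr, unfolded abs_le_iff]] m Lambda_large by (simp add: field_simps)
  qed
  have "Q \<le> cnt i j \<tau> t" using b2[OF jr] vj z by auto
  then have \<mu>: "real Q \<le> \<mu> + (\<mu> + \<Lambda>) / 200" using c[OF jr] unfolding abs_le_iff by linarith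
  show "vacant s (i - 1) j' = 0" if "j' \<in> {1..K (i - 1)}" for j'
  proof (rule ccontr)
    assume "vacant s (i - 1) j' \<noteq> 0"
    then have "199 * \<mu> \<le> 42 * \<Lambda>" using small[OF that] by simp
    then show False using \<mu> Q Lambda_large by (simp add: field_simps)
  qed
  \<comment> \<open>Two deviations of (\<mu> + \<Lambda>) / 200 separate this bin from the
    overflowing one. As Q \<le> 3 \<Lambda>, they account for about \<Lambda> / 25 free cells plus
    rounding, less than \<Lambda> / 10.\<close>
  show "real (vacant s i j') \<le> \<Lambda> / 10" if j': "j' \<in> {1..K i}" for j'
  proof -
    have "vacant s i j' + cnt i j' \<tau> t \<le> Q + 1" using b2[OF j'] by auto
    then have "real (vacant s i j') + real (cnt i j' \<tau> t) \<le> real Q + 1" by linarith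
    then show ?thesis using conjunct2[OF c[OF j', unfolded abs_le_iff]] \<mu> Q Lambda_large by (simp add: field_simps)
  qed
qed

text \<open>A new bin already contains at most \<Lambda> / 5 free cells, from two buckets, against a
  capacity of at least \<Lambda> - 2. So the algorithm does not get stuck, every new bucket has
  positive size, and the arriving point finds room.\<close>

lemma good_next_phase:
  assumes g: "good i \<tau> u Q t s" and t: "t < n" and ov: "overflows n ch (X t) s" and ik: "i < k"
  shows "\<exists>u Q. good (Suc i) t u Q t (next_phase n ch h s)" and "\<not> overflows n ch (X t) (next_phase n ch h s)"
proof -
  have i: "1 \<le> i" "i \<le> k" and ph: "phase s = i" "\<not> stuck s" and bn: "bins i \<tau> u Q t s"
    and pl: "placed s" "exact s" and cd: "card (dom (cells s)) = t"
    and ok: "\<And>i'. i' \<in> {1..i} \<Longrightarrow> buckets_ok i' s"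
    and em: "\<And>i' j. i' > i \<Longrightarrow> bpts s i' j = []"
    and full: "\<And>i' j. i' \<in> {1..<i - 1} \<Longrightarrow> j \<in> {1..K i'} \<Longrightarrow> vacant s i' j = 0"
    using g unfolding good_def by blast+
  define i1 where "i1 = Suc i"
  have i1: "1 \<le> i1" "i1 \<le> k" using ik by (auto simp: i1_def)
  define N where "N = (\<Sum>j=1..K i. length (bpts s i j))"
  define T where "T = sub_len n i + sub_len n i1 - N"
  define C where "C = cap ch h T (K i1)"
  define old where "old = (\<lambda>j. vacant s i (2 * j - 1) + vacant s i (2 * j))"
  have Ki: "K i = 2 * K i1" using K_pred[of i1] i1 by (simp add: i1_def)
  have len: "length (bpts s i j) \<le> bsize s i j" if "j \<in> {1..K i}" for j
    using pl(1) i that unfolding placed_def by auto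
  have sumb: "(\<Sum>j=1..K i. bsize s i j) = sub_len n i" using ok[of i] i by (simp add: buckets_ok_def)
  have "(\<Sum>j=1..K i. vacant s i j) + N = (\<Sum>j=1..K i. vacant s i j + length (bpts s i j))"
    by (simp add: N_def sum.distrib)
  also have "\<dots> = (\<Sum>j=1..K i. bsize s i j)"
    using len by (intro sum.cong) (auto simp: vacant_def)
  finally have vN: "(\<Sum>j=1..K i. vacant s i j) + N = sub_len n i" using sumb by simp
  \<comment> \<open>The new bins share out the new subarray together with all cells still free in
    the current one.\<close>
  have T: "T = sub_len n i1 + (\<Sum>j=1..K i. vacant s i j)" unfolding T_def using vN by simp
  have sumold: "(\<Sum>j=1..K i1. old j) = (\<Sum>j=1..K i. vacant s i j)"
    unfolding old_def Ki by (rule sum_pairs)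
  have vle: "real (vacant s i j) \<le> \<Lambda> / 10" if "j \<in> {1..K i}" for j
    by (rule overflow_full(2)[OF g t ov that])
  have oldle: "real (old j) \<le> \<Lambda> / 5" if "j \<in> {1..K i1}" for j
  proof -
    have "2 * j - 1 \<in> {1..K i}" "2 * j \<in> {1..K i}" using that by (auto simp: Ki)
    then show ?thesis using vle[of "2 * j - 1"] vle[of "2 * j"] by (simp add: old_def)
  qed
  have Kp: "real (K i1) > 0" using K_pos by simp
  define Q' where "Q' = T div K i1"
  have "real (K i1) * (\<Lambda> - 1) \<le> real T"
  proof -
    have "sub_len n i1 \<le> T" by (simp add: T)
    then show ?thesis using sub_len_lower[OF i1] of_nat_mono[of "sub_len n i1" T] by (metis order_trans)
  qed
  moreover have "real T < real (K i1) * (real Q' + 1)"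
  proof -
    have "T < K i1 * (Q' + 1)"
      unfolding Q'_def using dividend_less_times_div[OF K_pos, of T i1] by (simp add: algebra_simps)
    then have "real T < real (K i1 * (Q' + 1))" by (simp only: of_nat_less_iff)
    then show ?thesis by (simp add: algebra_simps)
  qed
  ultimately have "real (K i1) * (\<Lambda> - 1) < real (K i1) * (real Q' + 1)" by linarith
  then have Q1: "\<Lambda> - 2 \<le> real Q'" using Kp by simp
  have "real (\<Sum>j=1..K i1. old j) \<le> (\<Sum>j=1..K i1. \<Lambda> / 5)"
    unfolding of_nat_sum using oldle by (intro sum_mono) auto
  then have so: "real (\<Sum>j=1..K i1. old j) \<le> real (K i1) * (\<Lambda> / 5)"
    by (simp only: sum_constant card_atLeastAtMost) simp
  have "real T = real (sub_len n i1) + real (\<Sum>j=1..K i1. old j)"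
    unfolding T sumold by (rule of_nat_add)
  then have "real T \<le> 2 * \<Lambda> * real (K i1) + real (K i1) * (\<Lambda> / 5)"
    using sub_len_upper[OF i1] so by linarith
  moreover have "real (K i1) * real Q' \<le> real T"
  proof -
    have "K i1 * Q' \<le> T" unfolding Q'_def by simp
    then show ?thesis by (simp only: of_nat_le_iff flip: of_nat_mult)
  qed
  ultimately have "real (K i1) * real Q' \<le> real (K i1) * (2 * \<Lambda> + \<Lambda> / 5)" by (simp add: algebra_simps)
  then have Q2: "real Q' \<le> 2 * \<Lambda> + \<Lambda> / 5" using Kp by simp
  have C: "C j \<in> {Q', Q' + 1}" if "j \<in> {1..K i1}" for j
    unfolding C_def Q'_def by (rule cap_range[OF K_pos that])
  have oldC: "old j < C j" if "j \<in> {1..K i1}" for j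
  proof -
    have "real (old j) < real Q'" using oldle[OF that] Q1 Lambda_large by linarith
    then show ?thesis using C[OF that] by auto
  qed
  define g' where "g' = (\<lambda>j. C j - old j)"
  define s' where "s' = s\<lparr> phase := i1, bsize := (bsize s)(i1 := g') \<rparr>"
  have np: "next_phase n ch h s = s'"
    unfolding next_phase_def using oldC[THEN less_imp_le] ik ph
    by (simp add: Let_def s'_def g'_def old_def C_def T_def N_def i1_def)
  have "(\<Sum>j=1..K i1. g' j) + (\<Sum>j=1..K i1. old j) = (\<Sum>j=1..K i1. C j)"
    unfolding g'_def sum.distrib[symmetric] using oldC by (intro sum.cong) (auto simp: less_imp_le)
  then have sumg: "(\<Sum>j=1..K i1. g' j) = sub_len n i1"
    unfolding C_def cap_sum[OF K_pos] using T sumold by simp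
  have e1: "bpts s i1 j = []" for j using em[of i1] by (simp add: i1_def)
  have pl': "placed s'" "exact s'"
    unfolding s'_def using set_sizes_placed[OF pl, of i1 g' i1] i1 sumg e1
    by (auto simp: slen_def)
  have ok': "buckets_ok i' s'" if "i' \<in> {1..i1}" for i'
  proof (cases "i' = i1")
    case True
    have "1 \<le> g' j \<and> real (g' j) \<le> 4 * \<Lambda>" if "j \<in> {1..K i1}" for j
    proof -
      have "g' j \<le> Q' + 1" using C[OF that] by (auto simp: g'_def)
      then have "real (g' j) \<le> real Q' + 1" by linarith
      then show ?thesis using oldC[OF that] Q2 Lambda_large by (auto simp: g'_def)
    qed
    then show ?thesis using sumg e1 by (auto simp: buckets_ok_def True s'_def)
  next
    case False
    then show ?thesis using ok[of i'] that by (auto simp: buckets_ok_def s'_def i1_def)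
  qed
  have v': "vacant s' i' j = (if i' = i1 then g' j else vacant s i' j)" for i' j
    using e1 by (simp add: vacant_def s'_def)
  have "bins i1 t (vacant s i) Q' t s'"
    unfolding bins_def
  proof (intro conjI ballI)
    show "\<Lambda> - 2 \<le> real Q'" "real Q' \<le> 3 * \<Lambda>" using Q1 Q2 Lambda_large by auto
  next
    fix j assume j: "j \<in> {1..K i1}"
    have "vacant s i (2 * j - 1) + vacant s i (2 * j) + bsize s' i1 j = C j"
      using oldC[OF j] by (simp add: s'_def g'_def old_def)
    then show "vacant s i (2 * j - 1) + vacant s i (2 * j) + bsize s' i1 j \<in> {Q', Q' + 1}"
      using C[OF j] by simp
    show "vacant s' (i1 - 1) (2 * j - 1) + vacant s' (i1 - 1) (2 * j) + vacant s' i1 j + cnt i1 j t t =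
        vacant s i (2 * j - 1) + vacant s i (2 * j) + bsize s' i1 j"
      unfolding v' by (simp add: i1_def) (simp add: s'_def i1_def)
  qed (use vle i in \<open>auto simp: v' i1_def\<close>)
  moreover have "vacant s' i' j = 0" if "i' \<in> {1..<i1 - 1}" "j \<in> {1..K i'}" for i' j
  proof (cases "i' = i - 1")
    case True
    then show ?thesis using overflow_full(1)[OF g t ov, of j] that i by (simp add: v' i1_def)
  next
    case False
    then show ?thesis using full[of i' j] that by (auto simp: v' i1_def)
  qed
  ultimately have "good i1 t (vacant s i) Q' t s'"
    unfolding good_def using i1 ph pl' ok' cd em by (auto simp: s'_def i1_def)
  then show "\<exists>u Q. good (Suc i) t u Q t (next_phase n ch h s)" unfolding np i1_def by blast
  have "bucket_of ch i1 (X t) \<in> {1..K i1}" by (rule bucket_of_range[OF in_cube[OF t] i1])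
  then have "0 < vacant s' i1 (bucket_of ch i1 (X t))" using oldC by (auto simp: v' g'_def)
  then show "\<not> overflows n ch (X t) (next_phase n ch h s)"
    unfolding np overflows_def by (auto simp: s'_def vacant_def)
qed

lemma dom_below_n: "placed s \<Longrightarrow> dom (cells s) \<subseteq> {..<n}"
  by (simp add: placed_def)

lemma final_next_phase:
  assumes g: "good k \<tau> u Q t s" and t: "t < n" and ov: "overflows n ch (X t) s"
  shows "final t (next_phase n ch h s)"
proof -
  have ph: "phase s = k" "\<not> stuck s"
    and pl: "placed s" "exact s" and cd: "card (dom (cells s)) = t"
    and ok: "\<And>i'. i' \<in> {1..k} \<Longrightarrow> buckets_ok i' s"
    and em: "\<And>i' j. i' > k \<Longrightarrow> bpts s i' j = []"
    and full: "\<And>i' j. i' \<in> {1..<k - 1} \<Longrightarrow> j \<in> {1..K i'} \<Longrightarrow> vacant s i' j = 0"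
    using g unfolding good_def by blast+
  define g' where "g' = (\<lambda>_::nat. 0::nat)(1 := unallocated n k)"
  define s' where "s' = s\<lparr> phase := k + 1, bsize := (bsize s)(k + 1 := g') \<rparr>"
  have np: "next_phase n ch h s = s'"
    unfolding next_phase_def using ph by (simp add: Let_def s'_def g'_def)
  have pl': "placed s'" "exact s'"
    unfolding s'_def using set_sizes_placed[OF pl, of "k + 1" g' "k + 1"] em
    by (auto simp: slen_def nb_def g'_def)
  have ok': "buckets_ok i s'" if "i \<in> {1..<k}" for i
    using ok[of i] that by (auto simp: buckets_ok_def s'_def)
  have v': "vacant s' i j = vacant s i j" if "i \<le> k" for i j
    using that by (simp add: vacant_def s'_def)
  have "vacant s' i j = 0" if "i \<in> {1..<k}" "j \<in> {1..K i}" for i j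
  proof (cases "i = k - 1")
    case True
    then show ?thesis using overflow_full(1)[OF g t ov, of j] that by (simp add: v')
  next
    case False
    then show ?thesis using full[of i j] that by (auto simp: v')
  qed
  then show ?thesis
    unfolding final_def np using pl' ok' cd ph by (auto simp: s'_def)
qed

lemma final_place:
  assumes f: "final t s" and t: "t < n"
  shows "final (Suc t) (if vacant s (k + 1) 1 > 0 then put_bucket n \<B> (k + 1) 1 (X t) s
    else put_spare ch h (X t) s)"
proof -
  have ph: "phase s = k + 1" "\<not> stuck s" and pl: "placed s" and ex: "exact s \<or> vacant s (k + 1) 1 = 0"
    and cd: "card (dom (cells s)) = t"
    and ok: "\<And>i. i \<in> {1..<k} \<Longrightarrow> buckets_ok i s \<and> (\<forall>j\<in>{1..K i}. vacant s i j = 0)"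
    using f by (auto simp: final_def)
  show ?thesis
  proof (cases "vacant s (k + 1) 1 > 0")
    case True
    then have "exact s" using ex by simp
    note pp = put_bucket_placed[OF pl this _ _ True in_cube[OF t]]
    have "buckets_ok i (put_bucket n \<B> (k + 1) 1 (X t) s)" if "i \<in> {1..<k}" for i
      using ok[OF that] that by (auto simp: buckets_ok_def)
    then show ?thesis
      unfolding final_def using pp ph cd ok True by (auto simp: nb_def vacant_put_bucket)
  next
    case False
    define c where "c = spare ch h (dom (cells s))"
    define s' where "s' = put_spare ch h (X t) s"
    have "dom (cells s) \<subset> {..<n}" using dom_below_n[OF pl] cd t by auto
    then have c: "c < n" "c \<notin> dom (cells s)" using spare_range[of "dom (cells s)" h] by (auto simp: c_def)
    have s': "phase s' = phase s" "stuck s' = stuck s" "bsize s' = bsize s" "bpts s' = bpts s"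
      "cells s' = (cells s)(c \<mapsto> X t)"
      by (simp_all add: s'_def put_spare_def c_def)
    have pos': "pos s' = pos s" by (simp add: pos_def fun_eq_iff s' bucket_start_def)
    have cl: "cells s' (pos s i j r) = Some (bpts s i j ! r)"
      if "cells s (pos s i j r) = Some (bpts s i j ! r)" for i j r
      using that c by (auto simp: s')
    have "placed s'"
      using pl c in_cube[OF t] cl unfolding placed_def pos' s'(3,4)
      by (auto simp: s' ran_def split: if_splits)
    moreover have "card (dom (cells s')) = Suc t"
      using cd c finite_subset[OF dom_below_n[OF pl]] by (simp add: s')
    moreover have "vacant s' i j = vacant s i j" for i j by (simp add: vacant_def s')
    moreover have "buckets_ok i s'" if "i \<in> {1..<k}" for i
      using ok[OF that] by (simp add: buckets_ok_def s')
    ultimately have "final (Suc t) s'"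
      unfolding final_def using ph ok False by (auto simp: s')
    then show ?thesis using False by (simp add: s'_def)
  qed
qed

text \<open>An arrival causes at most one change of phase, since the new bucket for it is nonempty;
  so unfolding the loop twice suffices.\<close>

lemma good_alg_step:
  assumes g: "good i \<tau> u Q t s" and t: "t < n"
  shows "(\<exists>i \<tau> u Q. good i \<tau> u Q (Suc t) (alg_step n \<B> ch h (X t) s)) \<or> final (Suc t) (alg_step n \<B> ch h (X t) s)"
proof -
  have settled: "alg_step n \<B> ch h (X t) s = settle i' (X t) s'"
    if "while (overflows n ch (X t)) (next_phase n ch h) s = s'" "good i' \<tau>' u' Q' t s'" for s' i' \<tau>' u' Q'
    using that unfolding alg_step_def settle_def good_def by (auto simp: Let_def)
  consider "\<not> overflows n ch (X t) s" | "overflows n ch (X t) s" "i < k" | "overflows n ch (X t) s" "i = k"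
    using g unfolding good_def by force
  then show ?thesis
  proof cases
    case 1
    then have "while (overflows n ch (X t)) (next_phase n ch h) s = s" by (subst while_unfold) simp
    then show ?thesis using settled g good_settle[OF g t 1] by metis
  next
    case 2
    let ?s = "next_phase n ch h s"
    obtain u' Q' where g': "good (Suc i) t u' Q' t ?s" using good_next_phase(1)[OF g t 2] by blast
    have no: "\<not> overflows n ch (X t) ?s" by (rule good_next_phase(2)[OF g t 2])
    have "while (overflows n ch (X t)) (next_phase n ch h) s = ?s"
      using 2 no by (subst while_unfold, subst while_unfold) simp
    then show ?thesis using settled g' good_settle[OF g' t no] by metis
  next
    case 3
    let ?s = "next_phase n ch h s"
    have f: "final t ?s" using final_next_phase[OF g[unfolded 3(2)] t 3(1)] .
    then have ph: "phase ?s = k + 1" "\<not> stuck ?s" by (auto simp: final_def)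
    then have no: "\<not> overflows n ch (X t) ?s" by (simp add: overflows_def)
    have w: "while (overflows n ch (X t)) (next_phase n ch h) s = ?s"
      using 3 no by (subst while_unfold, subst while_unfold) simp
    have "alg_step n \<B> ch h (X t) s = (if vacant ?s (k + 1) 1 > 0 then put_bucket n \<B> (k + 1) 1 (X t) ?s
      else put_spare ch h (X t) ?s)"
      unfolding alg_step_def w using ph by (simp add: Let_def)
    then have "final (Suc t) (alg_step n \<B> ch h (X t) s)" using final_place[OF f t, of h] by (simp only:)
    then show ?thesis ..
  qed
qed

lemma final_alg_step:
  assumes f: "final t s" and t: "t < n"
  shows "final (Suc t) (alg_step n \<B> ch h (X t) s)"
proof -
  have ph: "phase s = k + 1" "\<not> stuck s" using f by (auto simp: final_def)
  then have "\<not> overflows n ch (X t) s" by (simp add: overflows_def)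
  then have w: "while (overflows n ch (X t)) (next_phase n ch h) s = s" by (subst while_unfold) simp
  have "alg_step n \<B> ch h (X t) s = (if vacant s (k + 1) 1 > 0 then put_bucket n \<B> (k + 1) 1 (X t) s
      else put_spare ch h (X t) s)"
    unfolding alg_step_def w using ph by (simp add: Let_def)
  then show ?thesis using final_place[OF f t] by metis
qed

text \<open>Phase 1 fits the general pattern when it is preceded by a fictitious subarray 0 without
  free cells: \<open>u\<close> is constantly 0 and \<tau> = 0.\<close>

lemma good_init: "good 1 0 (\<lambda>_. 0) (sub_len n 1 div K 1) 0 (init_state n ch)"
proof -
  define s where "s = init_state n ch"
  define C where "C = cap ch [] (sub_len n 1) (K 1)"
  define Q where "Q = sub_len n 1 div K 1"
  have s: "phase s = 1" "stuck s = False" "bsize s = (\<lambda>_ _. 0)(1 := C)" "bpts s = (\<lambda>_ _. [])" "cells s = (\<lambda>_. None)"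
    by (simp_all add: s_def init_state_def C_def)
  have k1: "1 \<le> k" by (rule last_sub_bounds(1))
  have C: "C j \<in> {Q, Q + 1}" if "j \<in> {1..K 1}" for j
    unfolding C_def Q_def by (rule cap_range[OF K_pos that])
  have Cs: "(\<Sum>j=1..K 1. C j) = sub_len n 1" unfolding C_def by (rule cap_sum[OF K_pos])
  have Kp: "real (K 1) > 0" using K_pos by simp
  have "real (K 1) * (\<Lambda> - 1) \<le> real (sub_len n 1)" by (rule sub_len_lower) (use k1 in auto)
  moreover have "real (sub_len n 1) < real (K 1) * (real Q + 1)"
  proof -
    have "sub_len n 1 < K 1 * (Q + 1)"
      unfolding Q_def using dividend_less_times_div[OF K_pos, of "sub_len n 1" 1] by (simp add: algebra_simps)
    then have "real (sub_len n 1) < real (K 1 * (Q + 1))" by (simp only: of_nat_less_iff)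
    then show ?thesis by (simp add: algebra_simps)
  qed
  ultimately have "real (K 1) * (\<Lambda> - 1) < real (K 1) * (real Q + 1)" by linarith
  then have Q1: "\<Lambda> - 2 \<le> real Q" using Kp by simp
  have "real (sub_len n 1) \<le> 2 * \<Lambda> * real (K 1)" by (rule sub_len_upper) (use k1 in auto)
  moreover have "real (K 1) * real Q \<le> real (sub_len n 1)"
  proof -
    have "K 1 * Q \<le> sub_len n 1" unfolding Q_def by simp
    then show ?thesis by (simp only: of_nat_le_iff flip: of_nat_mult)
  qed
  ultimately have "real (K 1) * real Q \<le> real (K 1) * (2 * \<Lambda>)" by (simp add: algebra_simps)
  then have Q2: "real Q \<le> 2 * \<Lambda>" using Kp by simp
  have "placed s"
    unfolding placed_def s using Cs k1 by (auto simp: slen_def)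
  moreover have "exact s" unfolding exact_def s by simp
  moreover have "buckets_ok 1 s"
  proof -
    have "1 \<le> C j \<and> real (C j) \<le> 4 * \<Lambda>" if "j \<in> {1..K 1}" for j
      using C[OF that] Q1 Q2 Lambda_large by auto
    then show ?thesis using Cs by (simp add: buckets_ok_def s)
  qed
  moreover have "bins 1 0 (\<lambda>_. 0) Q 0 s"
    unfolding bins_def vacant_def s using C Q1 Q2 Lambda_large by auto
  ultimately show ?thesis
    unfolding good_def s_def[symmetric] Q_def[symmetric] using k1 by (auto simp: s)
qed

lemma run_invariant:
  "t \<le> n \<Longrightarrow> (\<exists>i \<tau> u Q. good i \<tau> u Q t (alg_run n \<B> ch X t)) \<or> final t (alg_run n \<B> ch X t)"
proof (induction t)
  case 0
  then show ?case using good_init by auto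
next
  case (Suc t)
  then show ?case using good_alg_step final_alg_step unfolding alg_run.simps
    by (metis Suc_le_eq Suc_leD)
qed

text \<open>As long as the run is in a phase up to \<open>k\<close>, all points lie in the subarrays
  up to \<open>A\<^sub>k\<close>, which together have fewer than n cells.\<close>

lemma not_good_at_end: "\<not> good i \<tau> u Q n s"
proof
  assume g: "good i \<tau> u Q n s"
  have i: "i \<le> k" and pl: "placed s" and ex: "exact s" and cd: "card (dom (cells s)) = n"
    and em: "\<And>i' j. i' > i \<Longrightarrow> bpts s i' j = []"
    using g unfolding good_def by blast+
  have sz: "\<And>i. i \<in> {1..k+1} \<Longrightarrow> (\<Sum>j=1..nb i. bsize s i j) \<le> slen i"
    and pb: "\<And>i j. i \<in> {1..k+1} \<Longrightarrow> j \<in> {1..nb i} \<Longrightarrow> length (bpts s i j) \<le> bsize s i j \<and> set (bpts s i j) \<subseteq> unit_cube"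
    using pl unfolding placed_def by blast+
  have "dom (cells s) \<subseteq> {..<\<Sum>i=1..k. sub_len n i}"
  proof
    fix c assume "c \<in> dom (cells s)"
    then obtain i' j r where *: "i' \<in> {1..k+1}" "j \<in> {1..nb i'}" "r < length (bpts s i' j)" "c = pos s i' j r"
      using ex unfolding exact_def by blast
    have "i' \<le> i" using em[of i' j] *(3) by (cases "i < i'") auto
    then have i'k: "i' < k + 1" using i by simp
    have "\<B> (bsize s i' j) (take (Suc r) (bpts s i' j)) < bsize s i' j"
      using placement_range pb[OF *(1,2)] *(3) by blast
    then have "c < bucket_start n s i' j + bsize s i' j" by (simp add: * pos_def)
    also have "\<dots> \<le> (\<Sum>i'=1..<i'. sub_len n i') + slen i'" by (rule bucket_end_le[OF sz[OF *(1)] *(2)])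
    also have "\<dots> \<le> (\<Sum>i'=1..<k+1. sub_len n i')" by (rule sub_start_mono) (use * i'k in auto)
    finally show "c \<in> {..<\<Sum>i=1..k. sub_len n i}" by (simp add: atLeastLessThanSuc_atLeastAtMost)
  qed
  then have "n \<le> (\<Sum>i=1..k. sub_len n i)" using card_mono[of "{..<\<Sum>i=1..k. sub_len n i}"] cd by fastforce
  then show False using sub_len_sum by simp
qed

section \<open>The array after all arrivals\<close>

lemma run_final: "final n (alg_run n \<B> ch X n)"
  using run_invariant[of n] not_good_at_end by blast

lemma final_cell_in_cube:
  assumes "c < n"
  shows "the (cells (alg_run n \<B> ch X n) c) \<in> unit_cube"
proof -
  let ?s = "alg_run n \<B> ch X n"
  have pl: "placed ?s" and cd: "card (dom (cells ?s)) = n" using run_final by (auto simp: final_def)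
  have "dom (cells ?s) = {..<n}"
    using dom_below_n[OF pl] cd by (intro card_subset_eq) auto
  then obtain x where "cells ?s c = Some x" using assms by (metis domD lessThan_iff)
  moreover have "ran (cells ?s) \<subseteq> unit_cube" using pl by (simp add: placed_def)
  ultimately show ?thesis by (auto simp: ran_def)
qed

text \<open>In a full bucket the injective placement map is a bijection onto the cells, so the
  inverse in \<open>final_array\<close> is genuine and competitiveness of \<open>\<B>\<close>
  applies.\<close>

lemma final_bucket:
  assumes i: "i \<in> {1..<k}" and j: "j \<in> {1..K i}"
  defines "s \<equiv> alg_run n \<B> ch X n"
  shows "length (bpts s i j) = bsize s i j" "set (bpts s i j) \<subseteq> unit_cube"
    and "\<And>x. x \<in> set (bpts s i j) \<Longrightarrow> bucket_of ch i x = j"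
    and "1 \<le> bsize s i j" "real (bsize s i j) \<le> 4 * \<Lambda>"
    and "\<And>c. c < bsize s i j \<Longrightarrow>
      the (cells s (bucket_start n s i j + c)) = final_array \<B> (bsize s i j) (bpts s i j) c"
    and "\<And>c. c < bsize s i j \<Longrightarrow> the (cells s (bucket_start n s i j + c)) \<in> set (bpts s i j)"
proof -
  have pl: "placed s" and ok: "buckets_ok i s" and v: "vacant s i j = 0"
    using run_final i j by (auto simp: final_def s_def)
  have ij: "i \<in> {1..k+1}" "j \<in> {1..nb i}" using i j by auto
  have pb: "length (bpts s i j) \<le> bsize s i j" "set (bpts s i j) \<subseteq> unit_cube"
      "\<And>r. r < length (bpts s i j) \<Longrightarrow> cells s (pos s i j r) = Some (bpts s i j ! r)"
    using pl ij unfolding placed_def by blast+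
  show len: "length (bpts s i j) = bsize s i j" using pb(1) v by (simp add: vacant_def)
  show "set (bpts s i j) \<subseteq> unit_cube" by (rule pb(2))
  show "\<And>x. x \<in> set (bpts s i j) \<Longrightarrow> bucket_of ch i x = j" "1 \<le> bsize s i j" "real (bsize s i j) \<le> 4 * \<Lambda>"
    using ok j unfolding buckets_ok_def by blast+
  define m where "m = bsize s i j"
  define ps where "ps = bpts s i j"
  define f where "f = (\<lambda>r. \<B> m (take (Suc r) ps))"
  have inj: "inj_on f {..<m}"
    using placement_inj[OF pb(1,2)] len by (simp add: f_def m_def ps_def)
  have into: "f ` {..<m} \<subseteq> {..<m}"
    using placement_range[OF pb(1,2)] len by (auto simp: f_def m_def ps_def)
  have surj: "f ` {..<m} = {..<m}" by (rule card_subset_eq) (use inj into in \<open>auto simp: card_image\<close>)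
  {
    fix c assume c: "c < bsize s i j"
    define r where "r = inv_into {..<m} f c"
    have r: "r < m" "f r = c" using c surj unfolding r_def m_def[symmetric]
      by (metis inv_into_into lessThan_iff, metis f_inv_into_f lessThan_iff)
    have "cells s (bucket_start n s i j + c) = Some (ps ! r)"
      using pb(3)[of r] r len by (simp add: pos_def f_def m_def ps_def)
    moreover have "final_array \<B> m ps c = ps ! r" by (simp add: final_array_def r_def f_def)
    ultimately have "the (cells s (bucket_start n s i j + c)) = final_array \<B> m ps c"
      "the (cells s (bucket_start n s i j + c)) \<in> set ps"
      using r len by (auto simp: ps_def m_def)
  }
  then show "\<And>c. c < bsize s i j \<Longrightarrow>
      the (cells s (bucket_start n s i j + c)) = final_array \<B> (bsize s i j) (bpts s i j) c"
    and "\<And>c. c < bsize s i j \<Longrightarrow> the (cells s (bucket_start n s i j + c)) \<in> set (bpts s i j)"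
    by (auto simp: m_def ps_def)
qed

lemma final_sizes: "i \<in> {1..<k} \<Longrightarrow> (\<Sum>j=1..K i. bsize (alg_run n \<B> ch X n) i j) = sub_len n i"
  using run_final by (simp add: final_def buckets_ok_def)

section \<open>The cost on a concentrated input\<close>

text \<open>Used with p = 0 inside a bucket and with p = 1 across the border of neighbouring
  buckets.\<close>

lemma bucket_of_dist:
  assumes "1 \<le> i" "1 \<le> assign ch x" "1 \<le> assign ch y"
    and "bucket_of ch i y \<le> bucket_of ch i x + p" "bucket_of ch i x \<le> bucket_of ch i y + p"
  shows "\<bar>real (assign ch x) - real (assign ch y)\<bar> \<le> real (p + 1) * 2 ^ (i - 1)"
proof -
  define P where "P = (2::nat) ^ (i - 1)"
  have P: "P > 0" by (simp add: P_def)
  have *: "assign ch z - 1 < P * bucket_of ch i z" "P * (bucket_of ch i z - 1) \<le> assign ch z - 1" for z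
    using P dividend_less_times_div[OF P, of "assign ch z - 1"] unfolding bucket_of_def P_def[symmetric]
    by (auto simp: algebra_simps)
  have "assign ch y \<le> assign ch x + P * (p + 1)" if "bucket_of ch i y \<le> bucket_of ch i x + p"
    "1 \<le> assign ch x" "1 \<le> assign ch y" for x y
  proof -
    have "assign ch y - 1 < P * bucket_of ch i y" by (rule *)
    also have "\<dots> \<le> P * ((bucket_of ch i x - 1) + (p + 1))" using that by (intro mult_left_mono) auto
    also have "\<dots> \<le> assign ch x - 1 + P * (p + 1)" using *(2)[of x] unfolding add_mult_distrib2 by simp
    finally show ?thesis using that by simp
  qed
  from this[of y x] this[of x y] assms have
    "assign ch y \<le> assign ch x + P * (p + 1)" "assign ch x \<le> assign ch y + P * (p + 1)" by auto
  then have "real (assign ch y) \<le> real (assign ch x + P * (p + 1))" "real (assign ch x) \<le> real (assign ch y + P * (p + 1))"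
    by (simp_all only: of_nat_le_iff)
  then show ?thesis unfolding abs_le_iff by (simp add: P_def algebra_simps)
qed

text \<open>Edges inside buckets are paid by competitiveness, those between neighbouring buckets by
  adjacency of the regions, those between subarrays and in the last cells by the diameter bound
  \<open>CARD('d)\<close>. As \<open>K i * 2 ^ (i - 1)\<close> is the total number of blocks, the
  terms proportional to region size are the same in each subarray, hence the factor
  \<open>k\<close>; the term with \<open>f\<close> decreases geometrically with
  \<open>K i\<close>.\<close>

lemma alg_cost_le:
  assumes \<Delta>: "\<Delta> \<ge> 0" and f: "f \<ge> 0" and c0: "c\<^sub>0 \<ge> 0"
    and dist: "\<And>x y. x \<in> unit_cube \<Longrightarrow> y \<in> unit_cube \<Longrightarrow>
      norm (x - y) \<le> (\<bar>real (assign ch x) - real (assign ch y)\<bar> + 1) * \<Delta>"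
    and opt: "\<And>i j ps. 1 \<le> i \<Longrightarrow> i \<le> k \<Longrightarrow> set ps \<subseteq> unit_cube \<Longrightarrow> (\<And>x. x \<in> set ps \<Longrightarrow> bucket_of ch i x = j) \<Longrightarrow>
      opt_tour ps \<le> (4 * 2 ^ (i - 1) + f * real (length ps)) * \<Delta>"
    and comp: "\<And>m ps. length ps = m \<Longrightarrow> set ps \<subseteq> unit_cube \<Longrightarrow>
      array_cost m (final_array \<B> m ps) \<le> c\<^sub>0 * sqrt (real m) * opt_tour ps"
    and rest: "real (n - (\<Sum>i=1..<k. sub_len n i)) \<le> 200 * \<Lambda>"
  shows "alg_cost n \<B> ch X \<le> 2 * c\<^sub>0 * sqrt \<Lambda> * \<Delta> * 2 ^ split_count n * (4 * real k + 8 * f * \<Lambda>)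
    + 4 * real k * 2 ^ split_count n * \<Delta> + real CARD('d) * real k + 200 * \<Lambda> * real CARD('d)"
proof -
  define s where "s = alg_run n \<B> ch X n"
  define F where "F = (\<lambda>c. the (cells s c))"
  \<comment> \<open>Each edge is charged to its left cell and the last cell gets 0, so sums over
    cells split along subarrays and buckets.\<close>
  define h where "h = (\<lambda>c. if Suc c < n then norm (F (Suc c) - F c) else 0)"
  define d where "d = real CARD('d)"
  have Fc: "F c \<in> unit_cube" if "c < n" for c
    using final_cell_in_cube[OF that] by (simp add: F_def s_def)
  have hd: "h c \<le> d" for c
    using unit_cube_dist[OF Fc Fc, of "Suc c" c] by (auto simp: h_def d_def)
  have "alg_cost n \<B> ch X = (\<Sum>c<n - 1. norm (F (Suc c) - F c))"
    by (simp add: alg_cost_def array_cost_def F_def s_def)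
  also have "\<dots> = (\<Sum>c<n - 1. h c)" by (intro sum.cong) (auto simp: h_def)
  also have "\<dots> = (\<Sum>c<n. h c)" by (rule sum.mono_neutral_left) (auto simp: h_def)
  finally have cost: "alg_cost n \<B> ch X = (\<Sum>c\<in>{0..<n}. h c)" by (simp add: lessThan_atLeast0)
  define S where "S = (\<Sum>i=1..<k. sub_len n i)"
  have "S \<le> (\<Sum>i=1..k. sub_len n i)" unfolding S_def by (intro sum_mono2) auto
  then have Sn: "S \<le> n" using sub_len_sum by simp
  have "(\<Sum>c\<in>{0..<n}. h c) = (\<Sum>c\<in>{0..<S}. h c) + (\<Sum>c\<in>{S..<n}. h c)"
    using Sn by (simp add: sum.atLeastLessThan_concat)
  moreover have "(\<Sum>c\<in>{S..<n}. h c) \<le> 200 * \<Lambda> * d"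
  proof -
    have "(\<Sum>c\<in>{S..<n}. h c) \<le> (\<Sum>c\<in>{S..<n}. d)" using hd by (intro sum_mono) auto
    also have "\<dots> = real (n - S) * d" by simp
    also have "\<dots> \<le> 200 * \<Lambda> * d" using rest by (intro mult_right_mono) (auto simp: S_def d_def)
    finally show ?thesis .
  qed
  ultimately have cost1: "alg_cost n \<B> ch X \<le> (\<Sum>c\<in>{0..<S}. h c) + 200 * \<Lambda> * d" using cost by linarith
  have S1: "S = (\<Sum>i=1..k - 1. sub_len n i)"
    unfolding S_def by (rule sum.cong) (use last_sub_bounds in auto)
  define st where "st = (\<lambda>i. \<Sum>i'=1..<i. sub_len n i')"
  have sumS: "(\<Sum>c\<in>{0..<S}. h c) = (\<Sum>i=1..k - 1. \<Sum>c\<in>{st i..<st i + sub_len n i}. h c)"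
    unfolding S1 st_def using sum_consecutive_blocks[of h 0 "sub_len n" "k - 1"] by simp
  \<comment> \<open>A bucket has at most 4 \<Lambda> cells, so \<open>\<B>\<close> loses at most the
    factor \<open>2 * c\<^sub>0 * sqrt \<Lambda>\<close> in it.\<close>
  define G where "G = 2 * c\<^sub>0 * sqrt \<Lambda> * \<Delta>"
  have G: "G \<ge> 0" using c0 \<Delta> Lambda_large by (simp add: G_def)
  \<comment> \<open>The edge leaving the last bucket goes to another subarray, hence the diameter
    term.\<close>
  have bucket: "(\<Sum>c\<in>{bucket_start n s i j..<bucket_start n s i j + bsize s i j}. h c)
      \<le> G * (4 * 2 ^ (i - 1) + 4 * f * \<Lambda>) + 4 * 2 ^ (i - 1) * \<Delta> + (if j = K i then d else 0)"
    if i: "i \<in> {1..<k}" and j: "j \<in> {1..K i}" for i j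
  proof -
    define m where "m = bsize s i j"
    define a where "a = bucket_start n s i j"
    define ps where "ps = bpts s i j"
    have fb: "length ps = m" "set ps \<subseteq> unit_cube" "\<And>x. x \<in> set ps \<Longrightarrow> bucket_of ch i x = j"
      "1 \<le> m" "real m \<le> 4 * \<Lambda>"
      "\<And>c. c < m \<Longrightarrow> F (a + c) = final_array \<B> m ps c"
      "\<And>c. c < m \<Longrightarrow> F (a + c) \<in> set ps"
      using final_bucket[OF i j] unfolding ps_def m_def a_def s_def F_def by blast+
    obtain m' where m': "m = Suc m'" using fb(4) by (cases m) auto
    have "(\<Sum>c\<in>{a..<a + m}. h c) = (\<Sum>c\<in>{0..<m}. h (a + c))"
      using sum.shift_bounds_nat_ivl[of h 0 a m] by (simp add: add.commute)
    also have "\<dots> = (\<Sum>c<m'. h (a + c)) + h (a + m')" by (simp add: m' lessThan_atLeast0)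
    finally have split: "(\<Sum>c\<in>{a..<a + m}. h c) = (\<Sum>c<m'. h (a + c)) + h (a + m')" .
    have "(\<Sum>c<m'. h (a + c)) \<le> (\<Sum>c<m'. norm (final_array \<B> m ps (Suc c) - final_array \<B> m ps c))"
    proof (rule sum_mono)
      fix c assume "c \<in> {..<m'}"
      then have "c < m" "Suc c < m" by (auto simp: m')
      then show "h (a + c) \<le> norm (final_array \<B> m ps (Suc c) - final_array \<B> m ps c)"
        using fb(6)[of c] fb(6)[of "Suc c"] by (auto simp: h_def)
    qed
    also have "\<dots> = array_cost m (final_array \<B> m ps)" by (simp add: array_cost_def m')
    also have "\<dots> \<le> c\<^sub>0 * sqrt (real m) * opt_tour ps" by (rule comp[OF fb(1,2)])
    also have "\<dots> \<le> c\<^sub>0 * (2 * sqrt \<Lambda>) * ((4 * 2 ^ (i - 1) + f * (4 * \<Lambda>)) * \<Delta>)"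
    proof (intro mult_mono mult_left_mono)
      have "sqrt (real m) \<le> sqrt (4 * \<Lambda>)" using fb(5) by simp
      then show "sqrt (real m) \<le> 2 * sqrt \<Lambda>" by (simp add: real_sqrt_mult)
      have "opt_tour ps \<le> (4 * 2 ^ (i - 1) + f * real (length ps)) * \<Delta>"
        by (rule opt[of i ps j]) (use i fb in auto)
      also have "\<dots> \<le> (4 * 2 ^ (i - 1) + f * (4 * \<Lambda>)) * \<Delta>"
        using fb(1,5) f \<Delta> by (intro mult_right_mono add_left_mono mult_left_mono) auto
      finally show "opt_tour ps \<le> (4 * 2 ^ (i - 1) + f * (4 * \<Lambda>)) * \<Delta>" .
    qed (use c0 opt_tour_nonneg Lambda_large in auto)
    finally have 1: "(\<Sum>c<m'. h (a + c)) \<le> G * (4 * 2 ^ (i - 1) + 4 * f * \<Lambda>)"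
      by (simp add: G_def algebra_simps)
    have "h (a + m') \<le> 4 * 2 ^ (i - 1) * \<Delta> + (if j = K i then d else 0)"
    proof (cases "j = K i")
      case True
      have "0 \<le> 4 * 2 ^ (i - 1) * \<Delta>" using \<Delta> by simp
      then show ?thesis using hd[of "a + m'"] True unfolding if_P[OF True] by linarith
    next
      case False
      then have j1: "Suc j \<in> {1..K i}" using j by auto
      have start: "bucket_start n s i (Suc j) = a + m"
        using j by (simp add: bucket_start_def a_def m_def)
      \<comment> \<open>Because the next bucket is nonempty, the cell after the border belongs to
        it.\<close>
      have sz1: "1 \<le> bsize s i (Suc j)" using final_bucket(4)[OF i j1] by (simp add: s_def)
      have "F (a + m) \<in> set (bpts s i (Suc j))"
        using final_bucket(7)[OF i j1, of 0] sz1 start by (simp add: F_def s_def)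
      then have y: "F (a + m) \<in> unit_cube" "bucket_of ch i (F (a + m)) = Suc j"
        using final_bucket(2,3)[OF i j1] by (auto simp: s_def)
      have x: "F (a + m') \<in> unit_cube" "bucket_of ch i (F (a + m')) = j"
        using fb(2,3) fb(7)[of m'] by (auto simp: m')
      have as: "1 \<le> assign ch (F (a + m'))" "1 \<le> assign ch (F (a + m))"
        using assign_range x y by auto
      have "\<bar>real (assign ch (F (a + m))) - real (assign ch (F (a + m')))\<bar> \<le> real (1 + 1) * 2 ^ (i - 1)"
        by (rule bucket_of_dist) (use as x y i in auto)
      also have "real (1 + 1) * 2 ^ (i - 1) + 1 \<le> (4::real) * 2 ^ (i - 1)"
        using one_le_power[of "2::real" "i - 1"] by (simp del: one_le_power)
      finally (add_right_mono[THEN order_trans]) have "\<bar>real (assign ch (F (a + m))) - real (assign ch (F (a + m')))\<bar> + 1 \<le> 4 * 2 ^ (i - 1)" .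
      then have "(\<bar>real (assign ch (F (a + m))) - real (assign ch (F (a + m')))\<bar> + 1) * \<Delta> \<le> (4 * 2 ^ (i - 1)) * \<Delta>"
        using \<Delta> by (intro mult_right_mono)
      then have "norm (F (a + m) - F (a + m')) \<le> 4 * 2 ^ (i - 1) * \<Delta>"
        using dist[OF y(1) x(1)] by linarith
      moreover have "h (a + m') \<le> norm (F (a + m) - F (a + m'))" by (auto simp: h_def m')
      ultimately show ?thesis using False by simp
    qed
    then show ?thesis using split 1 unfolding a_def m_def by linarith
  qed
  have sub: "(\<Sum>c\<in>{st i..<st i + sub_len n i}. h c)
      \<le> G * (4 * 2 ^ split_count n + 4 * f * \<Lambda> * real (K i)) + 4 * 2 ^ split_count n * \<Delta> + d"
    if i: "i \<in> {1..k - 1}" for i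
  proof -
    have i': "i \<in> {1..<k}" using i last_sub_bounds by auto
    have KP: "real (K i) * 2 ^ (i - 1) = 2 ^ split_count n"
    proof -
      have "split_count n + 1 - i + (i - 1) = split_count n" using i last_sub_bounds by auto
      then show ?thesis by (simp add: bucket_count_def flip: power_add)
    qed
    have "(\<Sum>c\<in>{st i..<st i + sub_len n i}. h c) =
        (\<Sum>j=1..K i. \<Sum>c\<in>{bucket_start n s i j..<bucket_start n s i j + bsize s i j}. h c)"
      using sum_consecutive_blocks[of h "st i" "bsize s i" "K i"] final_sizes[OF i']
      by (simp add: s_def bucket_start_def st_def)
    also have "\<dots> \<le> (\<Sum>j=1..K i. G * (4 * 2 ^ (i - 1) + 4 * f * \<Lambda>) + 4 * 2 ^ (i - 1) * \<Delta> + (if j = K i then d else 0))"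
      by (intro sum_mono bucket[OF i'])
    also have "\<dots> = real (K i) * (G * (4 * 2 ^ (i - 1) + 4 * f * \<Lambda>) + 4 * 2 ^ (i - 1) * \<Delta>) + d"
      using K_pos[of i] by (simp add: sum.distrib sum.delta Suc_le_eq)
    also have "\<dots> = G * (4 * (real (K i) * 2 ^ (i - 1)) + 4 * f * \<Lambda> * real (K i)) + 4 * (real (K i) * 2 ^ (i - 1)) * \<Delta> + d"
      by (simp add: algebra_simps)
    finally show ?thesis unfolding KP .
  qed
  have sumK: "(\<Sum>i=1..k - 1. real (K i)) \<le> 2 * 2 ^ split_count n"
  proof -
    have "real (K i) = 2 ^ split_count n * (2 * (1 / 2) ^ i)" if "i \<in> {1..k - 1}" for i
    proof -
      have "split_count n + 1 - i + i = split_count n + 1" using that last_sub_bounds by auto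
      then have "(2::real) ^ (split_count n + 1 - i) * 2 ^ i = 2 ^ split_count n * 2"
        by (simp flip: power_add)
      then show ?thesis by (simp add: bucket_count_def power_one_over field_simps)
    qed
    then have "(\<Sum>i=1..k - 1. real (K i)) = 2 ^ split_count n * 2 * (\<Sum>i=1..k - 1. (1 / 2) ^ i)"
      by (simp add: sum_distrib_left mult.assoc)
    also have "(\<Sum>i=1..k - 1. (1 / 2 :: real) ^ i) \<le> 1"
    proof -
      have "(\<Sum>i=1..m. (1 / 2 :: real) ^ i) = 1 - (1 / 2) ^ m" for m by (induction m) auto
      then show ?thesis by simp
    qed
    finally show ?thesis by simp
  qed
  have "(\<Sum>c\<in>{0..<S}. h c) \<le> (\<Sum>i=1..k - 1. G * (4 * 2 ^ split_count n + 4 * f * \<Lambda> * real (K i)) + 4 * 2 ^ split_count n * \<Delta> + d)"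
    unfolding sumS by (intro sum_mono sub)
  also have "\<dots> = G * (4 * 2 ^ split_count n * real (k - 1) + 4 * f * \<Lambda> * (\<Sum>i=1..k - 1. real (K i)))
      + real (k - 1) * (4 * 2 ^ split_count n * \<Delta> + d)"
    by (simp add: sum.distrib sum_distrib_left algebra_simps)
  also have "\<dots> \<le> G * (4 * 2 ^ split_count n * real k + 4 * f * \<Lambda> * (2 * 2 ^ split_count n))
      + real k * (4 * 2 ^ split_count n * \<Delta> + d)"
    using sumK G f \<Delta> Lambda_large
    by (intro add_mono mult_left_mono mult_right_mono) (auto simp: d_def)
  finally show ?thesis using cost1 unfolding G_def d_def by (simp add: algebra_simps)
qed

end

section \<open>Sizes of subarrays and buckets\<close>

text \<open>Consecutive powers of two differ by the factor 2 spanned by (y/2, y]; y \<ge> 2 rules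
  out the exponent 0. Here y will be n / (2 log^2 n).\<close>

lemma power2_between:
  assumes "(2::real) \<le> y"
  shows "\<exists>!l::nat. 0 < l \<and> y / 2 < 2 ^ l \<and> 2 ^ l \<le> y"
proof -
  have "1 \<le> nat \<lfloor>y\<rfloor>" using assms by linarith
  then obtain l where l: "2 ^ l \<le> nat \<lfloor>y\<rfloor>" "nat \<lfloor>y\<rfloor> < 2 ^ (l + 1)"
    using ex_power_ivl1[of 2 "nat \<lfloor>y\<rfloor>"] by auto
  have 1: "2 ^ l \<le> y"
  proof -
    have "real (2 ^ l) \<le> real (nat \<lfloor>y\<rfloor>)" using l(1) by (simp only: of_nat_le_iff)
    also have "\<dots> \<le> y" using assms by (simp add: of_nat_floor)
    finally show ?thesis by simp
  qed
  have 2: "y < 2 ^ (l + 1)"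
  proof -
    have "nat \<lfloor>y\<rfloor> + 1 \<le> 2 ^ (l + 1)" using l(2) by simp
    then have "real (nat \<lfloor>y\<rfloor> + 1) \<le> real (2 ^ (l + 1))" by (simp only: of_nat_le_iff)
    then have "real (nat \<lfloor>y\<rfloor>) + 1 \<le> 2 ^ (l + 1)" by simp
    moreover have "y < real (nat \<lfloor>y\<rfloor>) + 1" using assms by linarith
    ultimately show ?thesis by linarith
  qed
  have 3: "0 < l" using 2 assms by (cases l) auto
  show ?thesis
  proof (rule ex1I[of _ l])
    show "0 < l \<and> y / 2 < 2 ^ l \<and> 2 ^ l \<le> y" using 1 2 3 by simp
    fix l' :: nat assume l': "0 < l' \<and> y / 2 < 2 ^ l' \<and> 2 ^ l' \<le> y"
    then have "(2::real) ^ l' < 2 ^ (l + 1)" "(2::real) ^ l < 2 ^ (l' + 1)" using 1 2 by auto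
    then have "l' < l + 1" "l < l' + 1" by (simp_all only: power_strict_increasing_iff one_less_numeral_iff semiring_norm)
    then show "l' = l" by simp
  qed
qed

lemma split_count_bounds:
  assumes "2 \<le> real n / (2 * (log 2 (real n))\<^sup>2)"
  shows "real n / (4 * (log 2 (real n))\<^sup>2) < 2 ^ split_count n"
    and "2 ^ split_count n \<le> real n / (2 * (log 2 (real n))\<^sup>2)"
proof -
  have "real n / (4 * (log 2 (real n))\<^sup>2) = real n / (2 * (log 2 (real n))\<^sup>2) / 2" by simp
  then have "\<exists>!l. 0 < l \<and> real n / (4 * (log 2 (real n))\<^sup>2) < 2 ^ l \<and> 2 ^ l \<le> real n / (2 * (log 2 (real n))\<^sup>2)"
    using power2_between[OF assms] by presburger
  from theI'[OF this] show "real n / (4 * (log 2 (real n))\<^sup>2) < 2 ^ split_count n"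
    "2 ^ split_count n \<le> real n / (2 * (log 2 (real n))\<^sup>2)"
    unfolding split_count_def by auto
qed

lemma sub_len_bounds: "real n / 2 ^ i - 1 < real (sub_len n i)" "real (sub_len n i) \<le> real n / 2 ^ i"
proof -
  have p: "(2::nat) ^ i > 0" by simp
  have "n < 2 ^ i * (sub_len n i + 1)"
    unfolding sub_len_def using dividend_less_times_div[OF p, of n] by (simp add: algebra_simps)
  then have "real n < real (2 ^ i * (sub_len n i + 1))" by (simp only: of_nat_less_iff)
  then have "real n < 2 ^ i * (real (sub_len n i) + 1)" by (simp add: algebra_simps)
  then show "real n / 2 ^ i - 1 < real (sub_len n i)" by (simp add: field_simps)
  have "2 ^ i * sub_len n i \<le> n" unfolding sub_len_def by simp
  then have "real (2 ^ i * sub_len n i) \<le> real n" by (simp only: of_nat_le_iff)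
  then show "real (sub_len n i) \<le> real n / 2 ^ i" by (simp add: field_simps)
qed

text \<open>Rounding down loses at most one cell per subarray.\<close>

lemma sum_sub_len_bounds:
  "real (\<Sum>i'=1..i. sub_len n i') \<le> real n - real n / 2 ^ i"
  "real n - real n / 2 ^ i - real i \<le> real (\<Sum>i'=1..i. sub_len n i')"
proof (induction i)
  case (Suc i)
  have e: "real n / 2 ^ Suc i = real n / 2 ^ i / 2" by simp
  case 1
  show ?case using Suc(1) sub_len_bounds(2)[of n "Suc i"] unfolding e by simp
  case 2
  show ?case using Suc(2) sub_len_bounds(1)[of n "Suc i"] unfolding e by simp
qed auto

lemma unallocated_bounds:
  "real n / 2 ^ i \<le> real (unallocated n i)" "real (unallocated n i) \<le> real n / 2 ^ i + real i"
proof -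
  have "real (\<Sum>i'=1..i. sub_len n i') \<le> real n" 
    using sum_sub_len_bounds(1)[of n i] by (rule order_trans) simp
  then have "(\<Sum>i'=1..i. sub_len n i') \<le> n" by (simp only: of_nat_le_iff)
  then have "real (unallocated n i) = real n - real (\<Sum>i'=1..i. sub_len n i')"
    unfolding unallocated_def by (rule of_nat_diff)
  then show "real n / 2 ^ i \<le> real (unallocated n i)" "real (unallocated n i) \<le> real n / 2 ^ i + real i"
    using sum_sub_len_bounds[of n i] by linarith+
qed

lemma size_parameters:
  fixes n d :: nat
  defines "L \<equiv> log 2 (real n)"
  assumes L: "32 \<le> L" and n: "100 * L\<^sup>2 * 2 ^ (d + 5) \<le> real n"
  shows "real n / (4 * L\<^sup>2) < 2 ^ split_count n" "2 ^ split_count n \<le> real n / (2 * L\<^sup>2)"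
    and "d \<le> split_count n" "1 \<le> last_sub n" "last_sub n \<le> split_count n" "real (last_sub n) \<le> 2 * L"
    and "\<And>i. 1 \<le> i \<Longrightarrow> i \<le> last_sub n \<Longrightarrow> real (bucket_count n i) * (L\<^sup>2 - 1) \<le> real (sub_len n i)"
    and "\<And>i. 1 \<le> i \<Longrightarrow> i \<le> last_sub n \<Longrightarrow> real (sub_len n i) \<le> 2 * L\<^sup>2 * real (bucket_count n i)"
    and "(\<Sum>i=1..last_sub n. sub_len n i) < n"
    and "real (n - (\<Sum>i=1..<last_sub n. sub_len n i)) \<le> 200 * L\<^sup>2"
proof -
  define \<Lambda> where "\<Lambda> = L\<^sup>2"
  have LL: "32 * L \<le> \<Lambda>" using L by (simp add: \<Lambda>_def power2_eq_square)
  have \<Lambda>: "1024 \<le> \<Lambda>" using LL L by linarith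
  have p: "(2::real) ^ d \<ge> 1" by simp
  have n': "100 * \<Lambda> * (32 * 2 ^ d) \<le> real n" using n by (simp add: \<Lambda>_def power_add mult_ac)
  have n1: "3200 * \<Lambda> \<le> real n"
  proof -
    have "3200 * \<Lambda> * 1 \<le> 3200 * \<Lambda> * 2 ^ d" using p \<Lambda> by (intro mult_left_mono) auto
    then show ?thesis using n' by simp
  qed
  have n0: "real n > 0" using n1 \<Lambda> by linarith
  have y: "2 \<le> real n / (2 * \<Lambda>)" using n1 \<Lambda> by (simp add: field_simps)
  note sc = split_count_bounds[of n, folded L_def, folded \<Lambda>_def, OF y]
  show "real n / (4 * L\<^sup>2) < 2 ^ split_count n" "2 ^ split_count n \<le> real n / (2 * L\<^sup>2)"
    using sc unfolding \<Lambda>_def .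
  have "2 ^ d \<le> real n / (4 * \<Lambda>)" using n' \<Lambda> p by (simp add: field_simps)
  then have "(2::real) ^ d < 2 ^ split_count n" using sc(1) by linarith
  then show "d \<le> split_count n" by simp
  define k where "k = last_sub n"
  define Pk where "Pk = (\<lambda>i. real (unallocated n i) < 100 * \<Lambda>)"
  have k_Least: "k = (LEAST i. Pk i)"
    unfolding k_def last_sub_def Pk_def \<Lambda>_def L_def ..
  \<comment> \<open>After about log n halvings at most one cell plus rounding losses remains, so
    allocation has stopped by then; this bounds the number of phases.\<close>
  define i0 where "i0 = nat \<lceil>L\<rceil>"
  have i0: "L \<le> real i0" "real i0 \<le> L + 1" using L unfolding i0_def by linarith+
  have "real n = 2 powr L" unfolding L_def using n0 by simp
  also have "\<dots> \<le> 2 powr real i0" using i0 by simp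
  also have "\<dots> = 2 ^ i0" by (simp add: powr_realpow)
  finally have "real n / 2 ^ i0 \<le> 1" by simp
  then have Pi0: "Pk i0" unfolding Pk_def using unallocated_bounds(2)[of n i0] i0 LL L by linarith
  have Pk: "Pk k" unfolding k_Least by (rule LeastI[of _ i0]) (rule Pi0)
  have "k \<le> i0" unfolding k_Least by (rule Least_le) (rule Pi0)
  then have kL: "real k \<le> L + 1" using i0 by linarith
  then show "real (last_sub n) \<le> 2 * L" using L by (simp add: k_def)
  have "\<not> Pk 0" unfolding Pk_def unallocated_def using n1 \<Lambda> by simp
  then have k1: "1 \<le> k" using Pk by (cases k) auto
  then show "1 \<le> last_sub n" by (simp add: k_def)
  \<comment> \<open>By minimality at least 100 \<Lambda> cells were free before
    \<open>A\<^sub>k\<close> was allocated, of which rounding explains at most \<Lambda>. The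
    resulting 2^(k - 1) \<le> n / (99 \<Lambda>) keeps \<open>k\<close> below the number of splits,
    so the subtraction in \<open>bucket_count\<close> is never truncated.\<close>
  have "\<not> Pk (k - 1)" using not_less_Least[of "k - 1" Pk] k1 unfolding k_Least by auto
  then have "100 * \<Lambda> \<le> real n / 2 ^ (k - 1) + real (k - 1)"
    unfolding Pk_def using unallocated_bounds(2)[of n "k - 1"] by linarith
  moreover have "real (k - 1) \<le> \<Lambda>" using kL LL L k1 by linarith
  ultimately have "99 * \<Lambda> \<le> real n / 2 ^ (k - 1)" by linarith
  then have "99 * \<Lambda> * 2 ^ (k - 1) \<le> real n" by (simp add: field_simps)
  then have "99 / 4 * 2 ^ (k - 1) \<le> real n / (4 * \<Lambda>)" using \<Lambda> by (simp add: field_simps)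
  then have "99 / 4 * 2 ^ (k - 1) < (2::real) ^ split_count n" using sc(1) by linarith
  moreover have "(2::real) ^ k = 2 * 2 ^ (k - 1)" using k1 by (cases k) auto
  moreover have "(0::real) < 2 ^ (k - 1)" by simp
  ultimately have "(2::real) ^ k < 2 ^ split_count n" by linarith
  then have kl: "k \<le> split_count n" by simp
  then show "last_sub n \<le> split_count n" by (simp add: k_def)
  \<comment> \<open>The product of bucket count and 2^i does not depend on i, so the bounds on the
    number of blocks carry over to every subarray.\<close>
  have ratio: "\<Lambda> * real (bucket_count n i) \<le> real n / 2 ^ i" "real n / 2 ^ i \<le> 2 * \<Lambda> * real (bucket_count n i)"
    if i: "1 \<le> i" "i \<le> last_sub n" for i
  proof -
    have "split_count n + 1 - i + i = split_count n + 1" using i kl by (simp add: k_def)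
    then have "(2::real) ^ (split_count n + 1 - i) * 2 ^ i = 2 ^ split_count n * 2"
      by (simp flip: power_add)
    then have b: "real (bucket_count n i) = 2 * 2 ^ split_count n / 2 ^ i"
      by (simp add: bucket_count_def field_simps)
    have "2 * \<Lambda> * 2 ^ split_count n \<le> real n" using sc(2) \<Lambda> by (simp add: field_simps)
    then show "\<Lambda> * real (bucket_count n i) \<le> real n / 2 ^ i" unfolding b by (simp add: field_simps)
    have "real n \<le> 4 * \<Lambda> * 2 ^ split_count n" using sc(1) \<Lambda> by (simp add: field_simps)
    then show "real n / 2 ^ i \<le> 2 * \<Lambda> * real (bucket_count n i)" unfolding b by (simp add: field_simps)
  qed
  show "real (bucket_count n i) * (L\<^sup>2 - 1) \<le> real (sub_len n i)" if i: "1 \<le> i" "i \<le> last_sub n" for i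
  proof -
    have "1 \<le> real (bucket_count n i)" by (simp add: bucket_count_def)
    then show ?thesis using ratio(1)[OF i] sub_len_bounds(1)[of n i] unfolding \<Lambda>_def
      by (simp add: algebra_simps)
  qed
  show "real (sub_len n i) \<le> 2 * L\<^sup>2 * real (bucket_count n i)" if i: "1 \<le> i" "i \<le> last_sub n" for i
    using ratio(2)[OF i] sub_len_bounds(2)[of n i] unfolding \<Lambda>_def by linarith
  have "real (\<Sum>i=1..last_sub n. sub_len n i) < real n"
  proof -
    have "0 < real n / 2 ^ last_sub n" using n0 by simp
    then show ?thesis using sum_sub_len_bounds(1)[of n "last_sub n"] by linarith
  qed
  then show lt: "(\<Sum>i=1..last_sub n. sub_len n i) < n" by (simp only: of_nat_less_iff)
  have "{1..last_sub n} = insert (last_sub n) {1..<last_sub n}" using k1 by (auto simp: k_def)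
  then have s: "(\<Sum>i=1..last_sub n. sub_len n i) = sub_len n (last_sub n) + (\<Sum>i=1..<last_sub n. sub_len n i)" by simp
  \<comment> \<open>\<open>A\<^sub>k\<close> has at most n / 2^k cells and at least that many remain
    after it, so \<open>A\<^sub>k\<close> and \<open>B\<close> have at most 100 \<Lambda> cells
    each.\<close>
  have "n - (\<Sum>i=1..<last_sub n. sub_len n i) = unallocated n k + sub_len n k"
    using lt s unfolding unallocated_def k_def by simp
  then have "real (n - (\<Sum>i=1..<last_sub n. sub_len n i)) = real (unallocated n k) + real (sub_len n k)" by simp
  also have "\<dots> \<le> 100 * \<Lambda> + 100 * \<Lambda>"
    using Pk unallocated_bounds(1)[of n k] sub_len_bounds(2)[of n k] unfolding Pk_def by linarith
  finally show "real (n - (\<Sum>i=1..<last_sub n. sub_len n i)) \<le> 200 * L\<^sup>2" by (simp add: \<Lambda>_def)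
qed

section \<open>Random inputs\<close>

text \<open>Every grid cell contains a point assigned to it, and there are as many cells as positions in
  the block order; so validity of the assignment alone forces the order to be a bijection.\<close>

lemma snake_inj:
  fixes e :: "nat \<Rightarrow> 'd::finite"
  assumes e: "bij_betw e {1..CARD('d)} UNIV"
    and asg: "\<And>x. x \<in> unit_cube \<Longrightarrow> a x \<in> {1..2 ^ l} \<and> x \<in> ordered_block e l (a x)"
  shows "inj_on (\<lambda>q. restrict (snake CARD('d) (grid_size CARD('d) l) q) {1..CARD('d)}) {1..2 ^ l}"
    (is "inj_on ?g _")
proof -
  have "grid CARD('d) l \<subseteq> ?g ` {1..2 ^ l}"
  proof
    fix v assume v: "v \<in> grid CARD('d) l"
    then have vr: "\<And>r. r \<in> {1..CARD('d)} \<Longrightarrow> 1 \<le> v r \<and> v r \<le> int (grid_size CARD('d) l r)"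
      by (auto simp: grid_def PiE_def Pi_def)
    have "open_block e l v \<noteq> {}" using measure_open_block[OF e, of l v] by (metis divide_eq_0_iff measure_empty power_not_zero zero_neq_numeral zero_neq_one)
    then obtain x where x: "x \<in> open_block e l v" by blast
    then have "x \<in> unit_cube" using open_block_subset_cube[OF e vr] by blast
    note ax = asg[OF this]
    have "v r = snake CARD('d) (grid_size CARD('d) l) (a x) r" if "r \<in> {1..CARD('d)}" for r
      by (rule open_block_eqI[OF x _ that]) (use ax in \<open>simp add: ordered_block_def\<close>)
    moreover have "v \<in> extensional {1..CARD('d)}" using v by (simp add: grid_def PiE_def)
    ultimately have "v = ?g (a x)" by (intro extensionalityI[of _ "{1..CARD('d)}"]) auto
    then show "v \<in> ?g ` {1..2 ^ l}" using ax by blast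
  qed
  then have "card (grid CARD('d) l) \<le> card (?g ` {1..2 ^ l})" by (intro card_mono) auto
  then have "card {1..2 ^ l::nat} \<le> card (?g ` {1..2 ^ l})" by (simp add: card_grid)
  then have "card (?g ` {1..2 ^ l}) = card {1..2 ^ l::nat}" using card_image_le[of "{1..2 ^ l::nat}" ?g] by simp
  then show ?thesis by (intro eq_card_imp_inj_on) auto
qed

text \<open>Adjacency of consecutive blocks enters the cost here: grid positions change by at most
  |p - q| in every coordinate.\<close>

lemma assigned_dist:
  fixes e :: "nat \<Rightarrow> 'd::finite"
  assumes e: "bij_betw e {1..CARD('d)} UNIV" and l: "CARD('d) \<le> l"
    and x: "x \<in> ordered_block e l p" "1 \<le> p" and y: "y \<in> ordered_block e l q" "1 \<le> q"
  defines "s \<equiv> 2 * (2 ^ l :: real) powr (- 1 / real CARD('d))"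
  shows "\<bar>x $ i - y $ i\<bar> \<le> (\<bar>real p - real q\<bar> + 1) * s"
    and "norm (x - y) \<le> (\<bar>real p - real q\<bar> + 1) * (real CARD('d) * s)"
proof -
  define N where "N = grid_size CARD('d) l"
  have d: "CARD('d) \<ge> 1" by (simp add: Suc_le_eq)
  have ev: "even (N CARD('d))" unfolding N_def by (rule even_grid_size) (use d l in auto)
  have Np: "N r > 0" for r by (simp add: N_def grid_size_pos)
  have D: "of_int \<bar>snake CARD('d) N p r - snake CARD('d) N q r\<bar> \<le> \<bar>real p - real q\<bar>" for r
  proof -
    have "of_int \<bar>snake CARD('d) N p r - snake CARD('d) N q r\<bar> \<le> real_of_int \<bar>int p - int q\<bar>"
      using snake_dist[where d = "CARD('d)" and N = N, OF d ev Np x(2) y(2), of r] by (simp only: of_int_le_iff)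
    then show ?thesis by simp
  qed
  have x': "x \<in> block e l (snake CARD('d) N p)" and y': "y \<in> block e l (snake CARD('d) N q)"
    using x y by (simp_all add: ordered_block_def N_def)
  show "\<bar>x $ i - y $ i\<bar> \<le> (\<bar>real p - real q\<bar> + 1) * s"
    "norm (x - y) \<le> (\<bar>real p - real q\<bar> + 1) * (real CARD('d) * s)"
    unfolding s_def by (rule block_dist[OF e x' y' D])+
qed

section \<open>Bucket regions and the good event\<close>

lemma card_bucket_blocks:
  fixes i j l :: nat
  assumes "1 \<le> i" "i \<le> l" "j \<in> {1..2 ^ (l + 1 - i)}"
  shows "card {q \<in> {1..2 ^ l}. (q - 1) div 2 ^ (i - 1) + 1 = j} = 2 ^ (i - 1)"
proof -
  define P where "P = (2::nat) ^ (i - 1)"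
  have P: "P > 0" by (simp add: P_def)
  have PK: "P * 2 ^ (l + 1 - i) = 2 ^ l" using assms by (simp add: P_def flip: power_add)
  have "{q \<in> {1..2 ^ l}. (q - 1) div P + 1 = j} = {P * (j - 1) + 1..P * j}"
  proof (intro equalityI subsetI)
    fix q assume q: "q \<in> {q \<in> {1..2 ^ l}. (q - 1) div P + 1 = j}"
    then have "(q - 1) div P = j - 1" by auto
    then have "P * (j - 1) \<le> q - 1" "q - 1 < P * (j - 1) + P"
      using P by (metis div_times_less_eq_dividend mult.commute) (metis P \<open>(q - 1) div P = j - 1\<close> add.commute dividend_less_times_div)
    moreover have "P * j = P * (j - 1) + P" using assms by (cases j) auto
    moreover have "1 \<le> q" using q by simp
    ultimately show "q \<in> {P * (j - 1) + 1..P * j}" unfolding atLeastAtMost_iff by linarith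
  next
    fix q assume q: "q \<in> {P * (j - 1) + 1..P * j}"
    have Pj: "P * j = P * (j - 1) + P" using assms by (cases j) auto
    have "P * j \<le> P * 2 ^ (l + 1 - i)" using assms by (intro mult_left_mono) auto
    then have "q \<le> 2 ^ l" using q unfolding PK atLeastAtMost_iff by linarith
    moreover have "(q - 1) div P = j - 1"
      by (rule div_nat_eqI) (use q Pj in \<open>auto simp: mult.commute\<close>)
    ultimately show "q \<in> {q \<in> {1..2 ^ l}. (q - 1) div P + 1 = j}" using q assms by auto
  qed
  moreover have "card {P * (j - 1) + 1..P * j} = P" using assms by (cases j) auto
  ultimately show ?thesis by (simp add: P_def)
qed

text \<open>The region of a bucket without the block boundaries; its probability is exactly the
  reciprocal of the number of buckets.\<close>

definition region :: "(nat \<Rightarrow> 'd::finite) \<Rightarrow> nat \<Rightarrow> nat \<Rightarrow> nat \<Rightarrow> (real ^ 'd) set" where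
  "region e l i j = (\<Union>q\<in>{q \<in> {1..2 ^ l}. (q - 1) div 2 ^ (i - 1) + 1 = j}.
     open_block e l (snake CARD('d) (grid_size CARD('d) l) q))"

lemma snake_grid_size_range:
  assumes "1 \<le> d" "d \<le> l" "r \<in> {1..d}"
  shows "1 \<le> snake d (grid_size d l) q r \<and> snake d (grid_size d l) q r \<le> int (grid_size d l r)"
  by (rule snake_in_grid) (use assms even_grid_size[of d d l] grid_size_pos in auto)

lemma measure_snake_blocks:
  fixes e :: "nat \<Rightarrow> 'd::finite"
  assumes e: "bij_betw e {1..CARD('d)} UNIV" and l: "CARD('d) \<le> l"
    and inj: "inj_on (\<lambda>q. restrict (snake CARD('d) (grid_size CARD('d) l) q) {1..CARD('d)}) {1..2 ^ l}"
    and I: "I \<subseteq> {1..2 ^ l}"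
  shows "measure cube_measure (\<Union>q\<in>I. open_block e l (snake CARD('d) (grid_size CARD('d) l) q)) = real (card I) / 2 ^ l"
proof (rule measure_cube_UN_open_block[OF e])
  show "finite I" using I finite_subset by blast
  show "inj_on (\<lambda>q. restrict (snake CARD('d) (grid_size CARD('d) l) q) {1..CARD('d)}) I"
    using inj I by (rule inj_on_subset)
  show "1 \<le> snake CARD('d) (grid_size CARD('d) l) q r \<and>
      snake CARD('d) (grid_size CARD('d) l) q r \<le> int (grid_size CARD('d) l r)"
    if "r \<in> {1..CARD('d)}" for q r
    by (rule snake_grid_size_range) (use l that in \<open>auto simp: Suc_le_eq\<close>)
qed

lemma measure_grid_blocks:
  fixes e :: "nat \<Rightarrow> 'd::finite"
  assumes e: "bij_betw e {1..CARD('d)} UNIV" and S: "S \<subseteq> grid CARD('d) l"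
  shows "measure cube_measure (\<Union>v\<in>S. open_block e l v) = real (card S) / 2 ^ l"
proof (rule measure_cube_UN_open_block[OF e, of S "\<lambda>v. v"])
  show "finite S" using S finite_grid finite_subset by blast
  show "inj_on (\<lambda>v. restrict v {1..CARD('d)}) S"
  proof (rule inj_onI)
    fix v w assume "v \<in> S" "w \<in> S" and eq: "restrict v {1..CARD('d)} = restrict w {1..CARD('d)}"
    then have "v \<in> extensional {1..CARD('d)}" "w \<in> extensional {1..CARD('d)}"
      using S by (auto simp: grid_def PiE_def)
    then show "v = w" using eq by (metis extensional_restrict)
  qed
  show "1 \<le> v r \<and> v r \<le> int (grid_size CARD('d) l r)" if "v \<in> S" "r \<in> {1..CARD('d)}" for v r
    using that S by (auto simp: grid_def PiE_def Pi_def)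
qed

text \<open>Two grids occur: \<open>l\<close> for the buckets and \<open>l'\<close> for the optimum;
  almost surely every point is interior to a cell of both. Counts are controlled for the open
  regions and transferred to assigned buckets, which agree with them on \<open>U1\<close>. At most
  2^n sets of cells, each of probability at most 1/4, contribute (1/2)^n.\<close>

lemma good_event:
  fixes e :: "nat \<Rightarrow> 'd::finite" and n l k l' :: nat and \<Lambda> :: real
  assumes e: "bij_betw e {1..CARD('d)} UNIV" and l: "CARD('d) \<le> l" and k: "k \<le> l" and n: "2 ^ l \<le> n" "2 ^ l' \<le> n"
    and asg: "\<And>x. x \<in> unit_cube \<Longrightarrow> a x \<in> {1..2 ^ l} \<and> x \<in> ordered_block e l (a x)"
    and \<Lambda>: "0 \<le> \<Lambda>"
    and small: "real ((n + 1)\<^sup>2 * n\<^sup>2) * (2 * exp (- \<Lambda> / 80000)) + (1 / 2) ^ n \<le> 1 / real n"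
  shows "\<exists>E \<in> sets (uniform_input n :: (nat \<Rightarrow> real ^ 'd) measure). 1 - 1 / real n \<le> measure (uniform_input n) E \<and>
    (\<forall>X\<in>E. (\<forall>t<n. X t \<in> unit_cube) \<and>
      (2 ^ l' / (4 * 2 ^ CARD('d)) - 1) * ((2 ^ l') powr (- 1 / real CARD('d)) / 2) \<le> opt_tour (map X [0..<n]) \<and>
      (\<forall>i j p q. 1 \<le> i \<longrightarrow> i \<le> k \<longrightarrow> j \<in> {1..2 ^ (l + 1 - i)} \<longrightarrow> p \<le> q \<longrightarrow> q \<le> n \<longrightarrow>
        \<bar>real (card {t \<in> {p..<q}. (a (X t) - 1) div 2 ^ (i - 1) + 1 = j}) - real (q - p) / 2 ^ (l + 1 - i)\<bar>
          \<le> (real (q - p) / 2 ^ (l + 1 - i) + \<Lambda>) / 200))"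
proof -
  interpret prob_space "cube_measure :: (real ^ 'd) measure" by (rule prob_space_cube)
  let ?v = "snake CARD('d) (grid_size CARD('d) l)"
  note inj = snake_inj[OF e asg]
  define J where "J = (SIGMA i:{1..k}. {1..2 ^ (l + 1 - i) :: nat})"
  define R where "R = (\<lambda>(i, j). region e l i j)"
  define S where "S = {S. S \<subseteq> grid CARD('d) l' \<and> 4 * card S \<le> 2 ^ l'}"
  define W where "W = (\<lambda>S. \<Union>v\<in>S. open_block e l' v)"
  define U1 where "U1 = (\<Union>q\<in>{1..2 ^ l}. open_block e l (?v q))"
  define U2 where "U2 = (\<Union>v\<in>grid CARD('d) l'. open_block e l' v)"
  have Rs: "R ij \<in> events" for ij unfolding R_def region_def by (cases ij) (auto intro!: sets.finite_UN open_block_sets[OF e])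
  have Rp: "prob (R (i, j)) = 1 / 2 ^ (l + 1 - i)" if "1 \<le> i" "i \<le> k" "j \<in> {1..2 ^ (l + 1 - i)}" for i j
  proof -
    have "prob (R (i, j)) = real (card {q \<in> {1..2 ^ l}. (q - 1) div 2 ^ (i - 1) + 1 = j}) / 2 ^ l"
      unfolding R_def region_def prod.case by (rule measure_snake_blocks[OF e l inj]) auto
    also have "\<dots> = 2 ^ (i - 1) / 2 ^ l" using card_bucket_blocks[of i l j] that k by simp
    also have "\<dots> = 1 / 2 ^ (l + 1 - i)"
    proof -
      have "l = (i - 1) + (l + 1 - i)" using that k by simp
      then have "(2::real) ^ l = 2 ^ (i - 1) * 2 ^ (l + 1 - i)" by (metis power_add)
      then show ?thesis by simp
    qed
    finally show ?thesis .
  qed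
  have finS: "finite S" unfolding S_def by (rule finite_subset[of _ "Pow (grid CARD('d) l')"]) (auto simp: finite_grid)
  have Ws: "W T \<in> events" if "T \<in> S" for T
    unfolding W_def using that finite_subset[OF _ finite_grid] by (auto simp: S_def intro!: sets.finite_UN open_block_sets[OF e])
  have Wp: "prob (W T) \<le> 1 / 4" if "T \<in> S" for T
  proof -
    have "prob (W T) = real (card T) / 2 ^ l'" unfolding W_def
      using that by (intro measure_grid_blocks[OF e]) (auto simp: S_def)
    moreover have "real (4 * card T) \<le> real (2 ^ l')" using that unfolding S_def of_nat_le_iff by blast
    then have "real (card T) / 2 ^ l' \<le> 1 / 4" by (simp add: field_simps)
    ultimately show ?thesis by simp
  qed
  have U1: "U1 \<in> events" "prob U1 = 1"
    using measure_snake_blocks[OF e l inj, of "{1..2 ^ l}"] unfolding U1_def by (auto intro!: sets.finite_UN open_block_sets[OF e])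
  have U2: "U2 \<in> events" "prob U2 = 1"
    using measure_grid_blocks[OF e, of "grid CARD('d) l'" l'] unfolding U2_def
    by (auto intro!: sets.finite_UN open_block_sets[OF e] simp: finite_grid card_grid)
  have U: "U1 \<inter> U2 \<in> events" "prob (U1 \<inter> U2) = 1"
    using U1 U2 prob_eq_1[of U1] prob_eq_1[of U2] prob_eq_1[of "U1 \<inter> U2"] by auto
  have finJ: "finite J" by (auto simp: J_def)
  have "card J = (\<Sum>i=1..k. 2 ^ (l + 1 - i))" by (simp add: J_def)
  also have "\<dots> \<le> (\<Sum>i=1..k. 2 ^ l)" by (intro sum_mono power_increasing) auto
  also have "\<dots> = k * 2 ^ l" by simp
  also have "\<dots> \<le> n * n"
  proof (rule mult_mono)
    have "l < 2 ^ l" by (rule less_exp)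
    then show "k \<le> n" using n k by linarith
  qed (use n in auto)
  finally have cJ: "card J \<le> n\<^sup>2" by (simp add: power2_eq_square)
  have "card S \<le> card (Pow (grid CARD('d) l'))" unfolding S_def by (intro card_mono) (auto simp: finite_grid)
  also have "\<dots> = 2 ^ 2 ^ l'" by (simp add: card_Pow finite_grid card_grid)
  also have "\<dots> \<le> 2 ^ n" using n by (intro power_increasing) auto
  finally have cS: "card S \<le> 2 ^ n" .
  \<comment> \<open>The tolerance 1/200 of the invariants gives \<epsilon>^2 / 2 = 1 /
    80000.\<close>
  define \<epsilon> where "\<epsilon> = (1 / 200 :: real)"
  have \<epsilon>: "0 < \<epsilon>" "\<epsilon> \<le> 1" "- \<epsilon>\<^sup>2 * \<Lambda> / 2 = - \<Lambda> / 80000" by (auto simp: \<epsilon>_def power2_eq_square)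
  let ?P = "Pi\<^sub>M {..<n} (\<lambda>_. cube_measure :: (real ^ 'd) measure)"
  let ?good = "\<lambda>X. (\<forall>t<n. X t \<in> U1 \<inter> U2) \<and> (\<forall>T\<in>S. \<exists>t<n. X t \<notin> W T) \<and>
      (\<forall>j\<in>J. \<forall>a b. a \<le> b \<and> b \<le> n \<longrightarrow>
        \<bar>real (card {t \<in> {a..<b}. X t \<in> R j}) - real (b - a) * prob (R j)\<bar>
          \<le> \<epsilon> * (real (b - a) * prob (R j) + \<Lambda>))"
  have "\<exists>E\<in>sets ?P. 1 - ((real (n + 1))\<^sup>2 * card J * (2 * exp (- \<epsilon>\<^sup>2 * \<Lambda> / 2)) + card S * (1 / 4) ^ n) \<le> measure ?P E \<and>
      (\<forall>X\<in>E. ?good X)"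
    by (rule concentration_event[where J = J and R = R and S = S and W = W,
        OF finJ Rs finS Ws Wp U \<epsilon>(1,2) \<Lambda>])
  then obtain E where E: "E \<in> sets ?P"
    "1 - ((real (n + 1))\<^sup>2 * card J * (2 * exp (- \<epsilon>\<^sup>2 * \<Lambda> / 2)) + card S * (1 / 4) ^ n) \<le> measure ?P E"
    and good: "\<And>X. X \<in> E \<Longrightarrow> ?good X"
    by (elim bexE conjE) simp
  have ui: "uniform_input n = ?P" by (simp add: uniform_input_def cube_measure_def)
  have m: "1 - 1 / real n \<le> measure ?P E"
  proof -
    have "(real (n + 1))\<^sup>2 * card J * (2 * exp (- \<epsilon>\<^sup>2 * \<Lambda> / 2)) \<le> (real (n + 1))\<^sup>2 * real (n\<^sup>2) * (2 * exp (- \<epsilon>\<^sup>2 * \<Lambda> / 2))"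
      using cJ by (intro mult_right_mono mult_left_mono) (simp_all only: of_nat_le_iff, auto)
    moreover have "card S * (1 / 4) ^ n \<le> real (2 ^ n) * (1 / 4) ^ n"
      using cS by (intro mult_right_mono) (simp_all only: of_nat_le_iff, auto)
    moreover have "real (2 ^ n) * (1 / 4) ^ n = (1 / 2) ^ n" by (simp flip: power_mult_distrib)
    moreover have "(real (n + 1))\<^sup>2 * real (n\<^sup>2) * (2 * exp (- \<epsilon>\<^sup>2 * \<Lambda> / 2)) + (1 / 2) ^ n \<le> 1 / real n"
      using small unfolding \<epsilon>(3) by (simp only: of_nat_mult of_nat_power)
    ultimately show ?thesis using E(2) by linarith
  qed
  \<comment> \<open>An interior point fixes the grid cell, and injectivity of the order then fixes
    the index.\<close>
  have asg_eq: "a x = q" if x: "x \<in> open_block e l (?v q)" and q: "q \<in> {1..2 ^ l}" for x q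
  proof -
    have "x \<in> unit_cube" using x open_block_subset_cube[OF e snake_grid_size_range] l by (fastforce simp: Suc_le_eq)
    note ax = asg[OF this]
    have "?v q r = ?v (a x) r" if "r \<in> {1..CARD('d)}" for r
      by (rule open_block_eqI[OF x _ that]) (use ax in \<open>simp add: ordered_block_def\<close>)
    then have "restrict (?v q) {1..CARD('d)} = restrict (?v (a x)) {1..CARD('d)}" by (auto simp: restrict_def)
    then show ?thesis using inj_onD[OF inj] q ax by metis
  qed
  have reg: "x \<in> R (i, j) \<longleftrightarrow> (a x - 1) div 2 ^ (i - 1) + 1 = j" if "x \<in> U1" for x i j
  proof -
    obtain q where q: "q \<in> {1..2 ^ l}" "x \<in> open_block e l (?v q)" using \<open>x \<in> U1\<close> unfolding U1_def by blast
    have "a x = q" by (rule asg_eq[OF q(2,1)])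
    show ?thesis
    proof
      assume "x \<in> R (i, j)"
      then obtain q' where "q' \<in> {1..2 ^ l}" "(q' - 1) div 2 ^ (i - 1) + 1 = j" "x \<in> open_block e l (?v q')"
        unfolding R_def region_def by auto
      then show "(a x - 1) div 2 ^ (i - 1) + 1 = j" using asg_eq by blast
    next
      assume "(a x - 1) div 2 ^ (i - 1) + 1 = j"
      then show "x \<in> R (i, j)" using q \<open>a x = q\<close> unfolding R_def region_def by auto
    qed
  qed
  show ?thesis unfolding ui
  proof (intro bexI[OF _ E(1)] conjI m ballI allI impI)
    fix X t assume X: "X \<in> E" and t: "t < n"
    then obtain q where "q \<in> {1..2 ^ l}" "X t \<in> open_block e l (?v q)" using good[OF X] unfolding U1_def by blast
    then show "X t \<in> unit_cube" using open_block_subset_cube[OF e snake_grid_size_range] l by (fastforce simp: Suc_le_eq)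
  next
    fix X assume X: "X \<in> E"
    show "(2 ^ l' / (4 * 2 ^ CARD('d)) - 1) * ((2 ^ l') powr (- 1 / real CARD('d)) / 2) \<le> opt_tour (map X [0..<n])"
    proof (rule opt_tour_ge_occupied)
      show "X t \<in> (\<Union>v\<in>grid CARD('d) l'. open_block e l' v)" if "t < n" for t
        using good[OF X] that by (simp add: U2_def)
      show "\<exists>t<n. X t \<notin> (\<Union>v\<in>T. open_block e l' v)" if "T \<subseteq> grid CARD('d) l'" "4 * card T \<le> 2 ^ l'" for T
        using good[OF X] that by (simp add: S_def W_def)
    qed
  next
    fix X and i j p q :: nat assume X: "X \<in> E" and i: "1 \<le> i" "i \<le> k" and j: "j \<in> {1..2 ^ (l + 1 - i)}" and pq: "p \<le> q" "q \<le> n"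
    have "(i, j) \<in> J" using i j by (simp add: J_def)
    then have c: "\<bar>real (card {t \<in> {p..<q}. X t \<in> R (i, j)}) - real (q - p) * prob (R (i, j))\<bar>
        \<le> \<epsilon> * (real (q - p) * prob (R (i, j)) + \<Lambda>)" using good[OF X] pq by blast
    have U1t: "X t \<in> U1" if "t < n" for t using good[OF X] that by blast
    have "{t \<in> {p..<q}. X t \<in> R (i, j)} = {t \<in> {p..<q}. (a (X t) - 1) div 2 ^ (i - 1) + 1 = j}"
      using reg[OF U1t] pq by auto
    then show "\<bar>real (card {t \<in> {p..<q}. (a (X t) - 1) div 2 ^ (i - 1) + 1 = j}) - real (q - p) / 2 ^ (l + 1 - i)\<bar>
          \<le> (real (q - p) / 2 ^ (l + 1 - i) + \<Lambda>) / 200"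
      using c unfolding Rp[OF i j] by (simp add: \<epsilon>_def)
  qed
qed

section \<open>Comparing the cost with the optimum\<close>

text \<open>In dimension one the coordinate is the key and distances equal differences of keys.
  Otherwise the block index is the key and each point costs one extra \<Delta>.\<close>

lemma opt_tour_bucket:
  fixes e :: "nat \<Rightarrow> 'd::finite" and ps :: "(real ^ 'd) list"
  assumes e: "bij_betw e {1..CARD('d)} UNIV" and l: "CARD('d) \<le> l"
    and ps: "\<And>x. x \<in> set ps \<Longrightarrow> x \<in> ordered_block e l (a x) \<and> 1 \<le> a x"
    and P: "1 \<le> P" "\<And>x y. x \<in> set ps \<Longrightarrow> y \<in> set ps \<Longrightarrow> \<bar>real (a x) - real (a y)\<bar> \<le> P"
  defines "\<Delta> \<equiv> 2 * (real CARD('d) * (2 * (2 ^ l) powr (- 1 / real CARD('d))))"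
    and "f \<equiv> if CARD('d) = 1 then 0 else 1 :: real"
  shows "opt_tour ps \<le> (4 * P + f * real (length ps)) * \<Delta>"
proof -
  define s where "s = 2 * (2 ^ l :: real) powr (- 1 / real CARD('d))"
  have s: "s \<ge> 0" by (simp add: s_def)
  have \<Delta>: "\<Delta> = 2 * (real CARD('d) * s)" by (simp add: \<Delta>_def s_def)
  have \<Delta>0: "\<Delta> \<ge> 0" using s by (simp add: \<Delta>)
  define x0 where "x0 = hd ps"
  \<comment> \<open>\<open>hd ps\<close> is unspecified for the empty list, so \<open>x0\<close> is
    used only when some point is present.\<close>
  have x0: "x0 \<in> set ps" if "x \<in> set ps" for x using that by (cases ps) (auto simp: x0_def)
  show ?thesis
  proof (cases "CARD('d) = 1")
    case True
    \<comment> \<open>All coordinates lie within \<open>W\<close> of that of \<open>x0\<close>, so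
      the tour costs at most 4 W; P + 1 \<le> 2 P is absorbed by the factor 2 in \<Delta>.\<close>
    define W where "W = (P + 1) * s"
    have W: "0 \<le> W" using s P by (simp add: W_def)
    have U: "(UNIV :: 'd set) = {e 1}" using e True by (auto simp: bij_betw_def)
    have "opt_tour ps \<le> 2 * 1 * ((x0 $ e 1 + W) - (x0 $ e 1 - W)) + real (length ps) * 0"
    proof (rule opt_tour_le_key[where f = "\<lambda>x. x $ e 1"])
      fix x y assume "x \<in> set ps" "y \<in> set ps"
      have "norm (x - y) \<le> (\<Sum>i\<in>UNIV. \<bar>(x - y) $ i\<bar>)" by (rule norm_le_l1_cart)
      then show "norm (x - y) \<le> 1 * \<bar>x $ e 1 - y $ e 1\<bar> + 0" by (simp add: U)
    next
      fix x assume x: "x \<in> set ps"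
      have "\<bar>x $ e 1 - x0 $ e 1\<bar> \<le> (\<bar>real (a x) - real (a x0)\<bar> + 1) * s"
        unfolding s_def by (rule assigned_dist(1)[OF e l]) (use ps x x0[OF x] in auto)
      also have "\<dots> \<le> W" unfolding W_def using P(2)[OF x x0[OF x]] s by (intro mult_right_mono) auto
      finally show "x0 $ e 1 - W \<le> x $ e 1 \<and> x $ e 1 \<le> x0 $ e 1 + W" by (simp add: abs_le_iff)
    qed (use W in auto)
    also have "\<dots> = 4 * (P + 1) * s" by (simp add: W_def)
    also have "\<dots> \<le> 8 * P * s" using P s by (intro mult_right_mono) auto
    finally show ?thesis by (simp add: f_def True \<Delta>)
  next
    case False
    have "opt_tour ps \<le> 2 * \<Delta> * ((real (a x0) + P) - (real (a x0) - P)) + real (length ps) * \<Delta>"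
    proof (rule opt_tour_le_key[where f = "\<lambda>x. real (a x)"])
      fix x y assume xy: "x \<in> set ps" "y \<in> set ps"
      have "norm (x - y) \<le> (\<bar>real (a x) - real (a y)\<bar> + 1) * (real CARD('d) * s)"
        unfolding s_def by (rule assigned_dist(2)[OF e l]) (use ps xy in auto)
      also have "\<dots> \<le> (\<bar>real (a x) - real (a y)\<bar> + 1) * \<Delta>"
        using s by (intro mult_left_mono) (auto simp: \<Delta>)
      finally show "norm (x - y) \<le> \<Delta> * \<bar>real (a x) - real (a y)\<bar> + \<Delta>" by (simp add: algebra_simps)
    next
      fix x assume x: "x \<in> set ps"
      show "real (a x0) - P \<le> real (a x) \<and> real (a x) \<le> real (a x0) + P"
        using P(2)[OF x x0[OF x]] by (simp add: abs_le_iff)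
    qed (use \<Delta>0 P in auto)
    moreover have "f = 1" using False by (simp add: f_def)
    ultimately show ?thesis by (simp add: algebra_simps)
  qed
qed

text \<open>\<open>K\<close> is the number of blocks and \<open>M\<close> is n up to a factor 2. For
  d \<ge> 2 the exponent p is at least 1/2, so L \<le> (L^2)^p, and the gap L^2 between K and M pays
  for the extra factor.\<close>

lemma volume_comparison:
  fixes K M L :: real and d :: nat
  assumes d: "d \<ge> 1" and L: "L \<ge> 1" and K: "0 < K" "K \<le> M / L\<^sup>2"
  defines "f \<equiv> if d = 1 then 0 else 1 :: real"
  shows "K powr (1 - 1 / real d) * (1 + f * L) \<le> 2 * M powr (1 - 1 / real d)"
    and "K powr (1 - 1 / real d) \<le> M powr (1 - 1 / real d)"
proof -
  define p where "p = 1 - 1 / real d"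
  have p: "0 \<le> p" using d by (simp add: p_def)
  have L2: "1 \<le> L\<^sup>2" using L by (simp add: power2_eq_square mult_ge1_I)
  have KM: "K * L\<^sup>2 \<le> M" using mult_right_mono[OF K(2), of "L\<^sup>2"] L by simp
  moreover have "K * 1 \<le> K * L\<^sup>2" using K L2 by (intro mult_left_mono) auto
  ultimately have "K \<le> M" by linarith
  then have 1: "K powr p \<le> M powr p" using K p by (intro powr_mono2) auto
  then show "K powr (1 - 1 / real d) \<le> M powr (1 - 1 / real d)" by (simp add: p_def)
  have M0: "M > 0" using K \<open>K \<le> M\<close> by linarith
  have "K powr p * (1 + f * L) \<le> 2 * M powr p"
  proof (cases "d = 1")
    case True
    then have "K powr p * (1 + f * L) = K powr p" by (simp add: f_def)
    moreover have "0 \<le> M powr p" by (rule powr_ge_zero)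
    ultimately show ?thesis using 1 by linarith
  next
    case False
    then have "1 / 2 \<le> p" using d by (simp add: p_def field_simps)
    have "K powr p * L \<le> K powr p * (L powr (2 * p))"
    proof (rule mult_left_mono)
      have "L powr 1 \<le> L powr (2 * p)" using L \<open>1 / 2 \<le> p\<close> by (intro powr_mono) auto
      then show "L \<le> L powr (2 * p)" using L by simp
    qed simp
    also have "\<dots> = (K * L\<^sup>2) powr p"
      using K L by (simp add: powr_mult powr_powr flip: powr_numeral)
    also have "\<dots> \<le> M powr p" using KM K p by (intro powr_mono2) auto
    finally show ?thesis using 1 False by (simp add: f_def algebra_simps)
  qed
  then show "K powr (1 - 1 / real d) * (1 + f * L) \<le> 2 * M powr (1 - 1 / real d)" by (simp add: p_def)
qed

text \<open>The key identity is \<Delta> * K = 4 d K^(1 - 1/d). The constant 234 collects 32 for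
  edges between buckets, 2 for those between subarrays and 200 for the last cells.\<close>

lemma cost_comparison:
  fixes c L K M :: real and d k :: nat
  assumes c: "c \<ge> 0" and d: "d \<ge> 1" and L: "L \<ge> 1" and K: "0 < K" "K \<le> M / L\<^sup>2" and M: "1 \<le> M" and k: "real k \<le> 2 * L"
  defines "f \<equiv> if d = 1 then 0 else 1 :: real"
    and "\<Delta> \<equiv> 2 * (real d * (2 * K powr (- 1 / real d)))"
  shows "2 * c * sqrt (L\<^sup>2) * \<Delta> * K * (4 * real k + 8 * f * L\<^sup>2) + 4 * real k * K * \<Delta> + real d * real k + 200 * L\<^sup>2 * real d
    \<le> (128 * c + 234) * real d * L\<^sup>2 * M powr (1 - 1 / real d)"
proof -
  define \<kappa> where "\<kappa> = K powr (1 - 1 / real d)"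
  define \<mu> where "\<mu> = M powr (1 - 1 / real d)"
  have vc: "\<kappa> * (1 + f * L) \<le> 2 * \<mu>" "\<kappa> \<le> \<mu>"
    using volume_comparison[OF d L K] unfolding \<kappa>_def \<mu>_def f_def by auto
  have \<kappa>0: "0 \<le> \<kappa>" by (simp add: \<kappa>_def)
  have \<mu>1: "1 \<le> \<mu>" unfolding \<mu>_def using M d by (intro ge_one_powr_ge_zero) auto
  have f0: "f \<ge> 0" by (simp add: f_def)
  have "K * K powr (- 1 / real d) = K powr (1 - 1 / real d)"
    using K by (simp add: powr_diff powr_minus_divide)
  then have \<Delta>K: "\<Delta> * K = 4 * real d * \<kappa>" unfolding \<Delta>_def \<kappa>_def by (simp add: mult_ac)
  have L2: "L \<le> L\<^sup>2" using L by (simp add: power2_eq_square)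
  have sL: "sqrt (L\<^sup>2) = L" using L by simp
  have "2 * c * sqrt (L\<^sup>2) * \<Delta> * K * (4 * real k + 8 * f * L\<^sup>2) = 8 * c * L * real d * \<kappa> * (4 * real k + 8 * f * L\<^sup>2)"
    using \<Delta>K sL by (simp add: mult.assoc)
  also have "\<dots> \<le> 8 * c * L * real d * \<kappa> * (8 * L + 8 * f * L\<^sup>2)"
    using k c L \<kappa>0 by (intro mult_left_mono) auto
  also have "\<dots> = 64 * c * real d * L\<^sup>2 * (\<kappa> * (1 + f * L))" by (simp add: algebra_simps power2_eq_square)
  also have "\<dots> \<le> 64 * c * real d * L\<^sup>2 * (2 * \<mu>)" using vc(1) c by (intro mult_left_mono) auto
  finally have 1: "2 * c * sqrt (L\<^sup>2) * \<Delta> * K * (4 * real k + 8 * f * L\<^sup>2) \<le> 128 * c * (real d * L\<^sup>2 * \<mu>)" by simp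
  have "4 * real k * K * \<Delta> = 16 * real d * (real k * \<kappa>)" using \<Delta>K by (simp add: mult_ac)
  also have "\<dots> \<le> 16 * real d * ((2 * L\<^sup>2) * \<mu>)"
    using k L2 vc(2) \<kappa>0 by (intro mult_left_mono mult_mono) auto
  finally have 2: "4 * real k * K * \<Delta> \<le> 32 * (real d * L\<^sup>2 * \<mu>)" by simp
  have \<mu>': "real d * L\<^sup>2 * 1 \<le> real d * L\<^sup>2 * \<mu>" using \<mu>1 by (intro mult_left_mono) auto
  then have 4: "200 * L\<^sup>2 * real d \<le> 200 * (real d * L\<^sup>2 * \<mu>)" by (simp add: mult_ac)
  have "real d * real k \<le> real d * (2 * L\<^sup>2)" using k L2 by (intro mult_left_mono) auto
  also have "\<dots> = 2 * (real d * L\<^sup>2 * 1)" by simp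
  also have "\<dots> \<le> 2 * (real d * L\<^sup>2 * \<mu>)" using \<mu>' by linarith
  finally have 3: "real d * real k \<le> 2 * (real d * L\<^sup>2 * \<mu>)" .
  show ?thesis using 1 2 3 4 unfolding \<mu>_def[symmetric] by (simp add: algebra_simps)
qed

theorem theorem3:
  fixes e :: "nat \<Rightarrow> 'd::finite" and \<B> :: "'d online_alg"
  assumes "bij_betw e {1..CARD('d)} UNIV"
    and "sqrt_competitive \<B>"
  shows "\<exists>D::real. \<forall>\<^sub>F n in sequentially. \<forall>ch. valid_choices n e ch \<longrightarrow>
    (\<exists>E \<in> sets (uniform_input n :: (nat \<Rightarrow> real ^ 'd) measure).
       measure (uniform_input n) E \<ge> 1 - 1 / real n \<and>
       (\<forall>X\<in>E. alg_cost n \<B> ch X \<le> D * (log 2 (real n))\<^sup>2 * opt_tour (map X [0..<n])))"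
proof -
  note e = assms(1)
  define d where "d = CARD('d)"
  have d: "d \<ge> 1" by (simp add: d_def Suc_le_eq)
  obtain c where c: "\<And>m ps. length ps = m \<Longrightarrow> set ps \<subseteq> unit_cube \<Longrightarrow>
      array_cost m (final_array \<B> m ps) \<le> c * sqrt (real m) * opt_tour ps"
    and pl: "online_placement \<B>"
    using assms(2) unfolding sqrt_competitive_def by blast
  \<comment> \<open>The constant supplied by competitiveness may be negative.\<close>
  define c0 where "c0 = max c 0"
  have c0: "c0 \<ge> 0" by (simp add: c0_def)
  have comp: "array_cost m (final_array \<B> m ps) \<le> c0 * sqrt (real m) * opt_tour ps"
    if "length ps = m" "set ps \<subseteq> unit_cube" for m ps
  proof -
    have "c * sqrt (real m) * opt_tour ps \<le> c0 * sqrt (real m) * opt_tour ps"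
      by (intro mult_right_mono) (auto simp: c0_def opt_tour_nonneg)
    then show ?thesis using c[OF that] by linarith
  qed
  \<comment> \<open>The factor 16 * 2^d inverts the lower bound on the optimum: M / (4 * 2^d) - 1
    \<ge> M / (8 * 2^d) once M \<ge> 8 * 2^d, and the separation contributes another 1/2.\<close>
  define D where "D = (128 * c0 + 234) * real d * (16 * 2 ^ d)"
  have ev1: "\<forall>\<^sub>F n in sequentially. 32 \<le> log 2 (real n)" by real_asymp
  have ev2: "\<forall>\<^sub>F n in sequentially. 100 * (log 2 (real n))\<^sup>2 * 2 ^ (d + 5) \<le> real n" by real_asymp
  \<comment> \<open>exp (- log^2 n / 80000) eventually beats every power of n.\<close>
  have ev3: "\<forall>\<^sub>F n in sequentially.
      (real n + 1)\<^sup>2 * (real n)\<^sup>2 * (2 * exp (- (log 2 (real n))\<^sup>2 / 80000)) + (1 / 2) ^ n \<le> 1 / real n"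
    by real_asymp
  have "\<forall>\<^sub>F n in sequentially. \<forall>ch. valid_choices n e ch \<longrightarrow>
    (\<exists>E \<in> sets (uniform_input n :: (nat \<Rightarrow> real ^ 'd) measure).
       measure (uniform_input n) E \<ge> 1 - 1 / real n \<and>
       (\<forall>X\<in>E. alg_cost n \<B> ch X \<le> D * (log 2 (real n))\<^sup>2 * opt_tour (map X [0..<n])))"
    using ev1 ev2 ev3
  proof eventually_elim
    case (elim n)
    define L where "L = log 2 (real n)"
    define l where "l = split_count n"
    define k where "k = last_sub n"
    have L: "32 \<le> L" using elim(1) by (simp add: L_def)
    have L2: "1024 \<le> L\<^sup>2" using power_mono[of 32 L 2] L by simp
    note sp = size_parameters[of n d, folded L_def l_def k_def, OF L elim(2)[folded L_def]]
    have n1: "32 * 2 ^ d \<le> real n"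
    proof -
      have "1 * (32 * 2 ^ d) \<le> (100 * L\<^sup>2) * (32 * 2 ^ d :: real)" using L2 by (intro mult_right_mono) auto
      also have "\<dots> = 100 * L\<^sup>2 * 2 ^ (d + 5)" by (simp add: power_add)
      finally show ?thesis using elim(2) unfolding L_def by linarith
    qed
    have n0: "1 \<le> n"
    proof (rule ccontr)
      assume "\<not> 1 \<le> n"
      then have "real n = 0" by simp
      moreover have "(0::real) < 32 * 2 ^ d" by simp
      ultimately show False using n1 by linarith
    qed
    \<comment> \<open>The finest dyadic cell count M not above n: M \<le> n keeps the 2^M sets of
      cells within the union bound, and M > n / 2 keeps the lower bound of the right order.\<close>
    obtain l' where l': "2 ^ l' \<le> n" "n < 2 ^ (l' + 1)" using ex_power_ivl1[of 2 n] n0 by auto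
    define M where "M = (2 ^ l' :: real)"
    have nM: "real n \<le> 2 * M"
    proof -
      have "real n < real (2 ^ (l' + 1))" using l'(2) by (simp only: of_nat_less_iff)
      then show ?thesis by (simp add: M_def)
    qed
    have M1: "1 \<le> M" by (simp add: M_def)
    have M8: "8 * 2 ^ d \<le> M"
    proof -
      have "(0::real) < 2 ^ d" by simp
      then show ?thesis using n1 nM by linarith
    qed
    have KM: "2 ^ l \<le> M / L\<^sup>2"
    proof -
      have "2 ^ l \<le> real n / (2 * L\<^sup>2)" by (rule sp(2))
      also have "\<dots> \<le> (2 * M) / (2 * L\<^sup>2)" using nM by (intro divide_right_mono) auto
      finally show ?thesis by simp
    qed
    have ln: "2 ^ l \<le> n"
    proof -
      have "real n / (2 * L\<^sup>2) \<le> real n / 1" using L2 by (intro divide_left_mono) auto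
      then have "(2::real) ^ l \<le> real n" using sp(2) by linarith
      then have "real (2 ^ l) \<le> real n" by (simp only: of_nat_power of_nat_numeral)
      then show ?thesis by (simp only: of_nat_le_iff)
    qed
    show ?case
    proof (intro allI impI)
      fix ch :: "'d choices" assume ch: "valid_choices n e ch"
      have asg: "assign ch x \<in> {1..2 ^ l} \<and> x \<in> ordered_block e l (assign ch x)" if "x \<in> unit_cube" for x
        using ch that unfolding valid_choices_def l_def by blast
      have capr: "cap ch h T K j \<in> {T div K, T div K + 1}" if "K > 0" "j \<in> {1..K}" for h T K j
        using ch that unfolding valid_choices_def by blast
      have caps: "(\<Sum>j=1..K. cap ch h T K j) = T" if "K > 0" for h T K
        using ch that unfolding valid_choices_def by blast
      have spr: "spare ch h S \<in> {..<n} - S" if "S \<subset> {..<n}" for h S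
        using ch that unfolding valid_choices_def by blast
      have dl: "CARD('d) \<le> l" using sp(3) by (simp add: d_def)
      have small: "real ((n + 1)\<^sup>2 * n\<^sup>2) * (2 * exp (- L\<^sup>2 / 80000)) + (1 / 2) ^ n \<le> 1 / real n"
        using elim(3) by (simp add: L_def add_ac)
      obtain E where E: "E \<in> sets (uniform_input n :: (nat \<Rightarrow> real ^ 'd) measure)"
        "1 - 1 / real n \<le> measure (uniform_input n) E"
        "\<And>X t. X \<in> E \<Longrightarrow> t < n \<Longrightarrow> X t \<in> unit_cube"
        "\<And>X. X \<in> E \<Longrightarrow> (2 ^ l' / (4 * 2 ^ CARD('d)) - 1) * ((2 ^ l') powr (- 1 / real CARD('d)) / 2) \<le> opt_tour (map X [0..<n])"
        "\<And>X i j p q. X \<in> E \<Longrightarrow> 1 \<le> i \<Longrightarrow> i \<le> k \<Longrightarrow> j \<in> {1..2 ^ (l + 1 - i)} \<Longrightarrow> p \<le> q \<Longrightarrow> q \<le> n \<Longrightarrow>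
          \<bar>real (card {t \<in> {p..<q}. (assign ch (X t) - 1) div 2 ^ (i - 1) + 1 = j}) - real (q - p) / 2 ^ (l + 1 - i)\<bar>
            \<le> (real (q - p) / 2 ^ (l + 1 - i) + L\<^sup>2) / 200"
        using good_event[OF e dl sp(5) ln l'(1) asg zero_le_power2 small] by blast
      have "alg_cost n \<B> ch X \<le> D * (log 2 (real n))\<^sup>2 * opt_tour (map X [0..<n])" if X: "X \<in> E" for X
      proof -
        have gr: "good_run n \<B> ch X (L\<^sup>2)"
        proof
          show "\<bar>real (count_in ch X i j p q) - real (q - p) / real (bucket_count n i)\<bar>
              \<le> (real (q - p) / real (bucket_count n i) + L\<^sup>2) / 200"
            if "1 \<le> i" "i \<le> last_sub n" "j \<in> {1..bucket_count n i}" "p \<le> q" "q \<le> n" for i j p q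
            using E(5)[OF X that(1) _ _ that(4,5), of j] that(2,3)
            by (simp add: count_in_def bucket_of_def bucket_count_def k_def l_def)
        qed (use pl asg capr caps spr E(3)[OF X] sp L2 in \<open>auto simp: l_def k_def\<close>)
        interpret good_run n \<B> ch X "L\<^sup>2" by (rule gr)
        define \<Delta> where "\<Delta> = 2 * (real d * (2 * (2 ^ l) powr (- 1 / real d)))"
        define f where "f = (if d = 1 then 0 else 1 :: real)"
        have "alg_cost n \<B> ch X \<le> 2 * c0 * sqrt (L\<^sup>2) * \<Delta> * 2 ^ split_count n * (4 * real (last_sub n) + 8 * f * L\<^sup>2)
          + 4 * real (last_sub n) * 2 ^ split_count n * \<Delta> + real CARD('d) * real (last_sub n) + 200 * L\<^sup>2 * real CARD('d)"
        proof (rule alg_cost_le)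
          show "\<Delta> \<ge> 0" "f \<ge> 0" "c0 \<ge> 0" using c0 by (auto simp: \<Delta>_def f_def)
          show "real (n - (\<Sum>i=1..<last_sub n. sub_len n i)) \<le> 200 * L\<^sup>2" using sp(10) by (simp add: k_def)
          show "array_cost m (final_array \<B> m ps) \<le> c0 * sqrt (real m) * opt_tour ps"
            if "length ps = m" "set ps \<subseteq> unit_cube" for m ps by (rule comp[OF that])
          show "norm (x - y) \<le> (\<bar>real (assign ch x) - real (assign ch y)\<bar> + 1) * \<Delta>"
            if "x \<in> unit_cube" "y \<in> unit_cube" for x y
          proof -
            have "norm (x - y) \<le> (\<bar>real (assign ch x) - real (assign ch y)\<bar> + 1) * (real CARD('d) * (2 * (2 ^ l) powr (- 1 / real CARD('d))))"
              by (rule assigned_dist(2)[OF e dl]) (use asg that in auto)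
            also have "\<dots> \<le> (\<bar>real (assign ch x) - real (assign ch y)\<bar> + 1) * \<Delta>"
              by (intro mult_left_mono) (auto simp: \<Delta>_def d_def)
            finally show ?thesis .
          qed
          show "opt_tour ps \<le> (4 * 2 ^ (i - 1) + f * real (length ps)) * \<Delta>"
            if i: "1 \<le> i" "i \<le> last_sub n" and ps: "set ps \<subseteq> unit_cube" and b: "\<And>x. x \<in> set ps \<Longrightarrow> bucket_of ch i x = j" for i j ps
            unfolding \<Delta>_def f_def d_def
          proof (rule opt_tour_bucket[OF e dl, of ps "assign ch"])
            show "x \<in> ordered_block e l (assign ch x) \<and> 1 \<le> assign ch x" if "x \<in> set ps" for x
              using asg[of x] ps that by auto
            fix x y assume xy: "x \<in> set ps" "y \<in> set ps"
            have "\<bar>real (assign ch x) - real (assign ch y)\<bar> \<le> real (0 + 1) * 2 ^ (i - 1)"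
              by (rule bucket_of_dist) (use i xy b ps asg in auto)
            then show "\<bar>real (assign ch x) - real (assign ch y)\<bar> \<le> 2 ^ (i - 1)" by simp
          qed simp
        qed
        also have "\<dots> \<le> (128 * c0 + 234) * real d * L\<^sup>2 * M powr (1 - 1 / real d)"
          using cost_comparison[OF c0 d _ _ KM M1 sp(6)] L
          unfolding \<Delta>_def f_def l_def[symmetric] k_def[symmetric] d_def[symmetric] by simp
        also have "\<dots> = D * L\<^sup>2 * (M powr (1 - 1 / real d) / (16 * 2 ^ d))" by (simp add: D_def)
        also have "\<dots> \<le> D * L\<^sup>2 * opt_tour (map X [0..<n])"
        proof (rule mult_left_mono)
          have "M powr (1 - 1 / real d) / (16 * 2 ^ d) = M / (8 * 2 ^ d) * (M powr (- 1 / real d) / 2)"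
            using M1 by (simp add: powr_diff powr_minus_divide)
          also have "\<dots> \<le> (M / (4 * 2 ^ d) - 1) * (M powr (- 1 / real d) / 2)"
            using M8 by (intro mult_right_mono) (auto simp: field_simps)
          also have "\<dots> \<le> opt_tour (map X [0..<n])" using E(4)[OF X] by (simp add: M_def d_def)
          finally show "M powr (1 - 1 / real d) / (16 * 2 ^ d) \<le> opt_tour (map X [0..<n])" .
        qed (use c0 in \<open>simp add: D_def\<close>)
        finally show ?thesis by (simp add: L_def)
      qed
      then show "\<exists>E \<in> sets (uniform_input n :: (nat \<Rightarrow> real ^ 'd) measure).
        measure (uniform_input n) E \<ge> 1 - 1 / real n \<and>
        (\<forall>X\<in>E. alg_cost n \<B> ch X \<le> D * (log 2 (real n))\<^sup>2 * opt_tour (map X [0..<n]))"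
        using E(1,2) by blast
    qed
  qed
  then show ?thesis by blast
qed

end
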